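(* Let $\psi^0$ be a stochastic flow of measurable mappings in $M$ associated to a consistent sequence $(\mathsf P^{(n)}_\bullet:n\in\mathbb N)$ of coalescing Feller transition functions on $M$ satisfying (TF1), (TF2), (TF3) and (TF4), let $\varPhi$ be the associated random skeleton and let $\theta$ be the family of random mappings constructed from $\varPhi$ (see context). Then $\theta$ is a measurable continuous modification of $\psi^0$ that preserves the skeleton $\varPhi$; that is: $\theta_{s,s}(\omega,x)=x$; $(s,t,x,\omega)\mapsto\theta_{s,t}(\omega,x)$ is measurable; $t\mapsto\theta_{s,t}(\omega,x)$ is continuous on $[s,\infty)$ for all $(s,x,\omega)$; $\mathbb P[\theta_{s,t}(x)=\psi^0_{s,t}(x)]=1$ for all $s\le t$, $x\in M$; and $\theta_{s,t}(\varPhi_n(s))=\varPhi_n(t)$ for all $n$ and $t\ge s\ge s_n$.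
   Context: $(M,\rho)$ is a locally compact separable metric space, with $\rho$ complete and all bounded sets relatively compact; $\overline B(x,r)$ is the closed ball. Transition functions. For each $n$, $\mathsf P^{(n)}_\bullet=(\mathsf P^{(n)}_t)_{t\ge0}$ is a Feller transition function on $M^n$; conditions: (TF1) for $\{i_1,\dots,i_k\}\subset\{1,\dots,n\}$, $\mathsf P^{(n)}_t(x,\pi^{-1}_{i_1,\dots,i_k}B)=\mathsf P^{(k)}_t(\pi_{i_1,\dots,i_k}x,B)$, where $\pi_{i_1,\dots,i_k}x=(x_{i_1},\dots,x_{i_k})$; (TF2) $\mathsf P^{(2)}_t((x,x),\Delta)=1$ with $\Delta$ the diagonal of $M^2$; a sequence satisfying (TF1),(TF2) is a consistent sequence of coalescing Feller transition functions. (TF3) for every compact $K\subset M$ and $r>0$, $\lim_{t\downarrow0}t^{-1}\sup_{x\in K}\mathsf P^{(1)}_t(x,\{y:\rho(x,y)>r\})=0$. $\mathbb P^{(n)}_x$ is the law on $C([0,\infty):M^n)$ of the Markov process with transition function $\mathsf P^{(n)}_\bullet$ started at $x$; for $n=2$ the canonical process is $(X,Y)$. Flows. A stochastic flow of measurable mappings associated to $(\mathsf P^{(n)}_\bullet)$ is a family $\psi=(\psi_{s,t})_{s\le t}$ of random elements, on a probability space $(\Omega,\mathcal A,\mathbb P)$, of the space $\mathsf F$ of measurable maps $M\to M$ (with the cylindrical $\sigma$-field) such that: (SF1) $\mathbb E f(\psi_{s,t}(x_1),\dots,\psi_{s,t}(x_n))=\mathsf P^{(n)}_{t-s}f(x)$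 for $f\in C_0(M^n)$; (SF2) there are measurable $\mathcal J_t:\mathsf F\times M\to M$, $t\ge0$, such that for all $s\le t\le u$, $x$: $\mathcal J_{t-s}(\psi_{s,t})(x)=\psi_{s,t}(x)$ a.s., $\psi_{s,u}(x)=\mathcal J_{u-t}(\psi_{t,u})\circ\psi_{s,t}(x)$ a.s., $\psi_{s,s}(x)=x$; (SF3) $\psi_{t_1,t_2},\dots,\psi_{t_{n-1},t_n}$ are independent for $t_1\le\dots\le t_n$; (SF4) for $f\in C_0(M)$, $\lim_{(u,v)\to(s,t)}\sup_x\mathbb E[(f(\psi_{u,v}(x))-f(\psi_{s,t}(x)))^2]=0$; (SF5) for $f\in C_0(M)$, $\lim_{y\to x}\mathbb E[(f(\psi_{s,t}(y))-f(\psi_{s,t}(x)))^2]=0$ and $\lim_{y\to\infty}\mathbb E[f(\psi_{s,t}(y))^2]=0$. Path space and skeletons. $X=\bigcup_{s}C([s,\infty):M)$; for $f\in C([s,\infty):M)$, $i(f)=s$, $e(f)(t)=f(s\vee t)$; metric $d(f,g)=|i(f)-i(g)|+\delta(e(f),e(g))$ with $\delta$ a metric of locally uniform convergence on $C(\mathbb R:M)$; $d_0$ is the restriction of $d$ to $C([0,\infty):M)$; $fI$ is the restriction of $e(f)$ to $I$. For $\varphi\in X^{\mathbb N}$: $s_n=i(\varphi_n)$, $x_n=\varphi_n(s_n)$, $I^s=\{n:s_n\le s\}$. $\varphi$ is a skeleton ($\varphi\in\mathcal S(M)$) if (1) $m,n\in I^s$, $\varphi_m(s)=\varphi_n(s)$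 imply $\varphi_m=\varphi_n$ on $[s,\infty)$; (2) $\{(s_n,x_n)\}$ is dense in $\mathbb R\times M$; (3) for every compact $L\subset\mathbb R\times M$, $\{\varphi_n[s,\infty):n\in I^s,(s,\varphi_n(s))\in L\}$ is relatively compact in $X$. Random skeleton. Fix a countable dense set $\{(s_n,x_n):n\in\mathbb N\}$ of $\mathbb R\times M$; $\varPhi=(\varPhi_n)$, where $\varPhi_n$ is a continuous modification of $\psi^0_{s_n,\cdot}(x_n)$ with $\varPhi_n(s_n)=x_n$. (TF4): $\varPhi\in\mathcal S(M)$ a.s. One restricts to an event of full measure on which $\varPhi$ is a skeleton. $\theta$. Fix a measurable $\ell:X^{\mathbb N}\to X$ sending each relatively compact sequence to one of its limit points. Let $\varepsilon_k(x)=2^{-k}\wedge\inf\{r>0:\sup_{y\in\overline B(x,r)}\mathbb P^{(2)}_{(x,y)}[d_0(X,Y)\ge2^{-k}]>2^{-k}\}$ (these are positive measurable functions, non-increasing in $k$, tending to $0$), $n^{s,x}_k=\inf\{n\in I^s:\rho(\varPhi_n(s),x)<\varepsilon_k(x)\}$, $\varPhi^{s,x}_k=\varPhi_{n^{s,x}_k}[s,\infty)$, and $\theta_{s,\cdot}(x)=\ell((\varPhi^{s,x}_k)_{k\in\mathbb N})$. *)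

theory Defs
  imports "HOL-Probability.Probability"
begin

section \<open>The state space and its powers\<close>

text \<open>
  The state space \<open>M\<close> is a type of class \<^class>\<open>heine_borel\<close> (every bounded sequence has a convergent
  subsequence, that is, bounded sets are relatively compact) and \<^class>\<open>polish_space\<close> (complete and
  separable).  The power \<open>M\<^sup>n\<close> consists of the extensional functions on \<open>{..<n}\<close>, so that coordinates
  are numbered from \<open>0\<close>.
\<close>

definition Mpow :: "nat \<Rightarrow> (nat \<Rightarrow> 'a::{heine_borel,polish_space}) measure"
  where "Mpow n = PiM {..<n} (\<lambda>_. borel)"

definition Mpow_top :: "nat \<Rightarrow> (nat \<Rightarrow> 'a::{heine_borel,polish_space}) topology"
  where "Mpow_top n = product_topology (\<lambda>_. euclidean) {..<n}"

definition single :: "'a \<Rightarrow> nat \<Rightarrow> 'a"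
  where "single x = (\<lambda>i\<in>{..<1}. x)"

definition pair :: "'a \<Rightarrow> 'a \<Rightarrow> nat \<Rightarrow> 'a"
  where "pair x y = (\<lambda>i\<in>{..<2}. if i = 0 then x else y)"

definition proj :: "nat \<Rightarrow> (nat \<Rightarrow> nat) \<Rightarrow> (nat \<Rightarrow> 'a) \<Rightarrow> nat \<Rightarrow> 'a"
  where "proj k i x = (\<lambda>j\<in>{..<k}. x (i j))"

definition vanishes_at_infinity :: "'b topology \<Rightarrow> ('b \<Rightarrow> real) \<Rightarrow> bool"
  where "vanishes_at_infinity T f \<longleftrightarrow>
    (\<forall>e>0. \<exists>K. compactin T K \<and> (\<forall>x\<in>topspace T - K. \<bar>f x\<bar> < e))"

definition C0 :: "'b topology \<Rightarrow> ('b \<Rightarrow> real) set"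
  where "C0 T = {f. continuous_map T euclideanreal f \<and> vanishes_at_infinity T f}"

definition relatively_compact_in :: "'b topology \<Rightarrow> 'b set \<Rightarrow> bool"
  where "relatively_compact_in T S \<longleftrightarrow> S \<subseteq> topspace T \<and> compactin T (T closure_of S)"


section \<open>Transition functions\<close>

type_synonym 'a transition = "nat \<Rightarrow> real \<Rightarrow> (nat \<Rightarrow> 'a) \<Rightarrow> (nat \<Rightarrow> 'a) measure"

text \<open>\<open>P n t x\<close> is the probability measure \<open>P\<^sup>(\<^sup>n\<^sup>)\<^sub>t(x, _)\<close> on \<open>M\<^sup>n\<close>.\<close>

definition feller_transition_function ::
    "nat \<Rightarrow> (real \<Rightarrow> (nat \<Rightarrow> 'a::{heine_borel,polish_space}) \<Rightarrow> (nat \<Rightarrow> 'a) measure) \<Rightarrow> bool"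
  where "feller_transition_function n Q \<longleftrightarrow>
    (\<forall>t\<ge>0. Q t \<in> Mpow n \<rightarrow>\<^sub>M prob_algebra (Mpow n)) \<and>
    (\<forall>x\<in>space (Mpow n). Q 0 x = return (Mpow n) x) \<and>
    (\<forall>s\<ge>0. \<forall>t\<ge>0. \<forall>x\<in>space (Mpow n). Q (s + t) x = Q s x \<bind> Q t) \<and>
    (\<forall>t\<ge>0. \<forall>f\<in>C0 (Mpow_top n). (\<lambda>x. \<integral>y. f y \<partial>Q t x) \<in> C0 (Mpow_top n)) \<and>
    (\<forall>f\<in>C0 (Mpow_top n).
      ((\<lambda>t. SUP x\<in>space (Mpow n). \<bar>(\<integral>y. f y \<partial>Q t x) - f x\<bar>) \<longlongrightarrow> 0) (at_right 0))"

definition TF1 :: "'a::{heine_borel,polish_space} transition \<Rightarrow> bool"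
  where "TF1 P \<longleftrightarrow>
    (\<forall>n\<ge>1. \<forall>k\<ge>1. \<forall>i. inj_on i {..<k} \<and> i ` {..<k} \<subseteq> {..<n} \<longrightarrow>
      (\<forall>t\<ge>0. \<forall>x\<in>space (Mpow n). \<forall>B\<in>sets (Mpow k).
        emeasure (P n t x) (proj k i -` B \<inter> space (Mpow n)) = emeasure (P k t (proj k i x)) B))"

definition TF2 :: "'a::{heine_borel,polish_space} transition \<Rightarrow> bool"
  where "TF2 P \<longleftrightarrow>
    (\<forall>t\<ge>0. \<forall>x. emeasure (P 2 t (pair x x)) {z\<in>space (Mpow 2). z 0 = z 1} = 1)"

definition consistent_coalescing :: "'a::{heine_borel,polish_space} transition \<Rightarrow> bool"
  where "consistent_coalescing P \<longleftrightarrow>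
    (\<forall>n\<ge>1. feller_transition_function n (P n)) \<and> TF1 P \<and> TF2 P"

text \<open>The empty compact set is excluded because the supremum of \<open>{}\<close> in \<^typ>\<open>real\<close> is unspecified.\<close>

definition TF3 :: "'a::{heine_borel,polish_space} transition \<Rightarrow> bool"
  where "TF3 P \<longleftrightarrow>
    (\<forall>K. \<forall>r>0. compact K \<and> K \<noteq> {} \<longrightarrow>
      ((\<lambda>t. (SUP x\<in>K. measure (P 1 t (single x)) {y\<in>space (Mpow 1). dist x (y 0) > r}) / t)
        \<longlongrightarrow> 0) (at_right 0))"


section \<open>Laws of the Markov processes\<close>

text \<open>\<open>C([0,\<infinity>) : M\<^sup>n)\<close> with the \<open>\<sigma>\<close>-algebra generated by the coordinate maps.\<close>

definition Cpow :: "nat \<Rightarrow> (real \<Rightarrow> nat \<Rightarrow> 'a::{heine_borel,polish_space}) measure"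
  where "Cpow n = restrict_space (PiM {0..} (\<lambda>_. Mpow n))
    {w. continuous_map (top_of_set {0..}) (Mpow_top n) w}"

definition past :: "nat \<Rightarrow> real \<Rightarrow> (real \<Rightarrow> nat \<Rightarrow> 'a::{heine_borel,polish_space}) set set"
  where "past n s = sigma_sets (space (Cpow n))
    {{w\<in>space (Cpow n). w u \<in> C} | u C. 0 \<le> u \<and> u \<le> s \<and> C \<in> sets (Mpow n)}"

definition is_path_law ::
    "'a::{heine_borel,polish_space} transition \<Rightarrow> nat \<Rightarrow> (nat \<Rightarrow> 'a) \<Rightarrow> (real \<Rightarrow> nat \<Rightarrow> 'a) measure \<Rightarrow> bool"
  where "is_path_law P n x Q \<longleftrightarrow>
    prob_space Q \<and> sets Q = sets (Cpow n) \<and>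
    (AE w in Q. w 0 = x) \<and>
    (\<forall>s\<ge>0. \<forall>t\<ge>0. \<forall>A\<in>past n s. \<forall>B\<in>sets (Mpow n).
      emeasure Q {w\<in>A. w (s + t) \<in> B} = (\<integral>\<^sup>+w\<in>A. emeasure (P n t (w s)) B \<partial>Q))"

definition path_law ::
    "'a::{heine_borel,polish_space} transition \<Rightarrow> nat \<Rightarrow> (nat \<Rightarrow> 'a) \<Rightarrow> (real \<Rightarrow> nat \<Rightarrow> 'a) measure"
  where "path_law P n x = (THE Q. is_path_law P n x Q)"


section \<open>Stochastic flows of measurable mappings\<close>

definition Fspace :: "('a::{heine_borel,polish_space} \<Rightarrow> 'a) measure"
  where "Fspace = restrict_space (PiM UNIV (\<lambda>_. borel)) {f. f \<in> borel \<rightarrow>\<^sub>M borel}"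

definition SF1 ::
    "'a::{heine_borel,polish_space} transition \<Rightarrow> 'w measure \<Rightarrow> (real \<Rightarrow> real \<Rightarrow> 'w \<Rightarrow> 'a \<Rightarrow> 'a) \<Rightarrow> bool"
  where "SF1 P \<Omega> \<psi> \<longleftrightarrow>
    (\<forall>n\<ge>1. \<forall>s t. s \<le> t \<longrightarrow> (\<forall>f\<in>C0 (Mpow_top n). \<forall>x\<in>space (Mpow n).
      (\<integral>\<omega>. f (\<lambda>i\<in>{..<n}. \<psi> s t \<omega> (x i)) \<partial>\<Omega>) = (\<integral>y. f y \<partial>P n (t - s) x)))"

definition SF2 ::
    "'w measure \<Rightarrow> (real \<Rightarrow> real \<Rightarrow> 'w \<Rightarrow> 'a::{heine_borel,polish_space} \<Rightarrow> 'a) \<Rightarrow> bool"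
  where "SF2 \<Omega> \<psi> \<longleftrightarrow>
    (\<exists>J :: real \<Rightarrow> ('a \<Rightarrow> 'a) \<Rightarrow> 'a \<Rightarrow> 'a.
      (\<forall>t\<ge>0. (\<lambda>(g, x). J t g x) \<in> Fspace \<Otimes>\<^sub>M borel \<rightarrow>\<^sub>M borel) \<and>
      (\<forall>s t u x. s \<le> t \<and> t \<le> u \<longrightarrow>
        (AE \<omega> in \<Omega>. J (t - s) (\<psi> s t \<omega>) x = \<psi> s t \<omega> x) \<and>
        (AE \<omega> in \<Omega>. \<psi> s u \<omega> x = J (u - t) (\<psi> t u \<omega>) (\<psi> s t \<omega> x)) \<and>
        (\<forall>\<omega>\<in>space \<Omega>. \<psi> s s \<omega> x = x)))"

definition SF3 ::
    "'w measure \<Rightarrow> (real \<Rightarrow> real \<Rightarrow> 'w \<Rightarrow> 'a::{heine_borel,polish_space} \<Rightarrow> 'a) \<Rightarrow> bool"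
  where "SF3 \<Omega> \<psi> \<longleftrightarrow>
    (\<forall>n. \<forall>t :: nat \<Rightarrow> real. (\<forall>i<n. t i \<le> t (Suc i)) \<longrightarrow>
      prob_space.indep_vars \<Omega> (\<lambda>_. Fspace) (\<lambda>i. \<psi> (t i) (t (Suc i))) {..<n})"

definition SF4 ::
    "'w measure \<Rightarrow> (real \<Rightarrow> real \<Rightarrow> 'w \<Rightarrow> 'a::{heine_borel,polish_space} \<Rightarrow> 'a) \<Rightarrow> bool"
  where "SF4 \<Omega> \<psi> \<longleftrightarrow>
    (\<forall>f\<in>C0 euclidean. \<forall>s t. s \<le> t \<longrightarrow>
      ((\<lambda>(u, v). SUP x. \<integral>\<omega>. (f (\<psi> u v \<omega> x) - f (\<psi> s t \<omega> x))\<^sup>2 \<partial>\<Omega>) \<longlongrightarrow> 0)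
        (at (s, t) within {(u, v). u \<le> v}))"

definition SF5 ::
    "'w measure \<Rightarrow> (real \<Rightarrow> real \<Rightarrow> 'w \<Rightarrow> 'a::{heine_borel,polish_space} \<Rightarrow> 'a) \<Rightarrow> bool"
  where "SF5 \<Omega> \<psi> \<longleftrightarrow>
    (\<forall>f\<in>C0 euclidean. \<forall>s t. s \<le> t \<longrightarrow>
      (\<forall>x. ((\<lambda>y. \<integral>\<omega>. (f (\<psi> s t \<omega> y) - f (\<psi> s t \<omega> x))\<^sup>2 \<partial>\<Omega>) \<longlongrightarrow> 0) (at x)) \<and>
      vanishes_at_infinity euclidean (\<lambda>y. \<integral>\<omega>. (f (\<psi> s t \<omega> y))\<^sup>2 \<partial>\<Omega>))"

definition stochastic_flow ::
    "'a::{heine_borel,polish_space} transition \<Rightarrow> 'w measure \<Rightarrow> (real \<Rightarrow> real \<Rightarrow> 'w \<Rightarrow> 'a \<Rightarrow> 'a) \<Rightarrow> bool"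
  where "stochastic_flow P \<Omega> \<psi> \<longleftrightarrow>
    prob_space \<Omega> \<and> (\<forall>s t. s \<le> t \<longrightarrow> \<psi> s t \<in> \<Omega> \<rightarrow>\<^sub>M Fspace) \<and>
    SF1 P \<Omega> \<psi> \<and> SF2 \<Omega> \<psi> \<and> SF3 \<Omega> \<psi> \<and> SF4 \<Omega> \<psi> \<and> SF5 \<Omega> \<psi>"


section \<open>Path space and skeletons\<close>

text \<open>
  An element of \<open>C([s,\<infinity>) : M)\<close> is the pair of its initial time \<open>s\<close> and a function that is continuous
  on \<open>[s,\<infinity>)\<close> and \<^const>\<open>undefined\<close> before \<open>s\<close>.  Hence \<open>i(f)\<close> is \<^term>\<open>fst f\<close> and \<open>f(t)\<close> is
  \<^term>\<open>snd f t\<close> for \<open>t \<ge> i(f)\<close>.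
\<close>

type_synonym 'a path = "real \<times> (real \<Rightarrow> 'a)"

definition paths :: "'a::metric_space path set"
  where "paths = {(s, f). f \<in> extensional {s..} \<and> continuous_on {s..} f}"

definition extend :: "'a path \<Rightarrow> real \<Rightarrow> 'a"
  where "extend f t = snd f (max (fst f) t)"

definition restrict_from :: "real \<Rightarrow> 'a path \<Rightarrow> 'a path"
  where "restrict_from s f = (s, restrict (extend f) {s..})"

definition loc_unif_metric :: "((real \<Rightarrow> 'a::metric_space) \<Rightarrow> (real \<Rightarrow> 'a) \<Rightarrow> real) \<Rightarrow> bool"
  where "loc_unif_metric \<delta> \<longleftrightarrow>
    Metric_space {f. continuous_on UNIV f} \<delta> \<and>
    (\<forall>F f. (\<forall>n. continuous_on UNIV (F n)) \<and> continuous_on UNIV f \<longrightarrow>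
      ((\<lambda>n. \<delta> (F n) f) \<longlonglongrightarrow> 0) = (\<forall>K. compact K \<longrightarrow> uniform_limit K F f sequentially))"

definition path_dist ::
    "((real \<Rightarrow> 'a) \<Rightarrow> (real \<Rightarrow> 'a) \<Rightarrow> real) \<Rightarrow> 'a path \<Rightarrow> 'a path \<Rightarrow> real"
  where "path_dist \<delta> f g = \<bar>fst f - fst g\<bar> + \<delta> (extend f) (extend g)"

definition path_topology ::
    "((real \<Rightarrow> 'a::metric_space) \<Rightarrow> (real \<Rightarrow> 'a) \<Rightarrow> real) \<Rightarrow> 'a path topology"
  where "path_topology \<delta> = Metric_space.mtopology paths (path_dist \<delta>)"

definition path_borel ::
    "((real \<Rightarrow> 'a::metric_space) \<Rightarrow> (real \<Rightarrow> 'a) \<Rightarrow> real) \<Rightarrow> 'a path measure"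
  where "path_borel \<delta> = sigma paths {U. openin (path_topology \<delta>) U}"

lemma continuous_on_extend:
  assumes "f \<in> paths"
  shows "continuous_on UNIV (extend f)"
proof -
  have "continuous_on {fst f..} (snd f)"
    using assms by (auto simp: paths_def)
  then have "continuous_on UNIV (\<lambda>t. snd f (max (fst f) t))"
    by (rule continuous_on_compose2) (auto intro!: continuous_intros)
  then show ?thesis
    by (simp add: extend_def[abs_def])
qed

lemma extend_inject:
  assumes "f \<in> paths" "g \<in> paths" "fst f = fst g" "extend f = extend g"
  shows "f = g"
proof (rule prod_eqI)
  show "snd f = snd g"
  proof (rule extensionalityI)
    show "snd f \<in> extensional {fst f..}" "snd g \<in> extensional {fst f..}"
      using assms by (auto simp: paths_def)
    show "snd f t = snd g t" if "t \<in> {fst f..}" for t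
      using fun_cong[OF assms(4), of t] that assms(3) by (auto simp: extend_def max_def)
  qed
qed (fact assms)

lemma Metric_space_path_dist:
  assumes "loc_unif_metric \<delta>"
  shows "Metric_space paths (path_dist \<delta>)"
proof -
  interpret D: Metric_space "{f. continuous_on UNIV f}" \<delta>
    using assms by (simp add: loc_unif_metric_def)
  show ?thesis
  proof
    show "0 \<le> path_dist \<delta> f g" for f g
      by (simp add: path_dist_def)
    show "path_dist \<delta> f g = path_dist \<delta> g f" for f g
      by (simp add: path_dist_def D.commute abs_minus_commute)
    show "path_dist \<delta> f g = 0 \<longleftrightarrow> f = g" if "f \<in> paths" "g \<in> paths" for f g
    proof -
      have eq: "\<delta> (extend f) (extend g) = 0 \<longleftrightarrow> extend f = extend g"
        using that by (simp add: continuous_on_extend)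
      have "path_dist \<delta> f g = 0 \<longleftrightarrow> fst f = fst g \<and> \<delta> (extend f) (extend g) = 0"
        using D.nonneg[of "extend f" "extend g"] by (simp add: path_dist_def add_nonneg_eq_0_iff)
      then show ?thesis
        using eq extend_inject[OF that] by auto
    qed
    show "path_dist \<delta> f h \<le> path_dist \<delta> f g + path_dist \<delta> g h"
      if "f \<in> paths" "g \<in> paths" "h \<in> paths" for f g h
      using D.triangle[of "extend f" "extend g" "extend h"] that
      by (simp add: path_dist_def continuous_on_extend)
  qed
qed

definition active :: "(nat \<Rightarrow> 'a path) \<Rightarrow> real \<Rightarrow> nat set"
  where "active \<phi> s = {n. fst (\<phi> n) \<le> s}"

definition skeletons ::
    "((real \<Rightarrow> 'a::metric_space) \<Rightarrow> (real \<Rightarrow> 'a) \<Rightarrow> real) \<Rightarrow> (nat \<Rightarrow> 'a path) set"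
  where "skeletons \<delta> = {\<phi>. range \<phi> \<subseteq> paths \<and>
    (\<forall>s. \<forall>m\<in>active \<phi> s. \<forall>n\<in>active \<phi> s. snd (\<phi> m) s = snd (\<phi> n) s \<longrightarrow>
      (\<forall>t\<ge>s. snd (\<phi> m) t = snd (\<phi> n) t)) \<and>
    closure (range (\<lambda>n. (fst (\<phi> n), snd (\<phi> n) (fst (\<phi> n))))) = UNIV \<and>
    (\<forall>L. compact L \<longrightarrow> relatively_compact_in (path_topology \<delta>)
      {restrict_from s (\<phi> n) | s n. n \<in> active \<phi> s \<and> (s, snd (\<phi> n) s) \<in> L})}"

definition random_skeleton ::
    "'w measure \<Rightarrow> (real \<Rightarrow> real \<Rightarrow> 'w \<Rightarrow> 'a::metric_space \<Rightarrow> 'a) \<Rightarrow> (nat \<Rightarrow> real) \<Rightarrow> (nat \<Rightarrow> 'a) \<Rightarrow>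
      ('w \<Rightarrow> nat \<Rightarrow> 'a path) \<Rightarrow> bool"
  where "random_skeleton \<Omega> \<psi> S X \<Phi> \<longleftrightarrow> (\<forall>n.
    (\<forall>\<omega>\<in>space \<Omega>. \<Phi> \<omega> n \<in> paths \<and> fst (\<Phi> \<omega> n) = S n \<and> snd (\<Phi> \<omega> n) (S n) = X n) \<and>
    (\<forall>t\<ge>S n. (\<lambda>\<omega>. snd (\<Phi> \<omega> n) t) \<in> \<Omega> \<rightarrow>\<^sub>M borel \<and>
      (AE \<omega> in \<Omega>. snd (\<Phi> \<omega> n) t = \<psi> (S n) t \<omega> (X n))))"


section \<open>The mappings constructed from a skeleton\<close>

definition limit_point_selector ::
    "((real \<Rightarrow> 'a::metric_space) \<Rightarrow> (real \<Rightarrow> 'a) \<Rightarrow> real) \<Rightarrow> ((nat \<Rightarrow> 'a path) \<Rightarrow> 'a path) \<Rightarrow> bool"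
  where "limit_point_selector \<delta> l \<longleftrightarrow>
    l \<in> PiM UNIV (\<lambda>_. path_borel \<delta>) \<rightarrow>\<^sub>M path_borel \<delta> \<and>
    (\<forall>\<phi>. relatively_compact_in (path_topology \<delta>) (range \<phi>) \<longrightarrow>
      (\<exists>r :: nat \<Rightarrow> nat. strict_mono r \<and> limitin (path_topology \<delta>) (\<phi> \<circ> r) (l \<phi>) sequentially))"

definition coord_path :: "nat \<Rightarrow> (real \<Rightarrow> nat \<Rightarrow> 'a) \<Rightarrow> 'a path"
  where "coord_path i w = (0, \<lambda>t\<in>{0..}. w t i)"

definition separation_prob ::
    "'a::{heine_borel,polish_space} transition \<Rightarrow> ((real \<Rightarrow> 'a) \<Rightarrow> (real \<Rightarrow> 'a) \<Rightarrow> real) \<Rightarrow>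
      nat \<Rightarrow> 'a \<Rightarrow> 'a \<Rightarrow> real"
  where "separation_prob P \<delta> k x y = measure (path_law P 2 (pair x y))
    {w\<in>space (Cpow 2). path_dist \<delta> (coord_path 0 w) (coord_path 1 w) \<ge> 1 / 2 ^ k}"

text \<open>The infimum is taken in \<^typ>\<open>ereal\<close>, so that it equals \<open>\<infinity>\<close> if there is no such radius.\<close>

definition eps ::
    "'a::{heine_borel,polish_space} transition \<Rightarrow> ((real \<Rightarrow> 'a) \<Rightarrow> (real \<Rightarrow> 'a) \<Rightarrow> real) \<Rightarrow>
      nat \<Rightarrow> 'a \<Rightarrow> real"
  where "eps P \<delta> k x = real_of_ereal (min (ereal (1 / 2 ^ k))
    (INF r\<in>{r. r > 0 \<and> (SUP y\<in>cball x r. separation_prob P \<delta> k x y) > 1 / 2 ^ k}. ereal r))"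

definition approx_index ::
    "'a::{heine_borel,polish_space} transition \<Rightarrow> ((real \<Rightarrow> 'a) \<Rightarrow> (real \<Rightarrow> 'a) \<Rightarrow> real) \<Rightarrow>
      (nat \<Rightarrow> 'a path) \<Rightarrow> real \<Rightarrow> 'a \<Rightarrow> nat \<Rightarrow> nat"
  where "approx_index P \<delta> \<phi> s x k =
    (LEAST n. n \<in> active \<phi> s \<and> dist (snd (\<phi> n) s) x < eps P \<delta> k x)"

definition theta ::
    "'a::{heine_borel,polish_space} transition \<Rightarrow> ((real \<Rightarrow> 'a) \<Rightarrow> (real \<Rightarrow> 'a) \<Rightarrow> real) \<Rightarrow>
      ((nat \<Rightarrow> 'a path) \<Rightarrow> 'a path) \<Rightarrow> (nat \<Rightarrow> 'a path) \<Rightarrow> real \<Rightarrow> real \<Rightarrow> 'a \<Rightarrow> 'a"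
  where "theta P \<delta> l \<phi> s t x =
    snd (l (\<lambda>k. restrict_from s (\<phi> (approx_index P \<delta> \<phi> s x k)))) t"

end

theory Submission
  imports Defs
begin

text \<open>
  Relative compactness of the skeleton replaces all tightness estimates.  A sequence of paths in the
  closure of the skeleton that converges in probability at rational times converges locally
  uniformly almost surely along a subsequence.  Applied to \<open>\<Phi>\<^sub>n\<close> with \<open>(s\<^sub>n, x\<^sub>n) \<rightarrow> (s, y)\<close>, this gives
  a continuous modification \<open>\<Psi>\<close> of \<open>\<psi>\<^sub>s\<^sub>,\<^sub>\<cdot>(y)\<close> for every \<open>(s, y)\<close>, and it shows that \<open>\<Psi>\<close> depends on \<open>y\<close>
  continuously in probability.  By the independence of past and future, the law of a pair of such
  paths, shifted to time \<open>0\<close>, is the two-point path law.  Hence the separation probability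
  is upper semicontinuous and vanishes on the diagonal, which makes \<open>\<epsilon>\<^sub>k\<close> positive and measurable.

  Conditionally on the past of \<open>s\<close>, the path \<open>\<Phi>\<^sub>n\<close> after time \<open>s\<close> is the flow started at \<open>\<Phi>\<^sub>n(s)\<close>.  So the
  paths chosen by \<open>\<theta>\<close> are \<open>2\<^sup>-\<^sup>k\<close>-close to \<open>\<Psi>\<close> except with probability at most \<open>2\<^sup>-\<^sup>k\<close>, and by the
  Borel-Cantelli lemma they converge to \<open>\<Psi>\<close>.
\<close>

text \<open>The obstacle is that a flow of measurable mappings cannot simply be evaluated at a
  random point: \<open>(g, x) \<mapsto> g x\<close> need not be jointly measurable for the
  cylindrical \<sigma>-field. The flow at \<open>\<Phi>\<^sub>n(s)\<close> is therefore written with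
  the jointly measurable maps \<open>J\<close>, and every statement about a random starting point is
  reduced to fixed ones, either by integrating over an independent copy of the increment or by
  approximation with points of a countable dense set. Continuous modifications differ from the flow
  on null sets, so the \<sigma>-algebras of past and future are built from events that agree with
  flow events only almost surely. Starting times may approach \<open>s\<close> from the right.
  Convergence is thus obtained at times strictly after \<open>s\<close> only, and the value at
  \<open>s\<close> comes from the starting points. The number 2^-k bounds both a distance and a
  probability: the first makes the chosen paths converge, the second is summable over k.\<close>

lemma dist_le_open_interval_Rats:
  fixes f g :: "real \<Rightarrow> 'a::metric_space"
  assumes "continuous_on UNIV f" "continuous_on UNIV g"
    and le: "\<And>t. t \<in> \<rat> \<Longrightarrow> p < t \<Longrightarrow> t < q \<Longrightarrow> dist (f t) (g t) \<le> e"
    and t: "p < t" "t < q"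
  shows "dist (f t) (g t) \<le> e"
proof -
  have "closed {t. dist (f t) (g t) \<le> e}"
    using assms(1,2) by (intro closed_Collect_le continuous_intros) auto
  moreover have "{p<..<q} \<inter> \<rat> \<subseteq> {t. dist (f t) (g t) \<le> e}"
    using le by auto
  ultimately have "closure ({p<..<q} \<inter> \<rat>) \<subseteq> {t. dist (f t) (g t) \<le> e}"
    by (rule closure_minimal[rotated])
  moreover have "{p<..<q} \<subseteq> closure ({p<..<q} \<inter> \<rat>)"
    using open_Int_closure_subset[of "{p<..<q}" "\<rat>"] by (simp add: Rats_closure_real)
  ultimately show ?thesis
    using t by (metis (no_types, lifting) greaterThanLessThan_iff mem_Collect_eq subsetD)
qed

lemma continuous_eq_on_Rats_imp_eq:
  fixes f g :: "real \<Rightarrow> 'a::metric_space"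
  assumes "continuous_on UNIV f" "continuous_on UNIV g"
    and eq: "\<And>t. t \<in> \<rat> \<Longrightarrow> s < t \<Longrightarrow> f t = g t" and t: "s < t"
  shows "f t = g t"
  using dist_le_open_interval_Rats[OF assms(1,2), where p=s and q="t+1" and e=0 and t=t] eq t by simp

lemma continuous_right_eq:
  fixes f g :: "real \<Rightarrow> 'a::metric_space"
  assumes "continuous_on UNIV f" "continuous_on UNIV g"
    and eq: "\<And>t. s < t \<Longrightarrow> f t = g t"
  shows "f s = g s"
proof -
  have "closed {t. dist (f t) (g t) \<le> 0}"
    using assms(1,2) by (intro closed_Collect_le continuous_intros) auto
  then have "closure {s<..} \<subseteq> {t. dist (f t) (g t) \<le> 0}"
    by (rule closure_minimal[rotated]) (auto simp: eq)
  then show ?thesis by auto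
qed

section \<open>Path space\<close>

lemma extend_restrict_from: "extend (restrict_from s f) t = extend f (max s t)"
  by (simp add: extend_def restrict_from_def)

lemma fst_restrict_from [simp]: "fst (restrict_from s f) = s"
  by (simp add: restrict_from_def)

lemma paths_iff: "f \<in> paths \<longleftrightarrow> snd f \<in> extensional {fst f..} \<and> continuous_on {fst f..} (snd f)"
  by (cases f) (simp add: paths_def)

lemma restrict_from_paths:
  assumes "f \<in> paths" shows "restrict_from s f \<in> paths"
proof -
  have "continuous_on {s..} (restrict (extend f) {s..})"
    using continuous_on_extend[OF assms]
    by (subst continuous_on_cong[OF refl, of _ _ "extend f"]) (auto intro: continuous_on_subset)
  then show ?thesis by (auto simp: restrict_from_def paths_def)
qed

lemma extend_eq_snd: "fst f \<le> t \<Longrightarrow> extend f t = snd f t"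
  by (simp add: extend_def max_def)

lemma restrict_from_fst: "f \<in> paths \<Longrightarrow> restrict_from (fst f) f = f"
  by (rule extend_inject) (auto simp: restrict_from_paths extend_restrict_from fun_eq_iff, simp add: extend_def)

text \<open>Limits are identified at rational times strictly after the start. Density and continuity
  give all later times, continuity from the right gives the start itself, and before it
  \<open>extend\<close> is constant.\<close>

lemma paths_eqI_right:
  assumes f: "f \<in> paths" and g: "g \<in> paths" and "fst f = fst g"
    and eq: "\<And>t. t \<in> \<rat> \<Longrightarrow> fst f < t \<Longrightarrow> extend f t = extend g t"
  shows "f = g"
proof (rule extend_inject[OF f g \<open>fst f = fst g\<close>], rule ext)
  fix t
  have gt: "extend f t = extend g t" if "fst f < t" for t
    using continuous_eq_on_Rats_imp_eq[OF continuous_on_extend[OF f] continuous_on_extend[OF g] eq that] .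
  have eq': "extend f (fst f) = extend g (fst f)"
    by (rule continuous_right_eq[OF continuous_on_extend[OF f] continuous_on_extend[OF g] gt])
  show "extend f t = extend g t"
  proof (cases "fst f < t")
    case False
    then show ?thesis
      using eq' \<open>fst f = fst g\<close> by (simp add: extend_def max_def)
  qed (rule gt)
qed

section \<open>Convergence of paths with varying starting times\<close>

locale path_metric =
  fixes \<delta> :: "(real \<Rightarrow> 'a::{heine_borel,polish_space}) \<Rightarrow> (real \<Rightarrow> 'a) \<Rightarrow> real"
  assumes loc_unif: "loc_unif_metric \<delta>"
begin

sublocale PM: Metric_space paths "path_dist \<delta>"
  by (rule Metric_space_path_dist[OF loc_unif])

lemma topspace_path_topology [simp]: "topspace (path_topology \<delta>) = paths"
  by (simp add: path_topology_def)

text \<open>\<delta> is an arbitrary metric of locally uniform convergence. Apart from the metric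
  axioms, this equivalence is the only way in which it enters the later arguments.\<close>

lemma path_dist_tendsto_iff:
  assumes F: "\<And>n. F n \<in> paths" and f: "f \<in> paths"
  shows "(\<lambda>n. path_dist \<delta> (F n) f) \<longlonglongrightarrow> 0 \<longleftrightarrow>
    (\<lambda>n. fst (F n)) \<longlonglongrightarrow> fst f \<and>
    (\<forall>K. compact K \<longrightarrow> uniform_limit K (\<lambda>n. extend (F n)) (extend f) sequentially)"
proof -
  interpret D: Metric_space "{f. continuous_on UNIV f}" \<delta>
    using loc_unif by (simp add: loc_unif_metric_def)
  have *: "(\<lambda>n. \<delta> (extend (F n)) (extend f)) \<longlonglongrightarrow> 0 \<longleftrightarrow>
      (\<forall>K. compact K \<longrightarrow> uniform_limit K (\<lambda>n. extend (F n)) (extend f) sequentially)"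
    using loc_unif F f by (simp add: loc_unif_metric_def continuous_on_extend)
  have "(\<lambda>n. path_dist \<delta> (F n) f) \<longlonglongrightarrow> 0 \<longleftrightarrow>
     (\<lambda>n. fst (F n)) \<longlonglongrightarrow> fst f \<and> (\<lambda>n. \<delta> (extend (F n)) (extend f)) \<longlonglongrightarrow> 0"
  proof (intro iffI conjI)
    assume lim: "(\<lambda>n. path_dist \<delta> (F n) f) \<longlonglongrightarrow> 0"
    have "(\<lambda>n. fst (F n) - fst f) \<longlonglongrightarrow> 0"
      by (rule Lim_null_comparison[OF _ lim]) (auto simp: path_dist_def)
    then show "(\<lambda>n. fst (F n)) \<longlonglongrightarrow> fst f" by (simp add: LIM_zero_iff)
    show "(\<lambda>n. \<delta> (extend (F n)) (extend f)) \<longlonglongrightarrow> 0"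
      by (rule Lim_null_comparison[OF _ lim]) (auto simp: path_dist_def)
  next
    assume "(\<lambda>n. fst (F n)) \<longlonglongrightarrow> fst f \<and> (\<lambda>n. \<delta> (extend (F n)) (extend f)) \<longlonglongrightarrow> 0"
    then show "(\<lambda>n. path_dist \<delta> (F n) f) \<longlonglongrightarrow> 0"
      unfolding path_dist_def by (auto intro!: tendsto_add_zero tendsto_rabs_zero simp: LIM_zero_iff)
  qed
  with * show ?thesis by simp
qed

lemma limitin_path_topology_iff:
  assumes "\<And>n. F n \<in> paths"
  shows "limitin (path_topology \<delta>) F f sequentially \<longleftrightarrow> f \<in> paths \<and>
    (\<lambda>n. path_dist \<delta> (F n) f) \<longlonglongrightarrow> 0"
  using assms by (simp add: path_topology_def PM.limitin_metric_dist_null)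

lemma limitin_path_fst:
  assumes "\<And>n. F n \<in> paths" "limitin (path_topology \<delta>) F f sequentially"
  shows "(\<lambda>n. fst (F n)) \<longlonglongrightarrow> fst f"
  using assms limitin_path_topology_iff[where F=F] path_dist_tendsto_iff[where F=F, of f]
  by simp

lemma limitin_path_eval:
  assumes "\<And>n. F n \<in> paths" "limitin (path_topology \<delta>) F f sequentially"
  shows "(\<lambda>n. extend (F n) t) \<longlonglongrightarrow> extend f t"
proof -
  have "uniform_limit {t} (\<lambda>n. extend (F n)) (extend f) sequentially"
    using assms limitin_path_topology_iff[where F=F] path_dist_tendsto_iff[where F=F, of f]
    by (metis compact_empty compact_insert)
  then show ?thesis by (rule tendsto_uniform_limitI) simp
qed

text \<open>The evaluation time moves with \<open>n\<close>, so convergence at a fixed time is not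
  enough. Uniform convergence on the unit neighbourhood of the limiting start controls the values at
  the moving times.\<close>

lemma limitin_path_start:
  assumes F: "\<And>n. F n \<in> paths" and lim: "limitin (path_topology \<delta>) F f sequentially"
  shows "(\<lambda>n. snd (F n) (fst (F n))) \<longlonglongrightarrow> snd f (fst f)"
proof -
  have fp: "f \<in> paths" and pd: "(\<lambda>n. path_dist \<delta> (F n) f) \<longlonglongrightarrow> 0"
    using lim by (simp_all add: limitin_path_topology_iff[OF F])
  then have fst: "(\<lambda>n. fst (F n)) \<longlonglongrightarrow> fst f"
    and unif: "\<And>K. compact K \<Longrightarrow> uniform_limit K (\<lambda>n. extend (F n)) (extend f) sequentially"
    using path_dist_tendsto_iff[OF F fp] by auto
  have "(\<lambda>n. dist (snd (F n) (fst (F n))) (extend f (fst (F n)))) \<longlonglongrightarrow> 0"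
  proof (rule LIMSEQ_I)
    fix e :: real assume e: "e > 0"
    have "\<forall>\<^sub>F n in sequentially. \<forall>t\<in>{fst f - 1..fst f + 1}. dist (extend (F n) t) (extend f t) < e"
      by (rule uniform_limitD[OF unif]) (use e in simp_all)
    moreover have "\<forall>\<^sub>F n in sequentially. dist (fst (F n)) (fst f) < 1"
      using fst by (rule tendstoD) simp
    ultimately have "\<forall>\<^sub>F n in sequentially. norm (dist (snd (F n) (fst (F n))) (extend f (fst (F n))) - 0) < e"
    proof eventually_elim
      case (elim n)
      then have "fst (F n) \<in> {fst f - 1..fst f + 1}" by (auto simp: dist_real_def)
      from bspec[OF elim(1) this] show ?case by (simp add: extend_eq_snd)
    qed
    then show "\<exists>no. \<forall>n\<ge>no. norm (dist (snd (F n) (fst (F n))) (extend f (fst (F n))) - 0) < e"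
      by (simp add: eventually_sequentially)
  qed
  moreover have "(\<lambda>n. extend f (fst (F n))) \<longlonglongrightarrow> extend f (fst f)"
    using continuous_on_extend[OF fp] fst by (auto simp: continuous_on_eq_continuous_at intro: isCont_tendsto_compose)
  then have "(\<lambda>n. dist (extend f (fst (F n))) (extend f (fst f))) \<longlonglongrightarrow> 0"
    by (rule tendsto_dist_iff[THEN iffD1])
  ultimately have "(\<lambda>n. dist (snd (F n) (fst (F n))) (extend f (fst (F n))) + dist (extend f (fst (F n))) (extend f (fst f))) \<longlonglongrightarrow> 0"
    by (rule tendsto_add_zero)
  then have "(\<lambda>n. dist (snd (F n) (fst (F n))) (extend f (fst f))) \<longlonglongrightarrow> 0"
    by (rule Lim_null_comparison[rotated]) (auto intro!: always_eventually dist_triangle)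
  then have "(\<lambda>n. snd (F n) (fst (F n))) \<longlonglongrightarrow> extend f (fst f)"
    by (rule tendsto_dist_iff[THEN iffD2])
  then show ?thesis by (simp add: extend_eq_snd)
qed

text \<open>Stated for the closure, because the modifications constructed later are limits of
  skeleton paths and need not lie in the set itself.\<close>

lemma closure_of_subsequence:
  assumes rc: "relatively_compact_in (path_topology \<delta>) K"
    and F: "\<And>n. F n \<in> path_topology \<delta> closure_of K"
  obtains f r where "f \<in> path_topology \<delta> closure_of K" "strict_mono (r :: nat \<Rightarrow> nat)"
    "limitin (path_topology \<delta>) (F \<circ> r) f sequentially"
proof -
  have "compactin PM.mtopology (path_topology \<delta> closure_of K)"
    using rc by (simp add: relatively_compact_in_def path_topology_def)
  then have "\<exists>l r. l \<in> path_topology \<delta> closure_of K \<and> strict_mono (r :: nat \<Rightarrow> nat) \<and>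
      limitin PM.mtopology (F \<circ> r) l sequentially"
    using F unfolding PM.compactin_sequentially by (simp add: image_subset_iff)
  then show ?thesis using that by (auto simp: path_topology_def)
qed

lemma closure_of_paths: "f \<in> path_topology \<delta> closure_of K \<Longrightarrow> f \<in> paths"
  using closure_of_subset_topspace[of "path_topology \<delta>"] by auto

text \<open>In a relatively compact set, pointwise convergence at rational times
  leaves only one possible limit point.\<close>

lemma relatively_compact_pointwise_limit:
  assumes rc: "relatively_compact_in (path_topology \<delta>) K"
    and F: "\<And>n. F n \<in> path_topology \<delta> closure_of K"
    and s: "(\<lambda>n. fst (F n)) \<longlonglongrightarrow> s"
    and W: "\<And>t. t \<in> \<rat> \<Longrightarrow> s < t \<Longrightarrow> (\<lambda>n. extend (F n) t) \<longlonglongrightarrow> W t"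
  obtains f where "f \<in> path_topology \<delta> closure_of K" "fst f = s"
    "limitin (path_topology \<delta>) F f sequentially" "\<And>t. t \<in> \<rat> \<Longrightarrow> s < t \<Longrightarrow> extend f t = W t"
proof -
  have Fp: "F n \<in> paths" for n using F closure_of_paths by blast
  have lim: "fst f = s \<and> (\<forall>t. t \<in> \<rat> \<longrightarrow> s < t \<longrightarrow> extend f t = W t)"
    if r: "strict_mono (r :: nat \<Rightarrow> nat)" "limitin (path_topology \<delta>) (F \<circ> r) f sequentially" for f r
  proof (intro conjI allI impI)
    have "(\<lambda>n. fst ((F \<circ> r) n)) \<longlonglongrightarrow> fst f"
      by (rule limitin_path_fst[OF _ r(2)]) (simp add: Fp)
    then show "fst f = s"
      using LIMSEQ_subseq_LIMSEQ[OF s r(1)] unfolding o_def by (rule LIMSEQ_unique)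
    fix t assume t: "t \<in> \<rat>" "s < t"
    have "(\<lambda>n. extend ((F \<circ> r) n) t) \<longlonglongrightarrow> extend f t"
      by (rule limitin_path_eval[OF _ r(2)]) (simp add: Fp)
    then show "extend f t = W t"
      using LIMSEQ_subseq_LIMSEQ[OF W[OF t] r(1)] unfolding o_def by (rule LIMSEQ_unique)
  qed
  obtain f r where f: "f \<in> path_topology \<delta> closure_of K"
    and r: "strict_mono (r :: nat \<Rightarrow> nat)" "limitin (path_topology \<delta>) (F \<circ> r) f sequentially"
    by (rule closure_of_subsequence[OF rc F])
  have fp: "f \<in> paths" using f closure_of_paths by blast
  \<comment> \<open>A subsequence that stays away from \<open>f\<close> would have a further
    convergent subsequence, whose limit agrees with \<open>f\<close> by the values at rational
    times.\<close>
  have "limitin (path_topology \<delta>) F f sequentially"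
  proof (rule ccontr)
    assume "\<not> ?thesis"
    then have "\<not> (\<lambda>n. path_dist \<delta> (F n) f) \<longlonglongrightarrow> 0"
      by (simp add: limitin_path_topology_iff[OF Fp] fp)
    then obtain e where e: "e > 0" "\<And>N. \<exists>n\<ge>N. e \<le> path_dist \<delta> (F n) f"
      by (auto simp: LIMSEQ_iff not_less)
    then have "\<exists>q. strict_mono (q :: nat \<Rightarrow> nat) \<and> (\<forall>n. e \<le> path_dist \<delta> (F (q n)) f)"
    proof -
      have "infinite {n. e \<le> path_dist \<delta> (F n) f}"
        using e(2) by (auto simp: infinite_nat_iff_unbounded_le)
      then show ?thesis
        using enumerate_in_set[of "{n. e \<le> path_dist \<delta> (F n) f}"]
        by (intro exI[of _ "enumerate {n. e \<le> path_dist \<delta> (F n) f}"]) (auto simp: strict_mono_enumerate)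
    qed
    then obtain q where q: "strict_mono (q :: nat \<Rightarrow> nat)" "\<And>n. e \<le> path_dist \<delta> (F (q n)) f" by blast
    have Fq: "(F \<circ> q) n \<in> path_topology \<delta> closure_of K" for n using F by simp
    obtain g p
      where g: "g \<in> path_topology \<delta> closure_of K" "strict_mono (p :: nat \<Rightarrow> nat)"
        "limitin (path_topology \<delta>) (F \<circ> q \<circ> p) g sequentially"
      by (rule closure_of_subsequence[OF rc Fq])
    have lg: "fst g = s \<and> (\<forall>t. t \<in> \<rat> \<longrightarrow> s < t \<longrightarrow> extend g t = W t)"
      using lim[OF strict_mono_o[OF q(1) g(2)]] g(3) by (simp add: o_assoc)
    have "g = f"
    proof (rule paths_eqI_right)
      show "g \<in> paths" using g(1) by (rule closure_of_paths)
    qed (use lg lim[OF r] fp in simp_all)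
    with g(3) have "(\<lambda>n. path_dist \<delta> ((F \<circ> q \<circ> p) n) f) \<longlonglongrightarrow> 0"
      by (subst (asm) limitin_path_topology_iff) (auto simp: Fp)
    then obtain N where "path_dist \<delta> ((F \<circ> q \<circ> p) N) f < e"
    using eventually_happens'[OF sequentially_bot order_tendstoD(2)] e(1) by blast
    with q(2)[of "p N"] show False by simp
  qed
  then show ?thesis using that[OF f] lim[OF r] by simp
qed

subsection \<open>Measurability\<close>

text \<open>The sets \<open>tube\<close> and \<open>start_between\<close> are cylindrical and their finite intersections form a
  countable neighbourhood base of each path.  Hence the Borel sets of the path space are
  cylindrical.\<close>

definition tube :: "real \<Rightarrow> real \<Rightarrow> 'a \<Rightarrow> real \<Rightarrow> 'a path set"
  where "tube p q d e = {f\<in>paths. \<forall>t\<in>\<rat> \<inter> {p<..<q}. dist (extend f t) d \<le> e}"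

definition start_between :: "real \<Rightarrow> real \<Rightarrow> 'a path set"
  where "start_between p q = {f\<in>paths. p \<le> fst f \<and> fst f \<le> q}"

definition dense_set :: "'a set"
  where "dense_set = (SOME D. countable D \<and> (\<forall>X. open X \<longrightarrow> X \<noteq> {} \<longrightarrow> (\<exists>d\<in>D. d \<in> X)))"

lemma dense_set: "countable dense_set" "open X \<Longrightarrow> X \<noteq> {} \<Longrightarrow> \<exists>d\<in>dense_set. d \<in> X"
proof -
  have "\<exists>D::'a set. countable D \<and> (\<forall>X. open X \<longrightarrow> X \<noteq> {} \<longrightarrow> (\<exists>d\<in>D. d \<in> X))"
    using countable_dense_exists by blast
  from someI_ex[OF this] show "countable dense_set" "open X \<Longrightarrow> X \<noteq> {} \<Longrightarrow> \<exists>d\<in>dense_set. d \<in> X"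
    unfolding dense_set_def by blast+
qed

definition subbase :: "'a path set set"
  where "subbase = (\<lambda>(p, q). start_between p q) ` (\<rat> \<times> \<rat>) \<union>
    (\<lambda>(p, q, d, e). tube p q d e) ` (\<rat> \<times> \<rat> \<times> dense_set \<times> \<rat>)"

lemma countable_subbase: "countable subbase"
  unfolding subbase_def by (intro countable_Un countable_image countable_SIGMA) (auto simp: dense_set countable_rat)

text \<open>By contradiction: enumerate the countably many subbasic sets that contain
  \<open>f\<close>. If no finite intersection fits into the ball, there are points
  \<open>g n\<close> common to \<open>V 0\<close>, ..., \<open>V n\<close> that stay at distance at
  least \<open>e\<close> from \<open>f\<close>. Lying eventually in every tube around
  \<open>f\<close> forces them to converge to \<open>f\<close>.\<close>

lemma subbase_neighbourhood:
  assumes f: "f \<in> paths" and e: "e > 0"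
  obtains \<F> where "finite \<F>" "\<F> \<subseteq> subbase" "f \<in> \<Inter>\<F>" "\<F> \<noteq> {}"
    "\<forall>g\<in>paths \<inter> \<Inter>\<F>. path_dist \<delta> g f < e"
proof (rule ccontr)
  note that' = that
  assume neg: "\<not> thesis"
  define B where "B = {V\<in>subbase. f \<in> V}"
  have cB: "countable B" using countable_subbase by (auto simp: B_def)
  obtain p q where "p \<in> \<rat>" "q \<in> \<rat>" "p < fst f" "fst f < q"
    using Rats_dense_in_real[of "fst f - 1" "fst f"] Rats_dense_in_real[of "fst f" "fst f + 1"] by auto
  then have "start_between p q \<in> B"
    by (auto simp: B_def subbase_def start_between_def f)
  then have neB: "B \<noteq> {}" by auto
  define V where "V = from_nat_into B"
  have VB: "V n \<in> B" for n using neB by (simp add: V_def from_nat_into)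
  have surjV: "\<exists>n. V n = U" if "U \<in> B" for U
    using from_nat_into_surj[OF cB that] by (auto simp: V_def)
  have "\<exists>g. g \<in> paths \<and> (\<forall>i\<le>n. g \<in> V i) \<and> e \<le> path_dist \<delta> g f" for n
  proof (rule ccontr)
    assume *: "\<not> ?thesis"
    show False
    proof (rule neg[THEN notE], rule that'[of "V ` {..n}"])
      show "V ` {..n} \<subseteq> subbase" "f \<in> \<Inter>(V ` {..n})"
        using VB unfolding B_def by blast+
      show "\<forall>g\<in>paths \<inter> \<Inter>(V ` {..n}). path_dist \<delta> g f < e"
        using * by (metis IntE INT_E atMost_iff not_le)
    qed auto
  qed
  then obtain g where g: "\<And>n. g n \<in> paths" "\<And>n i. i \<le> n \<Longrightarrow> g n \<in> V i" "\<And>n. e \<le> path_dist \<delta> (g n) f"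
    by metis
  have ev: "\<forall>\<^sub>F n in sequentially. g n \<in> U" if "U \<in> B" for U
    using surjV[OF that] g(2) by (auto simp: eventually_sequentially)
  have "(\<lambda>n. path_dist \<delta> (g n) f) \<longlonglongrightarrow> 0"
    unfolding path_dist_tendsto_iff[OF g(1) f]
  proof (intro conjI allI impI)
    show "(\<lambda>n. fst (g n)) \<longlonglongrightarrow> fst f"
    proof (rule order_tendstoI)
      fix a assume "a < fst f"
      then obtain p where p: "p \<in> \<rat>" "a < p" "p < fst f" using Rats_dense_in_real by blast
      have "start_between p q \<in> B" using p \<open>q \<in> \<rat>\<close> \<open>fst f < q\<close>
        by (auto simp: B_def subbase_def start_between_def f)
      from ev[OF this] show "\<forall>\<^sub>F n in sequentially. a < fst (g n)"
        by eventually_elim (use p in \<open>auto simp: start_between_def\<close>)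
    next
      fix a assume "fst f < a"
      then obtain q where q: "q \<in> \<rat>" "q < a" "fst f < q" using Rats_dense_in_real by blast
      have "start_between p q \<in> B" using q \<open>p \<in> \<rat>\<close> \<open>p < fst f\<close>
        by (auto simp: B_def subbase_def start_between_def f)
      from ev[OF this] show "\<forall>\<^sub>F n in sequentially. fst (g n) < a"
        by eventually_elim (use q in \<open>auto simp: start_between_def\<close>)
    qed
  next
    fix K :: "real set" assume K: "compact K"
    show "uniform_limit K (\<lambda>n. extend (g n)) (extend f) sequentially"
    proof (rule uniform_limitI)
      fix e' :: real assume e': "e' > 0"
      have ex: "\<exists>p q. p < t \<and> t < q \<and> (\<forall>\<^sub>F n in sequentially. \<forall>u. p < u \<and> u < q \<longrightarrow> dist (extend (g n) u) (extend f u) < e')" for t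
      proof -
        \<comment> \<open>Margins: \<open>c\<close> exceeds the distance from \<open>d\<close> to
          the value of \<open>f\<close> at \<open>t\<close>, so \<open>f\<close> stays within
          \<open>c\<close> of \<open>d\<close> near \<open>t\<close>; and 2 * c is less than e', so
          any two paths in this tube are closer than e'.\<close>
        obtain d where d: "d \<in> dense_set" "dist (extend f t) d < e' / 6"
          using dense_set(2)[of "ball (extend f t) (e'/6)"] e' by auto
        obtain c where c: "c \<in> \<rat>" "e' / 3 < c" "c < e' / 2"
          using Rats_dense_in_real[of "e'/3" "e'/2"] e' by auto
        have "open {u. dist (extend f u) d < c}"
          using continuous_on_extend[OF f] by (intro open_Collect_less continuous_intros) auto
        moreover have "t \<in> {u. dist (extend f u) d < c}" using d c e' by auto
        ultimately obtain h where h: "h > 0" "ball t h \<subseteq> {u. dist (extend f u) d < c}"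
          by (auto simp: open_contains_ball)
        obtain p where p: "p \<in> \<rat>" "t - h < p" "p < t" using Rats_dense_in_real[of "t - h" t] h by auto
        obtain q where q: "q \<in> \<rat>" "t < q" "q < t + h" using Rats_dense_in_real[of t "t + h"] h by auto
        have less: "dist (extend f u) d < c" if "p < u" "u < q" for u
          using h(2) that p q by (auto simp: subset_eq dist_real_def)
        have "tube p q d c \<in> B"
        proof -
          have "(\<lambda>(p, q, d, e). tube p q d e) (p, q, d, c) \<in> subbase"
            unfolding subbase_def using p(1) q(1) d(1) c(1) by blast
          moreover have "f \<in> tube p q d c"
            using f less by (simp add: tube_def less_imp_le)
          ultimately show ?thesis by (simp add: B_def)
        qed
        from ev[OF this] have "\<forall>\<^sub>F n in sequentially. \<forall>u. p < u \<and> u < q \<longrightarrow> dist (extend (g n) u) (extend f u) < e'"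
        proof eventually_elim
          case (elim n)
          show ?case
          proof (intro allI impI, elim conjE)
            fix u assume u: "p < u" "u < q"
            \<comment> \<open>The tube constrains rational times only; continuity of
              \<open>g n\<close> extends the bound to the whole open interval.\<close>
            have "dist (extend (g n) u) d \<le> c"
              using dist_le_open_interval_Rats[OF continuous_on_extend[OF g(1)[of n]] continuous_on_const[of _ d] _ u, of c]
                elim by (simp add: tube_def)
            with less[OF u] c show "dist (extend (g n) u) (extend f u) < e'"
              using dist_triangle2[of "extend (g n) u" "extend f u" d] by linarith
          qed
        qed
        with p q show ?thesis by blast
      qed
      \<comment> \<open>Each interval has its own threshold for \<open>n\<close>. Compactness of
        \<open>K\<close> leaves finitely many intervals and hence a common threshold.\<close>
      define \<C> where "\<C> = {{p<..<q} | p q. \<forall>\<^sub>F n in sequentially. \<forall>u. p < u \<and> u < q \<longrightarrow> dist (extend (g n) u) (extend f u) < e'}"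
      have "\<exists>I\<in>\<C>. t \<in> I" for t
      proof -
        obtain p q where "p < t" "t < q" "\<forall>\<^sub>F n in sequentially. \<forall>u. p < u \<and> u < q \<longrightarrow> dist (extend (g n) u) (extend f u) < e'"
          using ex[of t] by (elim exE conjE)
        then show ?thesis by (intro bexI[of _ "{p<..<q}"]) (auto simp: \<C>_def)
      qed
      then have "K \<subseteq> \<Union>\<C>" by blast
      moreover have "open I" if "I \<in> \<C>" for I using that by (auto simp: \<C>_def)
      ultimately obtain D where D: "D \<subseteq> \<C>" "finite D" "K \<subseteq> \<Union>D"
        using compactE[OF K] by metis
      have "\<forall>\<^sub>F n in sequentially. \<forall>u\<in>I. dist (extend (g n) u) (extend f u) < e'" if ID: "I \<in> D" for I
      proof -
        obtain p q where "I = {p<..<q}" "\<forall>\<^sub>F n in sequentially. \<forall>u. p < u \<and> u < q \<longrightarrow> dist (extend (g n) u) (extend f u) < e'"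
          using subsetD[OF D(1) ID] by (auto simp: \<C>_def)
        then show ?thesis by (auto elim: eventually_mono)
      qed
      then have "\<forall>\<^sub>F n in sequentially. \<forall>I\<in>D. \<forall>u\<in>I. dist (extend (g n) u) (extend f u) < e'"
        using D(2) by (simp add: eventually_ball_finite)
      then show "\<forall>\<^sub>F n in sequentially. \<forall>u\<in>K. dist (extend (g n) u) (extend f u) < e'"
        by eventually_elim (use D(3) in blast)
    qed
  qed
  then obtain N where "path_dist \<delta> (g N) f < e"
    using eventually_happens'[OF sequentially_bot order_tendstoD(2)] e by blast
  with g(3)[of N] show False by simp
qed

definition base :: "'a path set set"
  where "base = {\<Inter>\<F> | \<F>. finite \<F> \<and> \<F> \<subseteq> subbase \<and> \<F> \<noteq> {}}"

lemma countable_base: "countable base"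
proof -
  have "base \<subseteq> Inter ` {\<F>. finite \<F> \<and> \<F> \<subseteq> subbase}" by (auto simp: base_def)
  then show ?thesis
    by (rule countable_subset) (intro countable_image countable_Collect_finite_subset countable_subbase)
qed

lemma base_subset: "W \<in> base \<Longrightarrow> W \<subseteq> paths"
proof -
  have "V \<subseteq> paths" if "V \<in> subbase" for V
    using that by (auto simp: subbase_def tube_def start_between_def)
  then show "W \<in> base \<Longrightarrow> W \<subseteq> paths"
    unfolding base_def by blast
qed

lemma base_neighbourhood:
  assumes "f \<in> paths" "e > 0"
  obtains W where "W \<in> base" "f \<in> W" "\<And>g. g \<in> W \<Longrightarrow> path_dist \<delta> g f < e"
proof -
  obtain \<F> where \<F>: "finite \<F>" "\<F> \<subseteq> subbase" "f \<in> \<Inter>\<F>" "\<F> \<noteq> {}"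
    "\<forall>g\<in>paths \<inter> \<Inter>\<F>. path_dist \<delta> g f < e" by (rule subbase_neighbourhood[OF assms])
  have "\<Inter>\<F> \<in> base"
    using \<F> by (auto simp: base_def)
  with \<F> base_subset[OF this] show ?thesis by (intro that[of "\<Inter>\<F>"]) blast+
qed

text \<open>A property of path-valued maps that can be checked coordinate by coordinate. It is
  stable under \<open>restrict_from\<close> and \<open>shift\<close>, and implies Borel
  measurability.\<close>

definition cylinder_measurable :: "'b measure \<Rightarrow> ('b \<Rightarrow> 'a path) \<Rightarrow> bool"
  where "cylinder_measurable N F \<longleftrightarrow> F \<in> space N \<rightarrow> paths \<and> (\<lambda>\<omega>. fst (F \<omega>)) \<in> borel_measurable N \<and>
    (\<forall>t. (\<lambda>\<omega>. extend (F \<omega>) t) \<in> borel_measurable N)"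

lemma cylinder_measurable_base:
  assumes F: "cylinder_measurable N F" and W: "W \<in> base"
  shows "{\<omega>\<in>space N. F \<omega> \<in> W} \<in> sets N"
proof -
  have [measurable]: "(\<lambda>\<omega>. fst (F \<omega>)) \<in> borel_measurable N" "\<And>t. (\<lambda>\<omega>. extend (F \<omega>) t) \<in> borel_measurable N"
    and p: "\<And>\<omega>. \<omega> \<in> space N \<Longrightarrow> F \<omega> \<in> paths"
    using F by (auto simp: cylinder_measurable_def)
  have sub: "{\<omega>\<in>space N. F \<omega> \<in> V} \<in> sets N" if "V \<in> subbase" for V
  proof -
    have 1: "{\<omega>\<in>space N. F \<omega> \<in> start_between a b} \<in> sets N" for a b
    proof -
      have "{\<omega>\<in>space N. F \<omega> \<in> start_between a b} = {\<omega>\<in>space N. a \<le> fst (F \<omega>) \<and> fst (F \<omega>) \<le> b}"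
        using p by (auto simp: start_between_def)
      then show ?thesis by simp
    qed
    have 2: "{\<omega>\<in>space N. F \<omega> \<in> tube a b d e} \<in> sets N" for a b d e
    proof -
      have "{\<omega>\<in>space N. F \<omega> \<in> tube a b d e} = {\<omega>\<in>space N. \<forall>t\<in>\<rat> \<inter> {a<..<b}. dist (extend (F \<omega>) t) d \<le> e}"
        using p by (auto simp: tube_def)
      also have "\<dots> \<in> sets N"
        by (intro sets.sets_Collect_countable_All') (auto intro: countable_subset[OF _ countable_rat])
      finally show ?thesis .
    qed
    show ?thesis using that 1 2 by (auto simp: subbase_def)
  qed
  obtain \<F> where \<F>: "finite \<F>" "\<F> \<subseteq> subbase" "W = \<Inter>\<F>" "\<F> \<noteq> {}" using W by (auto simp: base_def)
  have "{\<omega>\<in>space N. F \<omega> \<in> W} = {\<omega>\<in>space N. \<forall>V\<in>\<F>. F \<omega> \<in> V}" by (auto simp: \<F>)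
  also have "\<dots> \<in> sets N" using \<F> sub by (intro sets.sets_Collect_finite_All) auto
  finally show ?thesis .
qed

lemma space_path_borel [simp]: "space (path_borel \<delta>) = paths"
  by (simp add: path_borel_def space_measure_of_conv)

lemma openin_path_subset: "openin (path_topology \<delta>) U \<Longrightarrow> U \<subseteq> paths"
  using openin_subset by fastforce

lemma sets_path_borel: "sets (path_borel \<delta>) = sigma_sets paths {U. openin (path_topology \<delta>) U}"
  unfolding path_borel_def by (rule sets_measure_of) (auto dest: openin_path_subset)

text \<open>An open set is the union of the base sets contained in it, and there are only countably
  many of these.\<close>

lemma measurable_path_borelI:
  assumes F: "cylinder_measurable N F"
  shows "F \<in> N \<rightarrow>\<^sub>M path_borel \<delta>"
  unfolding path_borel_def
proof (rule measurable_measure_of)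
  show "{U. openin (path_topology \<delta>) U} \<subseteq> Pow paths" by (auto dest: openin_path_subset)
  show "F \<in> space N \<rightarrow> paths" using F by (simp add: cylinder_measurable_def)
  fix U assume "U \<in> {U. openin (path_topology \<delta>) U}"
  then have U: "openin PM.mtopology U" by (simp add: path_topology_def)
  have "U = (\<Union>W\<in>{W\<in>base. W \<subseteq> U}. W)"
  proof safe
    fix f assume fU: "f \<in> U"
    then obtain r where r: "r > 0" "PM.mball f r \<subseteq> U" and f: "f \<in> paths"
      using U unfolding PM.openin_mtopology by blast
    obtain W where W: "W \<in> base" "f \<in> W" "\<And>g. g \<in> W \<Longrightarrow> path_dist \<delta> g f < r"
      using base_neighbourhood[OF f r(1)] by blast
    have "W \<subseteq> paths" using W(1) by (rule base_subset)
    then have "W \<subseteq> U" using W r(2) f by (auto simp: PM.commute subset_eq)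
    with W show "f \<in> (\<Union>W\<in>{W\<in>base. W \<subseteq> U}. W)" by blast
  qed auto
  then have "F -` U \<inter> space N = (\<Union>W\<in>{W\<in>base. W \<subseteq> U}. {\<omega>\<in>space N. F \<omega> \<in> W})" by auto
  also have "\<dots> \<in> sets N"
    using cylinder_measurable_base[OF F] countable_base by (intro sets.countable_UN'') auto
  finally show "F -` U \<inter> space N \<in> sets N" .
qed

text \<open>The pairs at distance less than \<open>c\<close> form a countable union of products of
  base sets, so measurability of each of the two paths separately suffices.\<close>

lemma measurable_path_dist:
  assumes F: "cylinder_measurable N F" and G: "cylinder_measurable N G"
  shows "(\<lambda>\<omega>. path_dist \<delta> (F \<omega>) (G \<omega>)) \<in> borel_measurable N"
proof (rule borel_measurableI_less)
  fix c :: real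
  have p: "\<And>\<omega>. \<omega> \<in> space N \<Longrightarrow> F \<omega> \<in> paths" "\<And>\<omega>. \<omega> \<in> space N \<Longrightarrow> G \<omega> \<in> paths"
    using F G by (auto simp: cylinder_measurable_def)
  define \<W> where "\<W> = {(V, W)\<in>base \<times> base. \<forall>f\<in>V. \<forall>g\<in>W. path_dist \<delta> f g < c}"
  have "{\<omega>\<in>space N. path_dist \<delta> (F \<omega>) (G \<omega>) < c} =
    (\<Union>(V, W)\<in>\<W>. {\<omega>\<in>space N. F \<omega> \<in> V} \<inter> {\<omega>\<in>space N. G \<omega> \<in> W})"
  proof (intro set_eqI iffI)
    fix \<omega> assume "\<omega> \<in> {\<omega>\<in>space N. path_dist \<delta> (F \<omega>) (G \<omega>) < c}"
    then have \<omega>: "\<omega> \<in> space N" and less: "path_dist \<delta> (F \<omega>) (G \<omega>) < c" by auto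
    \<comment> \<open>Half of the slack for each of the two arguments.\<close>
    define e where "e = (c - path_dist \<delta> (F \<omega>) (G \<omega>)) / 2"
    have e: "e > 0" using less by (simp add: e_def)
    obtain V where V: "V \<in> base" "F \<omega> \<in> V" "\<And>g. g \<in> V \<Longrightarrow> path_dist \<delta> g (F \<omega>) < e"
      using base_neighbourhood[OF p(1)[OF \<omega>] e] by blast
    obtain W where W: "W \<in> base" "G \<omega> \<in> W" "\<And>g. g \<in> W \<Longrightarrow> path_dist \<delta> g (G \<omega>) < e"
      using base_neighbourhood[OF p(2)[OF \<omega>] e] by blast
    have sub: "V \<subseteq> paths" "W \<subseteq> paths"
      using V(1) W(1) base_subset by auto
    have "path_dist \<delta> f g < c" if "f \<in> V" "g \<in> W" for f g
    proof -
      have "f \<in> paths" "g \<in> paths" using sub that by auto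
      then have "path_dist \<delta> f g \<le> path_dist \<delta> f (F \<omega>) + path_dist \<delta> (F \<omega>) g"
        and "path_dist \<delta> (F \<omega>) g \<le> path_dist \<delta> (F \<omega>) (G \<omega>) + path_dist \<delta> g (G \<omega>)"
        using p \<omega> PM.triangle by (auto simp: PM.commute[of g])
      then show ?thesis using V(3)[OF that(1)] W(3)[OF that(2)] by (simp add: e_def field_simps)
    qed
    then have "(V, W) \<in> \<W>"
      using V(1) W(1) by (simp add: \<W>_def)
    then show "\<omega> \<in> (\<Union>(V, W)\<in>\<W>. {\<omega>\<in>space N. F \<omega> \<in> V} \<inter> {\<omega>\<in>space N. G \<omega> \<in> W})"
      using V(2) W(2) \<omega> by (intro UN_I[of "(V, W)"]) auto
  qed (auto simp: \<W>_def)
  also have "\<dots> \<in> sets N"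
  proof (rule sets.countable_UN'')
    show "countable \<W>"
      using countable_base by (auto simp: \<W>_def intro: countable_subset[of _ "base \<times> base"])
  qed (auto simp: \<W>_def intro!: sets.Int cylinder_measurable_base[OF F] cylinder_measurable_base[OF G])
  finally show "{\<omega>\<in>space N. path_dist \<delta> (F \<omega>) (G \<omega>) < c} \<in> sets N" .
qed

text \<open>Sequentially continuous maps on a metric space are continuous: if the preimage of an
  open set were not open at \<open>f\<close>, points within 1/(n+1) of \<open>f\<close> outside it
  would give a contradiction.\<close>

lemma measurable_path_borel_sequential:
  fixes h :: "'a path \<Rightarrow> 'c::metric_space"
  assumes "\<And>F f. (\<And>n. F n \<in> paths) \<Longrightarrow> limitin (path_topology \<delta>) F f sequentially \<Longrightarrow> (\<lambda>n. h (F n)) \<longlonglongrightarrow> h f"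
  shows "h \<in> borel_measurable (path_borel \<delta>)"
proof (rule borel_measurableI)
  fix U :: "'c set" assume "open U"
  have "openin PM.mtopology (h -` U \<inter> paths)"
    unfolding PM.openin_mtopology
  proof (intro conjI allI impI)
    fix f assume f: "f \<in> h -` U \<inter> paths"
    show "\<exists>r>0. PM.mball f r \<subseteq> h -` U \<inter> paths"
    proof (rule ccontr)
      assume neg: "\<not> ?thesis"
      have "\<exists>g. g \<in> paths \<and> path_dist \<delta> f g < inverse (Suc n) \<and> h g \<notin> U" for n
      proof -
        have "\<not> PM.mball f (inverse (Suc n)) \<subseteq> h -` U \<inter> paths"
          using neg by (auto simp del: of_nat_Suc)
        then show ?thesis by auto
      qed
      then obtain g where g: "\<And>n. g n \<in> paths" "\<And>n. path_dist \<delta> f (g n) < inverse (Suc n)" "\<And>n. h (g n) \<notin> U"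
        by metis
      have "(\<lambda>n. path_dist \<delta> (g n) f) \<longlonglongrightarrow> 0"
        by (rule Lim_null_comparison[OF _ LIMSEQ_inverse_real_of_nat])
           (use g(2) in \<open>auto intro!: always_eventually less_imp_le simp: PM.commute[of _ f]\<close>)
      then have "limitin (path_topology \<delta>) g f sequentially"
        using f by (simp add: limitin_path_topology_iff[OF g(1)])
      from assms[OF g(1) this] have "\<forall>\<^sub>F n in sequentially. h (g n) \<in> U"
        using f \<open>open U\<close> by (auto dest: topological_tendstoD)
      then show False using g(3) by simp
    qed
  qed auto
  then show "h -` U \<inter> space (path_borel \<delta>) \<in> sets (path_borel \<delta>)"
    by (auto simp: sets_path_borel path_topology_def intro: sigma_sets.Basic)
qed

lemma measurable_fst_path [measurable]: "fst \<in> borel_measurable (path_borel \<delta>)"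
  by (rule measurable_path_borel_sequential) (rule limitin_path_fst)

lemma measurable_extend_path [measurable]: "(\<lambda>f. extend f t) \<in> borel_measurable (path_borel \<delta>)"
  by (rule measurable_path_borel_sequential) (rule limitin_path_eval)

end

section \<open>Continuous processes at random times\<close>

lemma floor_div_tendsto: "(\<lambda>n. real_of_int \<lfloor>real (Suc n) * t\<rfloor> / real (Suc n)) \<longlonglongrightarrow> t"
proof -
  have "(\<lambda>n. real_of_int \<lfloor>real (Suc n) * t\<rfloor> / real (Suc n) - t) \<longlonglongrightarrow> 0"
  proof (rule Lim_null_comparison[OF always_eventually LIMSEQ_inverse_real_of_nat], rule allI)
    fix n
    have "\<bar>real_of_int \<lfloor>real (Suc n) * t\<rfloor> - real (Suc n) * t\<bar> \<le> 1" by linarith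
    then show "norm (real_of_int \<lfloor>real (Suc n) * t\<rfloor> / real (Suc n) - t) \<le> inverse (real (Suc n))"
      by (simp add: divide_simps mult.commute del: of_nat_Suc)
  qed
  then show ?thesis by (simp add: LIM_zero_iff)
qed

text \<open>The floor approximation of \<open>T\<close> takes countably many values, so
  measurability at fixed times is enough for each approximant; continuity of the trajectories gives
  the limit.\<close>

lemma measurable_continuous_process:
  fixes Z :: "'b \<Rightarrow> real \<Rightarrow> 'c::metric_space"
  assumes Z: "\<And>t. (\<lambda>\<omega>. Z \<omega> t) \<in> borel_measurable N"
    and cont: "\<And>\<omega>. \<omega> \<in> space N \<Longrightarrow> continuous_on UNIV (Z \<omega>)"
    and T: "T \<in> borel_measurable N"
  shows "(\<lambda>\<omega>. Z \<omega> (T \<omega>)) \<in> borel_measurable N"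
proof (rule borel_measurable_LIMSEQ_metric)
  show "(\<lambda>\<omega>. Z \<omega> (real_of_int \<lfloor>real (Suc n) * T \<omega>\<rfloor> / real (Suc n))) \<in> borel_measurable N" for n
  proof (rule measurable_compose_countable[where f="\<lambda>i \<omega>. Z \<omega> (real_of_int i / real (Suc n))"])
    show "(\<lambda>\<omega>. \<lfloor>real (Suc n) * T \<omega>\<rfloor>) \<in> N \<rightarrow>\<^sub>M count_space UNIV"
      using T by measurable
  qed (rule Z)
  show "(\<lambda>n. Z \<omega> (real_of_int \<lfloor>real (Suc n) * T \<omega>\<rfloor> / real (Suc n))) \<longlonglongrightarrow> Z \<omega> (T \<omega>)" if "\<omega> \<in> space N" for \<omega>
    using cont[OF that] floor_div_tendsto by (auto simp: continuous_on_eq_continuous_at intro: isCont_tendsto_compose)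
qed

section \<open>Mappings constructed from a skeleton\<close>

text \<open>\<open>real_of_ereal\<close> sends \<infinity> to 0, but the minimum with a finite
  number is taken first. An infimum over the empty set therefore yields the cap 2^-k and not
  0.\<close>

lemma eps_le: "eps P \<delta> k x \<le> 1 / 2 ^ k"
proof -
  define I where "I = (INF r\<in>{r. r > 0 \<and> (SUP y\<in>cball x r. separation_prob P \<delta> k x y) > 1 / 2 ^ k}. ereal r)"
  have "0 \<le> I" unfolding I_def by (rule INF_greatest) auto
  then have "real_of_ereal (min (ereal (1 / 2 ^ k)) I) \<le> 1 / 2 ^ k"
    by (cases I) (auto simp: min_def)
  then show ?thesis by (simp add: eps_def I_def)
qed

lemma eps_tendsto_0:
  assumes "\<And>k. 0 < eps P \<delta> k x"
  shows "(\<lambda>k. eps P \<delta> k x) \<longlonglongrightarrow> 0"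
proof (rule Lim_null_comparison)
  show "\<forall>\<^sub>F k in sequentially. norm (eps P \<delta> k x) \<le> (1/2) ^ k"
  proof (intro always_eventually allI)
    fix k
    show "norm (eps P \<delta> k x) \<le> (1/2) ^ k"
      using assms[of k] eps_le[of P \<delta> k x] by (simp only: real_norm_def abs_of_pos power_divide power_one)
  qed
  show "(\<lambda>k. (1/2::real) ^ k) \<longlonglongrightarrow> 0" by (rule LIMSEQ_power_zero) simp
qed

context path_metric
begin

definition skeleton_set :: "(nat \<Rightarrow> 'a path) \<Rightarrow> (real \<times> 'a) set \<Rightarrow> 'a path set"
  where "skeleton_set \<phi> L = {restrict_from s (\<phi> n) | s n. n \<in> active \<phi> s \<and> (s, snd (\<phi> n) s) \<in> L}"

lemma skeletonsD:
  assumes "\<phi> \<in> skeletons \<delta>"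
  shows "\<phi> n \<in> paths"
    and "m \<in> active \<phi> s \<Longrightarrow> n \<in> active \<phi> s \<Longrightarrow> snd (\<phi> m) s = snd (\<phi> n) s \<Longrightarrow> s \<le> t \<Longrightarrow> snd (\<phi> m) t = snd (\<phi> n) t"
    and "closure (range (\<lambda>n. (fst (\<phi> n), snd (\<phi> n) (fst (\<phi> n))))) = UNIV"
    and "compact L \<Longrightarrow> relatively_compact_in (path_topology \<delta>) (skeleton_set \<phi> L)"
proof -
  have sk: "range \<phi> \<subseteq> paths \<and> (\<forall>s. \<forall>m\<in>active \<phi> s. \<forall>n\<in>active \<phi> s. snd (\<phi> m) s = snd (\<phi> n) s \<longrightarrow> (\<forall>t\<ge>s. snd (\<phi> m) t = snd (\<phi> n) t))"
    using assms unfolding skeletons_def mem_Collect_eq by (elim conjE) (intro conjI; assumption)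
  show "\<phi> n \<in> paths" using conjunct1[OF sk] by (rule subsetD) simp
  show "m \<in> active \<phi> s \<Longrightarrow> n \<in> active \<phi> s \<Longrightarrow> snd (\<phi> m) s = snd (\<phi> n) s \<Longrightarrow> s \<le> t \<Longrightarrow> snd (\<phi> m) t = snd (\<phi> n) t"
    by (rule conjunct2[OF sk, THEN spec, THEN bspec, THEN bspec, THEN mp, THEN spec, THEN mp])
  show "closure (range (\<lambda>n. (fst (\<phi> n), snd (\<phi> n) (fst (\<phi> n))))) = UNIV"
    "compact L \<Longrightarrow> relatively_compact_in (path_topology \<delta>) (skeleton_set \<phi> L)"
    using assms by (simp_all add: skeletons_def skeleton_set_def)
qed

lemma skeleton_set_closure:
  assumes "\<phi> \<in> skeletons \<delta>" "f \<in> skeleton_set \<phi> L"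
  shows "f \<in> path_topology \<delta> closure_of skeleton_set \<phi> L"
proof -
  have "skeleton_set \<phi> L \<subseteq> paths"
    using skeletonsD(1)[OF assms(1)] by (auto simp: skeleton_set_def restrict_from_paths)
  then show ?thesis
    using closure_of_subset[of "skeleton_set \<phi> L" "path_topology \<delta>"] assms(2) by auto
qed

lemma skeleton_set_restrict:
  "n \<in> active \<phi> s \<Longrightarrow> (s, snd (\<phi> n) s) \<in> L \<Longrightarrow> restrict_from s (\<phi> n) \<in> skeleton_set \<phi> L"
  by (auto simp: skeleton_set_def)

text \<open>Density in space-time becomes density at each single time by compactness. Starting
  points slightly before \<open>s\<close> approach (s, x); a subsequence of their paths converges to
  a path that starts at \<open>s\<close> in \<open>x\<close>, and convergence at the fixed time
  \<open>s\<close> brings the path values at \<open>s\<close> close to \<open>x\<close>.\<close>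

lemma skeleton_dense_at:
  assumes sk: "\<phi> \<in> skeletons \<delta>" and e: "e > 0"
  shows "\<exists>n\<in>active \<phi> s. dist (snd (\<phi> n) s) x < e"
proof -
  have "\<exists>n. s - inverse (real (Suc k)) < fst (\<phi> n) \<and> fst (\<phi> n) < s \<and>
      dist (snd (\<phi> n) (fst (\<phi> n))) x < inverse (real (Suc k))" for k
  proof -
    define A where "A = {s - inverse (real (Suc k))<..<s} \<times> ball x (inverse (real (Suc k)))"
    have "(s - inverse (real (Suc k)) / 2, x) \<in> A" by (simp add: A_def del: of_nat_Suc)
    moreover have "open A" unfolding A_def by (intro open_Times) auto
    ultimately have "A \<inter> range (\<lambda>n. (fst (\<phi> n), snd (\<phi> n) (fst (\<phi> n)))) \<noteq> {}"
      using skeletonsD(3)[OF sk] open_Int_closure_eq_empty[of A] by auto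
    then show ?thesis by (auto simp: A_def dist_commute)
  qed
  then obtain n where n: "\<And>k. s - inverse (real (Suc k)) < fst (\<phi> (n k))" "\<And>k. fst (\<phi> (n k)) < s"
      "\<And>k. dist (snd (\<phi> (n k)) (fst (\<phi> (n k)))) x < inverse (real (Suc k))"
    by metis
  define L where "L = {s - 1..s} \<times> cball x 1"
  have L: "compact L" unfolding L_def by (intro compact_Times) auto
  have p: "\<phi> (n k) \<in> paths" for k by (rule skeletonsD(1)[OF sk])
  have i1: "inverse (real (Suc k)) \<le> 1" for k by (simp add: divide_simps)
  have "\<phi> (n k) \<in> skeleton_set \<phi> L" for k
  proof -
    have "restrict_from (fst (\<phi> (n k))) (\<phi> (n k)) \<in> skeleton_set \<phi> L"
      using n[of k] i1[of k] by (intro skeleton_set_restrict) (auto simp: active_def L_def dist_commute intro: less_imp_le)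
    then show ?thesis by (simp add: restrict_from_fst p)
  qed
  then have cl: "\<phi> (n k) \<in> path_topology \<delta> closure_of skeleton_set \<phi> L" for k
    by (intro skeleton_set_closure[OF sk])
  obtain f r where f: "f \<in> path_topology \<delta> closure_of skeleton_set \<phi> L"
    and r: "strict_mono (r :: nat \<Rightarrow> nat)" "limitin (path_topology \<delta>) ((\<lambda>k. \<phi> (n k)) \<circ> r) f sequentially"
    by (rule closure_of_subsequence[OF skeletonsD(4)[OF sk L] cl])
  have pr: "((\<lambda>k. \<phi> (n k)) \<circ> r) k \<in> paths" for k by (simp add: p)
  have sub: "(\<lambda>k. inverse (real (Suc (r k)))) \<longlonglongrightarrow> 0"
    using LIMSEQ_subseq_LIMSEQ[OF LIMSEQ_inverse_real_of_nat r(1)] by (simp add: o_def)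
  have "(\<lambda>k. fst (\<phi> (n (r k))) - s) \<longlonglongrightarrow> 0"
  proof (rule Lim_null_comparison[OF _ sub], intro always_eventually allI)
    show "norm (fst (\<phi> (n (r k))) - s) \<le> inverse (real (Suc (r k)))" for k
      using n(1,2)[of "r k"] by simp
  qed
  then have "(\<lambda>k. fst (((\<lambda>k. \<phi> (n k)) \<circ> r) k)) \<longlonglongrightarrow> s"
    by (simp add: LIM_zero_iff)
  from LIMSEQ_unique[OF this limitin_path_fst[OF pr r(2)]] have fs: "fst f = s" ..
  have "(\<lambda>k. dist (snd (\<phi> (n (r k))) (fst (\<phi> (n (r k))))) x) \<longlonglongrightarrow> 0"
  proof (rule Lim_null_comparison[OF _ sub], intro always_eventually allI)
    show "norm (dist (snd (\<phi> (n (r k))) (fst (\<phi> (n (r k))))) x) \<le> inverse (real (Suc (r k)))" for k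
      using n(3)[of "r k"] by simp
  qed
  then have "(\<lambda>k. snd (\<phi> (n (r k))) (fst (\<phi> (n (r k))))) \<longlonglongrightarrow> x"
    by (rule tendsto_dist_iff[THEN iffD2])
  moreover have "(\<lambda>k. snd (\<phi> (n (r k))) (fst (\<phi> (n (r k))))) \<longlonglongrightarrow> snd f (fst f)"
    using limitin_path_start[OF pr r(2)] by simp
  ultimately have "snd f (fst f) = x" by (rule LIMSEQ_unique[rotated])
  then have "(\<lambda>k. extend (\<phi> (n (r k))) s) \<longlonglongrightarrow> x"
    using limitin_path_eval[OF pr r(2), of s] by (simp add: fs extend_eq_snd)
  from eventually_happens'[OF sequentially_bot tendstoD[OF this e]]
  obtain k where "dist (extend (\<phi> (n (r k))) s) x < e" by blast
  then show ?thesis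
    using n(2)[of "r k"] by (intro bexI[of _ "n (r k)"]) (auto simp: active_def extend_eq_snd)
qed

text \<open>The selector chooses a limit along an unspecified subsequence. Its start and its value
  at \<open>s\<close> are nevertheless determined, because the whole sequence of initial values
  converges to \<open>x\<close>.\<close>

lemma selector_limit:
  assumes sk: "\<phi> \<in> skeletons \<delta>" and l: "limit_point_selector \<delta> l"
    and n: "\<And>k. n k \<in> active \<phi> s" "\<And>k. dist (snd (\<phi> (n k)) s) x \<le> 1"
    and lim: "(\<lambda>k. snd (\<phi> (n k)) s) \<longlonglongrightarrow> x"
  defines "f \<equiv> l (\<lambda>k. restrict_from s (\<phi> (n k)))"
  shows "f \<in> paths" "fst f = s" "snd f s = x"
    "\<exists>r. strict_mono (r :: nat \<Rightarrow> nat) \<and> (\<forall>t\<ge>s. (\<lambda>k. snd (\<phi> (n (r k))) t) \<longlonglongrightarrow> snd f t)"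
proof -
  define F where "F k = restrict_from s (\<phi> (n k))" for k
  have Fp: "F k \<in> paths" for k by (simp add: F_def restrict_from_paths skeletonsD(1)[OF sk])
  have "relatively_compact_in (path_topology \<delta>) (skeleton_set \<phi> ({s} \<times> cball x 1))"
    by (rule skeletonsD(4)[OF sk]) (intro compact_Times; simp)
  \<comment> \<open>The bound 1 on the initial distances places all restricted paths over one
    compact set of initial points.\<close>
  moreover have "range F \<subseteq> skeleton_set \<phi> ({s} \<times> cball x 1)"
    using n by (auto simp: F_def dist_commute intro!: skeleton_set_restrict)
  ultimately have "relatively_compact_in (path_topology \<delta>) (range F)"
    unfolding relatively_compact_in_def
    using closed_compactin[of "path_topology \<delta>" "path_topology \<delta> closure_of skeleton_set \<phi> ({s} \<times> cball x 1)"
        "path_topology \<delta> closure_of range F"] closure_of_mono by (meson closedin_closure_of order_trans)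
  then obtain r where r: "strict_mono (r :: nat \<Rightarrow> nat)" "limitin (path_topology \<delta>) (F \<circ> r) f sequentially"
    using l unfolding limit_point_selector_def f_def F_def by blast
  have Frp: "(F \<circ> r) k \<in> paths" for k by (simp add: Fp)
  show fp: "f \<in> paths" using r(2) by (simp add: limitin_path_topology_iff[OF Frp])
  have "(\<lambda>k. fst ((F \<circ> r) k)) \<longlonglongrightarrow> fst f" by (rule limitin_path_fst[OF Frp r(2)])
  then show fs: "fst f = s" by (simp add: F_def LIMSEQ_const_iff)
  have conv: "(\<lambda>k. snd (\<phi> (n (r k))) t) \<longlonglongrightarrow> snd f t" if "s \<le> t" for t
  proof -
    have "extend ((F \<circ> r) k) t = snd (\<phi> (n (r k))) t" for k
      using that n(1)[of "r k"] by (simp add: F_def extend_restrict_from extend_eq_snd active_def)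
    then show ?thesis
      using limitin_path_eval[OF Frp r(2), of t] that fs by (simp add: extend_eq_snd)
  qed
  show "snd f s = x"
    using conv[of s] LIMSEQ_subseq_LIMSEQ[OF lim r(1)] by (auto simp: o_def intro: LIMSEQ_unique)
  show "\<exists>r. strict_mono (r :: nat \<Rightarrow> nat) \<and> (\<forall>t\<ge>s. (\<lambda>k. snd (\<phi> (n (r k))) t) \<longlonglongrightarrow> snd f t)"
    using r(1) conv by blast
qed

end

section \<open>Mappings built from a single skeleton, given that the radii are positive and
  measurable\<close>

locale skeleton_maps = path_metric \<delta> for \<delta> :: "(real \<Rightarrow> 'a::{heine_borel,polish_space}) \<Rightarrow> (real \<Rightarrow> 'a) \<Rightarrow> real" +
  fixes P :: "'a transition" and l :: "(nat \<Rightarrow> 'a path) \<Rightarrow> 'a path"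
  assumes selector: "limit_point_selector \<delta> l"
    and eps_pos: "\<And>k x. 0 < eps P \<delta> k x"
    and eps_measurable: "\<And>k. eps P \<delta> k \<in> borel_measurable borel"
begin

lemma approx_index:
  assumes "\<phi> \<in> skeletons \<delta>"
  shows "approx_index P \<delta> \<phi> s x k \<in> active \<phi> s"
    and "dist (snd (\<phi> (approx_index P \<delta> \<phi> s x k)) s) x < eps P \<delta> k x"
proof -
  obtain n where "n \<in> active \<phi> s \<and> dist (snd (\<phi> n) s) x < eps P \<delta> k x"
    using skeleton_dense_at[OF assms eps_pos[of k x], of s x] by blast
  then show "approx_index P \<delta> \<phi> s x k \<in> active \<phi> s"
    "dist (snd (\<phi> (approx_index P \<delta> \<phi> s x k)) s) x < eps P \<delta> k x"
    unfolding approx_index_def by (metis (mono_tags, lifting) LeastI)+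
qed

lemma approx_index_tendsto:
  assumes "\<phi> \<in> skeletons \<delta>"
  shows "(\<lambda>k. snd (\<phi> (approx_index P \<delta> \<phi> s x k)) s) \<longlonglongrightarrow> x"
proof -
  have "(\<lambda>k. dist (snd (\<phi> (approx_index P \<delta> \<phi> s x k)) s) x) \<longlonglongrightarrow> 0"
    by (rule Lim_null_comparison[OF _ eps_tendsto_0[OF eps_pos]])
       (use approx_index(2)[OF assms] in \<open>auto intro!: always_eventually less_imp_le\<close>)
  then show ?thesis by (subst tendsto_dist_iff)
qed

lemma theta_limit:
  assumes sk: "\<phi> \<in> skeletons \<delta>"
  defines "f \<equiv> \<lambda>s x. l (\<lambda>k. restrict_from s (\<phi> (approx_index P \<delta> \<phi> s x k)))"
  shows "f s x \<in> paths" "fst (f s x) = s" "snd (f s x) s = x"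
    "\<exists>r. strict_mono (r :: nat \<Rightarrow> nat) \<and>
      (\<forall>t\<ge>s. (\<lambda>k. snd (\<phi> (approx_index P \<delta> \<phi> s x (r k))) t) \<longlonglongrightarrow> theta P \<delta> l \<phi> s t x)"
proof -
  have le: "dist (snd (\<phi> (approx_index P \<delta> \<phi> s x k)) s) x \<le> 1" for k
  proof -
    have "(1::real) / 2 ^ k \<le> 1" by (simp add: divide_simps)
    then show ?thesis
      using approx_index(2)[OF sk, of s x k] eps_le[of P \<delta> k x] by linarith
  qed
  show "f s x \<in> paths" "fst (f s x) = s" "snd (f s x) s = x"
    "\<exists>r. strict_mono (r :: nat \<Rightarrow> nat) \<and>
      (\<forall>t\<ge>s. (\<lambda>k. snd (\<phi> (approx_index P \<delta> \<phi> s x (r k))) t) \<longlonglongrightarrow> theta P \<delta> l \<phi> s t x)"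
    unfolding f_def theta_def
    by (rule selector_limit[where n="approx_index P \<delta> \<phi> s x",
          OF sk selector approx_index(1)[OF sk] le approx_index_tendsto[OF sk]])+
qed

lemma theta_start: "\<phi> \<in> skeletons \<delta> \<Longrightarrow> theta P \<delta> l \<phi> s s x = x"
  unfolding theta_def by (rule theta_limit(3))

lemma theta_continuous:
  assumes "\<phi> \<in> skeletons \<delta>"
  shows "continuous_on {s..} (\<lambda>t. theta P \<delta> l \<phi> s t x)"
  using theta_limit(1,2)[OF assms, of s x] unfolding theta_def paths_iff by simp

text \<open>The index \<open>n\<close> itself competes in the minimum, so only finitely many indices occur and those
  with \<open>\<phi>\<^sub>m(s) \<noteq> \<phi>\<^sub>n(s)\<close> occur finitely often.\<close>

lemma theta_skeleton:
  assumes sk: "\<phi> \<in> skeletons \<delta>" and n: "n \<in> active \<phi> s" and t: "s \<le> t"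
  shows "theta P \<delta> l \<phi> s t (snd (\<phi> n) s) = snd (\<phi> n) t"
proof -
  define x where "x = snd (\<phi> n) s"
  define m where "m k = approx_index P \<delta> \<phi> s x k" for k
  have le: "m k \<le> n" for k
  proof -
    have "n \<in> active \<phi> s \<and> dist (snd (\<phi> n) s) x < eps P \<delta> k x"
      using n eps_pos[of k x] by (simp add: x_def)
    then show ?thesis unfolding m_def approx_index_def by (rule Least_le)
  qed
  have "\<forall>i\<in>{..n}. \<forall>\<^sub>F k in sequentially. snd (\<phi> i) s \<noteq> x \<longrightarrow> m k \<noteq> i"
  proof
    fix i assume "i \<in> {..n}"
    show "\<forall>\<^sub>F k in sequentially. snd (\<phi> i) s \<noteq> x \<longrightarrow> m k \<noteq> i"
    proof (cases "snd (\<phi> i) s = x")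
      case False
      then have "\<forall>\<^sub>F k in sequentially. dist (snd (\<phi> (m k)) s) x < dist (snd (\<phi> i) s) x"
        unfolding m_def by (intro tendstoD approx_index_tendsto sk) simp
      then show ?thesis by eventually_elim auto
    qed simp
  qed
  then have "\<forall>\<^sub>F k in sequentially. \<forall>i\<in>{..n}. snd (\<phi> i) s \<noteq> x \<longrightarrow> m k \<noteq> i"
    by (rule eventually_ball_finite[rotated]) simp
  then have ev: "\<forall>\<^sub>F k in sequentially. snd (\<phi> (m k)) t = snd (\<phi> n) t"
  proof eventually_elim
    case (elim k)
    then have "snd (\<phi> (m k)) s = x" using le[of k] by auto
    then show ?case
      using skeletonsD(2)[OF sk, of "m k" s n t] n t approx_index(1)[OF sk] by (simp add: m_def x_def)
  qed
  obtain r where r: "strict_mono (r :: nat \<Rightarrow> nat)"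
    "\<forall>t\<ge>s. (\<lambda>k. snd (\<phi> (approx_index P \<delta> \<phi> s x (r k))) t) \<longlonglongrightarrow> theta P \<delta> l \<phi> s t x"
    using theta_limit(4)[OF sk] by blast
  have "\<forall>\<^sub>F k in sequentially. snd (\<phi> (m (r k))) t = snd (\<phi> n) t"
    using ev r(1) by (rule eventually_subseq[rotated])
  then have "(\<lambda>k. snd (\<phi> (m (r k))) t) \<longlonglongrightarrow> snd (\<phi> n) t"
    by (rule tendsto_eventually)
  moreover have "(\<lambda>k. snd (\<phi> (m (r k))) t) \<longlonglongrightarrow> theta P \<delta> l \<phi> s t x"
    using r(2) t by (simp add: m_def)
  ultimately show ?thesis
    unfolding x_def by (rule LIMSEQ_unique[rotated])
qed

text \<open>All ingredients are total functions and are measurable on the whole product space, also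
  where \<Phi> is not a skeleton. Restriction to \<open>s \<le> t\<close> and
  \<open>\<Omega>0\<close> serves only to replace \<open>extend\<close> by \<open>snd\<close> in the
  final formula.\<close>

lemma theta_measurable:
  fixes \<Phi> :: "'w \<Rightarrow> nat \<Rightarrow> 'a path"
  assumes \<Omega>0: "\<Omega>0 \<in> sets \<Omega>" "\<And>\<omega>. \<omega> \<in> \<Omega>0 \<Longrightarrow> \<Phi> \<omega> \<in> skeletons \<delta>"
    and \<Phi>: "\<And>n. cylinder_measurable \<Omega> (\<lambda>\<omega>. \<Phi> \<omega> n)" and S: "\<And>n \<omega>. \<omega> \<in> space \<Omega> \<Longrightarrow> fst (\<Phi> \<omega> n) = S n"
  shows "(\<lambda>(s, t, x, \<omega>). theta P \<delta> l (\<Phi> \<omega>) s t x) \<in>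
      restrict_space (borel \<Otimes>\<^sub>M borel \<Otimes>\<^sub>M borel \<Otimes>\<^sub>M \<Omega>) {(s, t, x, \<omega>). s \<le> t \<and> \<omega> \<in> \<Omega>0} \<rightarrow>\<^sub>M borel"
proof -
  define N where "N = (borel :: real measure) \<Otimes>\<^sub>M (borel :: real measure) \<Otimes>\<^sub>M (borel :: 'a measure) \<Otimes>\<^sub>M \<Omega>"
  have \<Phi>_ext [measurable]: "(\<lambda>\<omega>. extend (\<Phi> \<omega> n) t) \<in> borel_measurable \<Omega>" for n t
    using \<Phi> by (auto simp: cylinder_measurable_def)
  have \<Phi>_path: "\<omega> \<in> space \<Omega> \<Longrightarrow> \<Phi> \<omega> n \<in> paths" for n \<omega>
    using \<Phi> by (auto simp: cylinder_measurable_def)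
  have [measurable]: "(\<lambda>p. snd (snd (snd p))) \<in> N \<rightarrow>\<^sub>M \<Omega>" "(\<lambda>p. fst p) \<in> borel_measurable N"
    "(\<lambda>p. fst (snd p)) \<in> borel_measurable N" "(\<lambda>p. fst (snd (snd p))) \<in> borel_measurable N"
    by (simp_all add: N_def)
  have sp: "p \<in> space N \<Longrightarrow> snd (snd (snd p)) \<in> space \<Omega>" for p
    by (auto simp: N_def space_pair_measure)
  have m_ext [measurable]: "(\<lambda>p. extend (\<Phi> (snd (snd (snd p))) n) (T p)) \<in> borel_measurable N"
    if T: "T \<in> borel_measurable N" for n T
  proof (rule measurable_continuous_process[where Z="\<lambda>p. extend (\<Phi> (snd (snd (snd p))) n)", OF _ _ T])
    show "(\<lambda>p. extend (\<Phi> (snd (snd (snd p))) n) t) \<in> borel_measurable N" for t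
      by measurable
    show "continuous_on UNIV (extend (\<Phi> (snd (snd (snd p))) n))" if "p \<in> space N" for p
      using that by (intro continuous_on_extend \<Phi>_path sp)
  qed
  have restr: "(\<lambda>p. restrict_from (fst p) (\<Phi> (snd (snd (snd p))) n)) \<in> N \<rightarrow>\<^sub>M path_borel \<delta>" for n
  proof (rule measurable_path_borelI)
    show "cylinder_measurable N (\<lambda>p. restrict_from (fst p) (\<Phi> (snd (snd (snd p))) n))"
      unfolding cylinder_measurable_def extend_restrict_from
      by (auto intro!: restrict_from_paths \<Phi>_path sp m_ext)
  qed
  have [measurable]: "eps P \<delta> k \<in> borel_measurable borel" for k by (rule eps_measurable)
  have index: "(\<lambda>p. approx_index P \<delta> (\<Phi> (snd (snd (snd p)))) (fst p) (fst (snd (snd p))) k) \<in> N \<rightarrow>\<^sub>M count_space UNIV" for k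
  proof -
    \<comment> \<open>Written with the deterministic \<open>S n\<close> and with
      \<open>extend\<close>, the predicate is measurable for every \<open>n\<close>, including paths
      that have not yet started at the given time.\<close>
    have "(\<lambda>p. LEAST n. S n \<le> fst p \<and> dist (extend (\<Phi> (snd (snd (snd p))) n) (fst p)) (fst (snd (snd p))) < eps P \<delta> k (fst (snd (snd p)))) \<in> N \<rightarrow>\<^sub>M count_space UNIV"
      by measurable
    then show ?thesis
    proof (rule measurable_cong[THEN iffD1, rotated])
      fix p assume "p \<in> space N"
      then have "fst (\<Phi> (snd (snd (snd p))) n) = S n" for n by (intro S sp)
      then show "(LEAST n. S n \<le> fst p \<and> dist (extend (\<Phi> (snd (snd (snd p))) n) (fst p)) (fst (snd (snd p))) < eps P \<delta> k (fst (snd (snd p))))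
        = approx_index P \<delta> (\<Phi> (snd (snd (snd p)))) (fst p) (fst (snd (snd p))) k"
        unfolding approx_index_def active_def
        by (intro arg_cong[where f=Least] ext) (auto simp: extend_eq_snd)
    qed
  qed
  have "(\<lambda>p k. restrict_from (fst p) (\<Phi> (snd (snd (snd p))) (approx_index P \<delta> (\<Phi> (snd (snd (snd p)))) (fst p) (fst (snd (snd p))) k)))
      \<in> N \<rightarrow>\<^sub>M PiM UNIV (\<lambda>_. path_borel \<delta>)"
    by (rule measurable_PiM_single') (auto intro!: measurable_compose_countable[OF restr index] restrict_from_paths \<Phi>_path sp)
  then have L: "(\<lambda>p. l (\<lambda>k. restrict_from (fst p) (\<Phi> (snd (snd (snd p))) (approx_index P \<delta> (\<Phi> (snd (snd (snd p)))) (fst p) (fst (snd (snd p))) k))))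
      \<in> N \<rightarrow>\<^sub>M path_borel \<delta>" (is "?L \<in> _")
    by (rule measurable_compose[OF _ selector[unfolded limit_point_selector_def, THEN conjunct1]])
  have "(\<lambda>p. extend (?L p) (fst (snd p))) \<in> borel_measurable N"
  proof (rule measurable_continuous_process)
    show "(\<lambda>p. extend (?L p) t) \<in> borel_measurable N" for t
      by (rule measurable_compose[OF L]) simp
    show "continuous_on UNIV (extend (?L p))" if "p \<in> space N" for p
      using measurable_space[OF L that] by (intro continuous_on_extend) simp
  qed measurable
  then have "(\<lambda>p. extend (?L p) (fst (snd p))) \<in> borel_measurable (restrict_space N {(s, t, x, \<omega>). s \<le> t \<and> \<omega> \<in> \<Omega>0})"
    by (rule measurable_restrict_space1)
  then show ?thesis
    unfolding N_def[symmetric]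
  proof (rule measurable_cong[THEN iffD1, rotated])
    fix p assume "p \<in> space (restrict_space N {(s, t, x, \<omega>). s \<le> t \<and> \<omega> \<in> \<Omega>0})"
    then obtain s t x \<omega> where p: "p = (s, t, x, \<omega>)" "s \<le> t" "\<omega> \<in> \<Omega>0"
      by (cases p) (auto simp: space_restrict_space)
    show "extend (?L p) (fst (snd p)) = (case p of (s, t, x, \<omega>) \<Rightarrow> theta P \<delta> l (\<Phi> \<omega>) s t x)"
      using p theta_limit(2)[OF \<Omega>0(2)[OF p(3)], of s x] by (simp add: theta_def extend_eq_snd)
  qed
qed

end

section \<open>Measures on the powers of the state space\<close>

text \<open>The \<sigma>-algebra generated by \<open>G\<close> may be smaller than that of the
  measures. The Markov property needs this form, since its event ranges over the past only.\<close>

lemma emeasure_eq_on_sigma_sets: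
  assumes fin: "finite_measure \<mu>" "finite_measure \<nu>" and sets: "sets \<mu> = sets \<nu>"
    and G: "Int_stable G" "G \<subseteq> sets \<mu>"
    and eq: "\<And>A. A \<in> G \<Longrightarrow> emeasure \<mu> A = emeasure \<nu> A"
    and space: "emeasure \<mu> (space \<mu>) = emeasure \<nu> (space \<mu>)"
    and A: "A \<in> sigma_sets (space \<mu>) G"
  shows "emeasure \<mu> A = emeasure \<nu> A"
proof -
  interpret \<mu>: finite_measure \<mu> by fact
  interpret \<nu>: finite_measure \<nu> by fact
  have sp: "space \<nu> = space \<mu>" using sets sets_eq_imp_space_eq by metis
  have sub: "sigma_sets (space \<mu>) G \<subseteq> sets \<mu>"
    using G(2) by (rule sets.sigma_sets_subset)
  have Gsp: "G \<subseteq> Pow (space \<mu>)" using G(2) sets.sets_into_space by blast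
  show ?thesis
    using G(1) Gsp A
  proof (induction rule: sigma_sets_induct_disjoint)
    case (basic A) then show ?case by (rule eq)
  next
    case empty then show ?case by simp
  next
    case (compl A)
    then have "A \<in> sets \<mu>" using sub by blast
    then show ?case
      using emeasure_compl[of A \<mu>] emeasure_compl[of A \<nu>] compl.IH space
      by (simp add: sets sp)
  next
    case (union A)
    then have "range A \<subseteq> sets \<mu>" using sub by blast
    then show ?case
      using suminf_emeasure[of A \<mu>] suminf_emeasure[of A \<nu>] union by (simp add: sets)
  qed
qed

text \<open>A closed set is the countable union of its intersections with balls of integer radius
  around an arbitrary point, and these intersections are compact.\<close>

lemma borel_eq_sigma_compact: "sets (borel :: 'a::heine_borel measure) = sigma_sets UNIV {K. compact K}"
proof
  have "closed C \<Longrightarrow> C \<in> sigma_sets UNIV {K. compact K}" for C :: "'a set"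
  proof -
    assume C: "closed C"
    have "C = (\<Union>n. C \<inter> cball undefined (real n))"
    proof -
      have "\<exists>n. dist undefined x \<le> real n" for x :: 'a by (rule real_arch_simple)
      then show ?thesis by auto
    qed
    moreover have "C \<inter> cball undefined (real n) \<in> sigma_sets UNIV {K. compact K}" for n
      using C by (intro sigma_sets.Basic) (auto intro: closed_Int_compact)
    ultimately show ?thesis
      using sigma_sets.Union[of "\<lambda>n. C \<inter> cball undefined (real n)" UNIV "{K. compact K}"] by simp
  qed
  then show "sets borel \<subseteq> sigma_sets UNIV {K :: 'a set. compact K}"
    unfolding borel_eq_closed by (subst sets_measure_of) (auto intro!: sigma_sets_mono)
  show "sigma_sets UNIV {K :: 'a set. compact K} \<subseteq> sets borel"
    using sets.sigma_sets_subset[of "{K :: 'a set. compact K}" borel]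
    by (auto intro: borel_closed compact_imp_closed)
qed

lemma space_Mpow: "space (Mpow n) = PiE {..<n} (\<lambda>_. UNIV)"
  by (simp add: Mpow_def space_PiM)

lemma topspace_Mpow_top: "topspace (Mpow_top n) = PiE {..<n} (\<lambda>_. UNIV)"
  by (simp add: Mpow_top_def)

lemma sets_Mpow_compact:
  "sets (Mpow n :: (nat \<Rightarrow> 'a::{heine_borel,polish_space}) measure) =
    sigma_sets (space (Mpow n)) {PiE {..<n} K | K. \<forall>i\<in>{..<n}. compact (K i)}"
proof -
  let ?C = "{K :: 'a set. compact K}"
  let ?B = "{{f\<in>PiE {..<n} (\<lambda>_. UNIV). \<forall>i\<in>j. f i \<in> A i} | A j. j \<in> {{..<n}} \<and> A \<in> Pi j (\<lambda>_. ?C)}"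
  have UN: "UNIV = \<Union>(range (\<lambda>j. cball (undefined :: 'a) (real j)))"
    using real_arch_simple by auto
  have "sets (Mpow n :: (nat \<Rightarrow> 'a) measure) = sets (PiM {..<n} (\<lambda>_. sigma UNIV ?C))"
    unfolding Mpow_def by (intro sets_PiM_cong) (simp_all add: borel_eq_sigma_compact)
  also have "\<dots> = sets (sigma (PiE {..<n} (\<lambda>_. UNIV)) ?B)"
  proof (rule sets_PiM_sigma[where E="\<lambda>_. ?C" and \<Omega>="\<lambda>_. UNIV" and I="{..<n}" and J="{{..<n}}"])
    show "\<exists>S\<subseteq>?C. countable S \<and> UNIV = \<Union>S"
      by (rule exI[of _ "range (\<lambda>j. cball (undefined :: 'a) (real j))"])
        (intro conjI UN image_subsetI, simp_all)
  qed simp_all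
  also have "\<dots> = sigma_sets (PiE {..<n} (\<lambda>_. UNIV)) ?B"
    by (rule sets_measure_of) auto
  also have "?B = {PiE {..<n} K | K. \<forall>i\<in>{..<n}. compact (K i)}"
  proof -
    have "{f\<in>PiE {..<n} (\<lambda>_. UNIV). \<forall>i\<in>{..<n}. f i \<in> A i} = PiE {..<n} A" for A :: "nat \<Rightarrow> 'a set"
      by (rule set_eqI) (unfold mem_Collect_eq PiE_iff, blast)
    then have "?B = {PiE {..<n} A | A. A \<in> Pi {..<n} (\<lambda>_. ?C)}"
      by simp
    then show ?thesis by (simp add: Pi_iff)
  qed
  finally show ?thesis by (simp add: space_Mpow)
qed

text \<open>The indicator of a compact box is a decreasing limit of products of functions that are
  continuous with compact support.\<close>

lemma Mpow_measure_eqI: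
  fixes \<mu> \<nu> :: "(nat \<Rightarrow> 'a::{heine_borel,polish_space}) measure"
  assumes prob: "prob_space \<mu>" "prob_space \<nu>"
    and sets: "sets \<mu> = sets (Mpow n)" "sets \<nu> = sets (Mpow n)"
    and eq: "\<And>f. f \<in> C0 (Mpow_top n) \<Longrightarrow> (\<integral>x. f x \<partial>\<mu>) = (\<integral>x. f x \<partial>\<nu>)"
  shows "\<mu> = \<nu>"
proof -
  interpret \<mu>: prob_space \<mu> by fact
  interpret \<nu>: prob_space \<nu> by fact
  have sp: "space \<mu> = PiE {..<n} (\<lambda>_. UNIV)" "space \<nu> = PiE {..<n} (\<lambda>_. UNIV)"
    using sets[THEN sets_eq_imp_space_eq] by (simp_all add: space_Mpow)
  have box: "emeasure \<mu> (PiE {..<n} K) = emeasure \<nu> (PiE {..<n} K)"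
    if K: "\<forall>i\<in>{..<n}. compact (K i)" for K
  proof (cases "PiE {..<n} K = {}")
    case False
    \<comment> \<open>Empty factors have to be excluded, because \<open>infdist\<close> to the empty
      set is 0 by convention and the corresponding factor of \<open>f\<close> would be 1.\<close>
    then have ne: "K i \<noteq> {}" if "i < n" for i
      using that by (auto simp: PiE_eq_empty_iff)
    define f where "f j z = (\<Prod>i<n. max 0 (1 - real j * infdist (z i) (K i)))" for j :: nat and z :: "nat \<Rightarrow> 'a"
    have box_m: "PiE {..<n} K \<in> sets (Mpow n)"
      unfolding sets_Mpow_compact using K by (intro sigma_sets.Basic) auto
    have cont1: "continuous_map (Mpow_top n) euclideanreal (\<lambda>z. max 0 (1 - real j * infdist (z i) (K i)))"
      if "i < n" for i j
    proof -
      have "continuous_map (Mpow_top n) euclidean (\<lambda>z. z i :: 'a)"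
        unfolding Mpow_top_def using that by (intro continuous_map_product_projection) auto
      moreover have "continuous_map euclidean euclideanreal (\<lambda>y. max 0 (1 - real j * infdist y (K i)))"
        by (auto intro!: continuous_intros)
      ultimately show ?thesis
        using continuous_map_compose[of "Mpow_top n" euclidean "\<lambda>z. z i" euclideanreal "\<lambda>y. max 0 (1 - real j * infdist y (K i))"]
        by (simp add: o_def)
    qed
    \<comment> \<open>Index 0 is skipped: \<open>f 0\<close> is the constant 1. For a slope of at
      least 1 the function vanishes outside the product of the closed unit neighbourhoods
      \<open>L i\<close> of the \<open>K i\<close>.\<close>
    have C0: "f (Suc j) \<in> C0 (Mpow_top n)" for j
      unfolding C0_def mem_Collect_eq
    proof
      show "continuous_map (Mpow_top n) euclideanreal (f (Suc j))"
        unfolding f_def by (intro continuous_map_prod cont1) auto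
      define L where "L i = {y. infdist y (K i) \<le> 1}" for i
      have L: "compact (L i)" if i_n: "i < n" for i
      proof -
        have "closed (L i)" unfolding L_def by (intro closed_Collect_le continuous_intros)
        moreover have "bounded (L i)"
        proof -
          obtain x B where xB: "\<And>y. y \<in> K i \<Longrightarrow> dist x y \<le> B"
            using compact_imp_bounded[of "K i"] K i_n by (auto simp: bounded_def)
          have "dist x y \<le> B + 2" if y: "y \<in> L i" for y
          proof -
            have "infdist y (K i) < 2" using y by (simp add: L_def)
            then obtain a where a: "a \<in> K i" "dist y a < 2"
              using ne[OF i_n] infdist_notempty[of "K i" y]
              by (metis cINF_less_iff bdd_below_image_dist image_is_empty)
            then show ?thesis using xB[OF a(1)] dist_triangle[of x y a] by (simp add: dist_commute)
          qed
          then show ?thesis unfolding bounded_def by blast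
        qed
        ultimately show ?thesis by (simp add: compact_eq_bounded_closed)
      qed
      have zero: "f (Suc j) z = 0" if z: "z \<in> topspace (Mpow_top n) - PiE {..<n} L" for z
      proof -
        have "\<exists>i<n. z i \<notin> L i" using z by (auto simp: topspace_Mpow_top PiE_iff)
        then obtain i where "i < n" "z i \<notin> L i" by blast
        then have "1 < infdist (z i) (K i)" by (simp add: L_def)
        moreover have "infdist (z i) (K i) \<le> real (Suc j) * infdist (z i) (K i)"
          using infdist_nonneg[of "z i" "K i"] by (simp add: mult_le_cancel_right1)
        ultimately have "max 0 (1 - real (Suc j) * infdist (z i) (K i)) = 0" by linarith
        then show ?thesis unfolding f_def using \<open>i < n\<close> by (intro prod_zero) auto
      qed
      show "vanishes_at_infinity (Mpow_top n) (f (Suc j))"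
        unfolding vanishes_at_infinity_def
      proof (intro allI impI exI conjI ballI)
        show "compactin (Mpow_top n) (PiE {..<n} L)"
          unfolding Mpow_top_def compactin_PiE using L by auto
        show "\<bar>f (Suc j) z\<bar> < e" if "0 < e" "z \<in> topspace (Mpow_top n) - PiE {..<n} L" for e z
          using zero[OF that(2)] that(1) by simp
      qed
    qed
    have bound: "\<bar>f j z\<bar> \<le> 1" for j z
    proof -
      have "0 \<le> f j z" unfolding f_def by (intro prod_nonneg) auto
      moreover have "f j z \<le> 1" unfolding f_def
        by (intro prod_le_1) (auto simp: infdist_nonneg)
      ultimately show ?thesis by simp
    qed
    have lim: "(\<lambda>j. f (Suc j) z) \<longlonglongrightarrow> indicator (PiE {..<n} K) z" if z: "z \<in> PiE {..<n} (\<lambda>_. UNIV)" for z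
    proof (cases "z \<in> PiE {..<n} K")
      case True
      then have "infdist (z i) (K i) = 0" if "i < n" for i
        using that by (intro infdist_zero PiE_mem[of z "{..<n}" K]) simp_all
      then have "f (Suc j) z = 1" for j
        unfolding f_def by simp
      with True show ?thesis by simp
    next
      case False
      then have "\<exists>i<n. z i \<notin> K i" using z by (auto simp: PiE_iff)
      then obtain i where i: "i < n" "z i \<notin> K i" by blast
      then have "infdist (z i) (K i) > 0"
        using in_closed_iff_infdist_zero[of "K i" "z i"] K ne infdist_nonneg[of "z i" "K i"]
        by (auto simp: compact_imp_closed less_le)
      then obtain N where N: "1 < real N * infdist (z i) (K i)"
        using reals_Archimedean3 by blast
      have "\<forall>\<^sub>F j in sequentially. f (Suc j) z = 0"
        unfolding eventually_sequentially
      proof (intro exI allI impI)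
        fix j assume "N \<le> j"
        then have "real N * infdist (z i) (K i) \<le> real (Suc j) * infdist (z i) (K i)"
          by (intro mult_right_mono infdist_nonneg) simp
        then have "max 0 (1 - real (Suc j) * infdist (z i) (K i)) = 0" using N by linarith
        then show "f (Suc j) z = 0" unfolding f_def using i by (intro prod_zero) auto
      qed
      then show ?thesis using False by (auto intro: tendsto_eventually)
    qed
    have conv: "(\<lambda>j. \<integral>z. f (Suc j) z \<partial>M) \<longlonglongrightarrow> measure M (PiE {..<n} K)"
      if M: "sets M = sets (Mpow n)" "prob_space M" for M
    proof -
      interpret prob_space M by fact
      have spM: "space M = PiE {..<n} (\<lambda>_. UNIV)"
        using M(1)[THEN sets_eq_imp_space_eq] by (simp add: space_Mpow)
      have "(\<lambda>j. \<integral>z. f (Suc j) z \<partial>M) \<longlonglongrightarrow> (\<integral>z. indicator (PiE {..<n} K) z \<partial>M)"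
      proof (rule integral_dominated_convergence[where w="\<lambda>_. 1"])
        show "indicator (PiE {..<n} K) \<in> borel_measurable M"
          using box_m M(1) by simp
        show "f (Suc j) \<in> borel_measurable M" for j
        proof -
          have "(\<lambda>z. max 0 (1 - real (Suc j) * infdist (z i) (K i))) \<in> borel_measurable (Mpow n)" if "i < n" for i
          proof (rule measurable_compose[of "\<lambda>z. z i" _ borel])
            show "(\<lambda>z. z i) \<in> Mpow n \<rightarrow>\<^sub>M borel"
              unfolding Mpow_def using that by (intro measurable_component_singleton) simp
            show "(\<lambda>y. max 0 (1 - real (Suc j) * infdist y (K i))) \<in> borel_measurable borel"
              by (intro borel_measurable_continuous_onI continuous_intros)
          qed
          then have "f (Suc j) \<in> borel_measurable (Mpow n)"
            unfolding f_def by (intro borel_measurable_prod) simp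
          then show ?thesis by (simp add: measurable_cong_sets[OF M(1) refl])
        qed
      qed (use lim bound spM in auto)
      then show ?thesis using box_m M(1) by (simp add: sets.Int_space_eq2)
    qed
    have "measure \<mu> (PiE {..<n} K) = measure \<nu> (PiE {..<n} K)"
      using conv[OF sets(1) prob(1)] conv[OF sets(2) prob(2)] eq[OF C0] by (auto intro: LIMSEQ_unique)
    then show ?thesis by (simp add: \<mu>.emeasure_eq_measure \<nu>.emeasure_eq_measure)
  qed simp
  show ?thesis
  proof (rule measure_eqI)
    show "sets \<mu> = sets \<nu>" using sets by simp
    fix A assume "A \<in> sets \<mu>"
    then have A: "A \<in> sigma_sets (space \<mu>) {PiE {..<n} K | K. \<forall>i\<in>{..<n}. compact (K i)}"
      using sets sp by (simp add: sets_Mpow_compact space_Mpow)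
    show "emeasure \<mu> A = emeasure \<nu> A"
    proof (rule emeasure_eq_on_sigma_sets[OF _ _ _ _ _ _ _ A])
      show "Int_stable {PiE {..<n} K | K :: nat \<Rightarrow> 'a set. \<forall>i\<in>{..<n}. compact (K i)}"
      proof (rule Int_stableI, clarsimp)
        fix K K' :: "nat \<Rightarrow> 'a set" assume "\<forall>i\<in>{..<n}. compact (K i)" "\<forall>i\<in>{..<n}. compact (K' i)"
        then show "\<exists>L. PiE {..<n} K \<inter> PiE {..<n} K' = PiE {..<n} L \<and> (\<forall>i\<in>{..<n}. compact (L i))"
          by (intro exI[of _ "\<lambda>i. K i \<inter> K' i"]) (auto simp: PiE_Int intro: compact_Int)
      qed
      show "{PiE {..<n} K | K :: nat \<Rightarrow> 'a set. \<forall>i\<in>{..<n}. compact (K i)} \<subseteq> sets \<mu>"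
        unfolding sets sets_Mpow_compact by (rule subsetI, rule sigma_sets.Basic)
      show "emeasure \<mu> (space \<mu>) = emeasure \<nu> (space \<mu>)"
        using \<mu>.emeasure_space_1 \<nu>.emeasure_space_1 sp by simp
    qed (use box sets in \<open>auto intro: \<mu>.finite_measure_axioms \<nu>.finite_measure_axioms\<close>)
  qed
qed

section \<open>Path laws\<close>

definition cylinder :: "nat \<Rightarrow> real set \<Rightarrow> (real \<Rightarrow> (nat \<Rightarrow> 'a) set) \<Rightarrow> (real \<Rightarrow> nat \<Rightarrow> 'a::{heine_borel,polish_space}) set"
  where "cylinder n J A = {w\<in>space (Cpow n). \<forall>u\<in>J. w u \<in> A u}"

definition cylinders :: "nat \<Rightarrow> real \<Rightarrow> (real \<Rightarrow> nat \<Rightarrow> 'a::{heine_borel,polish_space}) set set"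
  where "cylinders n s = {cylinder n J A | J A. finite J \<and> J \<subseteq> {0..s} \<and> (\<forall>u\<in>J. A u \<in> sets (Mpow n))}"

lemma Int_stable_cylinders: "Int_stable (cylinders n s)"
proof (rule Int_stableI)
  fix C C' :: "(real \<Rightarrow> nat \<Rightarrow> 'a) set" assume "C \<in> cylinders n s" "C' \<in> cylinders n s"
  then obtain J A J' A' where C: "C = cylinder n J A" "finite J" "J \<subseteq> {0..s}" "\<forall>u\<in>J. A u \<in> sets (Mpow n)"
    and C': "C' = cylinder n J' A'" "finite J'" "J' \<subseteq> {0..s}" "\<forall>u\<in>J'. A' u \<in> sets (Mpow n)"
    unfolding cylinders_def by blast
  define B where "B u = (if u \<in> J then if u \<in> J' then A u \<inter> A' u else A u else A' u)" for u
  have "C \<inter> C' = cylinder n (J \<union> J') B"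
    unfolding C(1) C'(1) cylinder_def B_def by auto
  moreover have "\<forall>u\<in>J \<union> J'. B u \<in> sets (Mpow n)" using C C' by (auto simp: B_def)
  ultimately show "C \<inter> C' \<in> cylinders n s"
    unfolding cylinders_def using C C' by (intro CollectI exI[of _ "J \<union> J'"] exI[of _ B]) auto
qed

lemma measurable_Cpow_eval: "u \<ge> 0 \<Longrightarrow> (\<lambda>w. w u) \<in> Cpow n \<rightarrow>\<^sub>M Mpow n"
  unfolding Cpow_def by (intro measurable_restrict_space1 measurable_component_singleton) simp

lemma cylinder_in_past:
  assumes "finite J" "J \<subseteq> {0..s}" "\<forall>u\<in>J. A u \<in> sets (Mpow n)"
  shows "cylinder n J A \<in> past n s"
  using assms
proof (induction J rule: finite_induct)
  case empty
  then show ?case by (simp add: cylinder_def past_def sigma_sets_top)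
next
  case (insert u J)
  let ?G = "{{w\<in>space (Cpow n). w u \<in> C} | u C. 0 \<le> u \<and> u \<le> s \<and> C \<in> sets (Mpow n)}"
  have *: "sigma_algebra (space (Cpow n)) (sigma_sets (space (Cpow n)) ?G)"
    by (rule sigma_algebra_sigma_sets) auto
  have "cylinder n (insert u J) A = {w\<in>space (Cpow n). w u \<in> A u} \<inter> cylinder n J A"
    by (auto simp: cylinder_def)
  moreover have "{w\<in>space (Cpow n). w u \<in> A u} \<in> past n s"
    unfolding past_def using insert.prems by (intro sigma_sets.Basic) auto
  moreover have "cylinder n J A \<in> past n s" using insert by auto
  ultimately show ?case
    using semiring_of_sets.Int[OF ring_of_sets.axioms(1)[OF algebra.axioms(1)[OF sigma_algebra.axioms(1)[OF *]]]]
    unfolding past_def by simp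
qed

text \<open>The generators in \<open>past\<close> constrain one time each and are not closed under
  intersection in general. Finite-time cylinders generate the same \<sigma>-algebra and form a
  \<pi>-system.\<close>

lemma past_eq_cylinders:
  "past n s = sigma_sets (space (Cpow n)) (cylinders n s :: (real \<Rightarrow> nat \<Rightarrow> 'a::{heine_borel,polish_space}) set set)"
    (is "?P = sigma_sets ?\<Omega> ?C")
proof
  let ?G = "{{w\<in>?\<Omega>. w u \<in> C} | u C. 0 \<le> u \<and> u \<le> s \<and> C \<in> sets (Mpow n)}"
  have P: "?P = sigma_sets ?\<Omega> ?G" by (rule past_def)
  have "?G \<subseteq> sigma_sets ?\<Omega> ?C"
  proof (rule subsetI)
    fix Z :: "(real \<Rightarrow> nat \<Rightarrow> 'a) set"
    assume "Z \<in> ?G"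
    then obtain u C where "Z = cylinder n {u} (\<lambda>_. C)" "0 \<le> u" "u \<le> s" "C \<in> sets (Mpow n)"
      by (auto simp: cylinder_def)
    then have "Z \<in> cylinders n s"
      unfolding cylinders_def by (intro CollectI exI[of _ "{u}"] exI[of _ "\<lambda>_. C"]) simp
    then show "Z \<in> sigma_sets ?\<Omega> ?C"
      by (rule sigma_sets.Basic)
  qed
  then show "?P \<subseteq> sigma_sets ?\<Omega> ?C"
    unfolding P by (rule sigma_sets_mono)
  have "?C \<subseteq> ?P"
  proof (rule subsetI)
    fix Z assume "Z \<in> ?C"
    then obtain J A where "Z = cylinder n J A" "finite J" "J \<subseteq> {0..s}" "\<forall>u\<in>J. A u \<in> sets (Mpow n)"
      unfolding cylinders_def by (elim CollectE exE conjE)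
    then show "Z \<in> ?P" using cylinder_in_past by simp
  qed
  then show "sigma_sets ?\<Omega> ?C \<subseteq> ?P"
    unfolding P by (rule sigma_sets_mono)
qed

lemma cylinder_sets:
  assumes "finite J" "J \<subseteq> {0..}" "\<forall>u\<in>J. A u \<in> sets (Mpow n)"
  shows "cylinder n J A \<in> sets (Cpow n)"
  unfolding cylinder_def
proof (rule sets.sets_Collect_finite_All)
  show "{w\<in>space (Cpow n). w u \<in> A u} \<in> sets (Cpow n)" if "u \<in> J" for u
    using measurable_sets[OF measurable_Cpow_eval, of u "A u" n] that assms
    by (auto simp: vimage_def Int_def conj_commute)
qed fact

lemma past_sets:
  fixes Z :: "(real \<Rightarrow> nat \<Rightarrow> 'a::{heine_borel,polish_space}) set"
  assumes "Z \<in> past n s"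
  shows "Z \<in> sets (Cpow n)"
proof -
  have "Z \<in> sets (Cpow n)" if "Z \<in> cylinders n s" for Z :: "(real \<Rightarrow> nat \<Rightarrow> 'a) set"
  proof -
    from that obtain J A where "Z = cylinder n J A" "finite J" "J \<subseteq> {0..s}" "\<forall>u\<in>J. A u \<in> sets (Mpow n)"
      unfolding cylinders_def by (elim CollectE exE conjE)
    then show ?thesis using cylinder_sets[of J A n] by fastforce
  qed
  then have "sigma_sets (space (Cpow n)) (cylinders n s) \<subseteq> sets (Cpow n :: (real \<Rightarrow> nat \<Rightarrow> 'a) measure)"
    by (intro sets.sigma_sets_subset subsetI)
  then show ?thesis using assms unfolding past_eq_cylinders by (rule subsetD)
qed

lemma kernel_measurable:
  assumes "feller_transition_function n (P n)" "t \<ge> 0" "B \<in> sets (Mpow n)"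
  shows "(\<lambda>z. emeasure (P n t z) B) \<in> borel_measurable (Mpow n)"
proof -
  have "P n t \<in> Mpow n \<rightarrow>\<^sub>M subprob_algebra (Mpow n)"
    using assms(1,2) by (auto simp: feller_transition_function_def intro: measurable_prob_algebraD)
  from measurable_compose[OF this measurable_emeasure_subprob_algebra[OF assms(3)]] show ?thesis .
qed

lemma kernel_prob_space:
  assumes "feller_transition_function n (P n)" "t \<ge> 0" "z \<in> space (Mpow n)"
  shows "prob_space (P n t z)" "sets (P n t z) = sets (Mpow n)"
proof -
  have "P n t \<in> Mpow n \<rightarrow>\<^sub>M prob_algebra (Mpow n)"
    using assms(1,2) by (auto simp: feller_transition_function_def)
  from measurable_space[OF this assms(3)] show "prob_space (P n t z)" "sets (P n t z) = sets (Mpow n)"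
    by (auto simp: space_prob_algebra)
qed

text \<open>Induction on the largest time of a cylinder, with one additional later time
  \<open>u\<close> in the induction statement. When \<open>b\<close> is added, the hypothesis at
  \<open>u = b\<close> says that the state at \<open>b\<close>, on the event given by the earlier
  times, has the same distribution under both laws. The Markov property at \<open>b\<close> then
  integrates the kernel against this distribution.\<close>

lemma is_path_law_unique:
  fixes P :: "'a::{heine_borel,polish_space} transition"
  assumes feller: "feller_transition_function n (P n)"
    and Q1: "is_path_law P n x Q1" and Q2: "is_path_law P n x Q2"
  shows "Q1 = Q2"
proof -
  interpret Q1: prob_space Q1 using Q1 by (simp add: is_path_law_def)
  interpret Q2: prob_space Q2 using Q2 by (simp add: is_path_law_def)
  have s1: "sets Q1 = sets (Cpow n)" and s2: "sets Q2 = sets (Cpow n)"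
    using Q1 Q2 by (simp_all add: is_path_law_def)
  have sp1: "space Q1 = space (Cpow n)" and sp2: "space Q2 = space (Cpow n)"
    using s1[THEN sets_eq_imp_space_eq] s2[THEN sets_eq_imp_space_eq] by simp_all
  have markov: "emeasure Q {w\<in>A. w (s + t) \<in> B} = (\<integral>\<^sup>+w\<in>A. emeasure (P n t (w s)) B \<partial>Q)"
    if "is_path_law P n x Q" "s \<ge> 0" "t \<ge> 0" "A \<in> past n s" "B \<in> sets (Mpow n)" for Q s t A B
    using that by (simp add: is_path_law_def)
  have eval: "(\<lambda>w. w u) \<in> Q \<rightarrow>\<^sub>M Mpow n" if "sets Q = sets (Cpow n)" "u \<ge> 0" for Q u
    using measurable_Cpow_eval[OF that(2)] by (simp add: measurable_cong_sets[OF that(1) refl])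
  have cyl: "\<forall>u\<ge>0. (\<forall>j\<in>J. j \<le> u) \<longrightarrow> (\<forall>B\<in>sets (Mpow n).
      emeasure Q1 {w\<in>cylinder n J A. w u \<in> B} = emeasure Q2 {w\<in>cylinder n J A. w u \<in> B})"
    if "finite J" "J \<subseteq> {0..}" "\<forall>u\<in>J. A u \<in> sets (Mpow n)" for J A
    using that
  proof (induction J rule: finite_linorder_max_induct)
    case empty
    show ?case
    proof (intro allI impI ballI)
      fix u :: real and B :: "(nat \<Rightarrow> 'a) set" assume u: "0 \<le> u" and B: "B \<in> sets (Mpow n)"
      have top: "space (Cpow n) \<in> past n 0" by (simp add: past_def sigma_sets_top)
      have "emeasure Q {w\<in>space (Cpow n). w u \<in> B} = emeasure (P n u x) B"
        if Q: "is_path_law P n x Q" for Q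
      proof -
        interpret prob_space Q using Q by (simp add: is_path_law_def)
        have sp: "space Q = space (Cpow n)"
          by (rule sets_eq_imp_space_eq) (use Q in \<open>simp add: is_path_law_def\<close>)
        have "emeasure Q {w\<in>space (Cpow n). w u \<in> B} = (\<integral>\<^sup>+w\<in>space Q. emeasure (P n u (w 0)) B \<partial>Q)"
          using markov[OF Q _ u top B] by (simp add: sp)
        also have "\<dots> = (\<integral>\<^sup>+w. emeasure (P n u x) B \<partial>Q)"
        proof (rule nn_integral_cong_AE)
          have "AE w in Q. w 0 = x" using Q by (simp add: is_path_law_def)
          then show "AE w in Q. emeasure (P n u (w 0)) B * indicator (space Q) w = emeasure (P n u x) B"
            by (rule AE_mp) (auto intro!: AE_I2)
        qed
        finally show ?thesis by (simp add: emeasure_space_1)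
      qed
      from this[OF Q1] this[OF Q2]
      show "emeasure Q1 {w\<in>cylinder n {} A. w u \<in> B} = emeasure Q2 {w\<in>cylinder n {} A. w u \<in> B}"
        by (simp add: cylinder_def)
    qed
  next
    case (insert b J)
    have b: "b \<ge> 0" and Ab: "A b \<in> sets (Mpow n)" and J: "J \<subseteq> {0..}" "\<forall>u\<in>J. A u \<in> sets (Mpow n)"
      using insert.prems by auto
    have CJ: "cylinder n J A \<in> sets (Cpow n)" by (rule cylinder_sets[OF insert.hyps(1) J])
    \<comment> \<open>The sub-probability distribution of the state at time \<open>b\<close> on the
      event described by the earlier times.\<close>
    define \<mu> where "\<mu> Q = distr (density Q (indicator (cylinder n J A))) (Mpow n) (\<lambda>w. w b)" for Q
    have \<mu>: "emeasure (\<mu> Q) B = emeasure Q {w\<in>cylinder n J A. w b \<in> B}"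
      if "sets Q = sets (Cpow n)" "B \<in> sets (Mpow n)" for Q B
    proof -
      have m: "(\<lambda>w. w b) \<in> Q \<rightarrow>\<^sub>M Mpow n" by (rule eval[OF that(1) b])
      have sp: "space Q = space (Cpow n)" using that(1) by (rule sets_eq_imp_space_eq)
      have C: "cylinder n J A \<in> sets Q" using CJ that by simp
      have "emeasure (\<mu> Q) B = emeasure (density Q (indicator (cylinder n J A))) ((\<lambda>w. w b) -` B \<inter> space Q)"
        unfolding \<mu>_def using m that by (subst emeasure_distr) auto
      also have "\<dots> = emeasure Q (cylinder n J A \<inter> ((\<lambda>w. w b) -` B \<inter> space Q))"
        using C measurable_sets[OF m that(2)]
        by (subst emeasure_density) (auto simp flip: indicator_inter_arith)
      also have "cylinder n J A \<inter> ((\<lambda>w. w b) -` B \<inter> space Q) = {w\<in>cylinder n J A. w b \<in> B}"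
        using sp by (auto simp: cylinder_def)
      finally show ?thesis .
    qed
    have "\<mu> Q1 = \<mu> Q2"
    proof (rule measure_eqI)
      show "sets (\<mu> Q1) = sets (\<mu> Q2)" by (simp add: \<mu>_def)
      fix B assume "B \<in> sets (\<mu> Q1)"
      then have B: "B \<in> sets (Mpow n)" by (simp add: \<mu>_def)
      have "\<forall>j\<in>J. j \<le> b" using insert.hyps by auto
      then show "emeasure (\<mu> Q1) B = emeasure (\<mu> Q2) B"
        using insert.IH[OF J] b B by (simp add: \<mu> s1 s2)
    qed
    show ?case
    proof (intro allI impI ballI)
      fix u :: real and B :: "(nat \<Rightarrow> 'a) set" assume u: "\<forall>j\<in>insert b J. j \<le> u" and B: "B \<in> sets (Mpow n)"
      have past: "cylinder n (insert b J) A \<in> past n b"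
      proof (rule cylinder_in_past)
        show "finite (insert b J)" using insert.hyps by simp
        show "insert b J \<subseteq> {0..b}" using J(1) b insert.hyps(2) by (auto simp: subset_eq intro: less_imp_le)
      qed (rule insert.prems)
      have ub: "u - b \<ge> 0" using u by simp
      have k: "(\<lambda>z. emeasure (P n (u - b) z) B) \<in> borel_measurable (Mpow n)"
        by (rule kernel_measurable[where P=P, OF feller ub B])
      have "emeasure Q {w\<in>cylinder n (insert b J) A. w u \<in> B} = (\<integral>\<^sup>+z. emeasure (P n (u - b) z) B * indicator (A b) z \<partial>\<mu> Q)"
        if Q: "is_path_law P n x Q" for Q
      proof -
        have sQ: "sets Q = sets (Cpow n)" using Q by (simp add: is_path_law_def)
        have m: "(\<lambda>w. w b) \<in> Q \<rightarrow>\<^sub>M Mpow n" by (rule eval[OF sQ b])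
        have C: "cylinder n J A \<in> sets Q" using CJ sQ by simp
        have sp: "space Q = space (Cpow n)" using sQ by (rule sets_eq_imp_space_eq)
        have [measurable]: "(\<lambda>w. emeasure (P n (u - b) (w b)) B * indicator (A b) (w b)) \<in> borel_measurable Q"
          using measurable_compose[OF m k] measurable_compose[OF m borel_measurable_indicator[OF Ab]] by (rule borel_measurable_times_ennreal)
        have "emeasure Q {w\<in>cylinder n (insert b J) A. w u \<in> B}
          = (\<integral>\<^sup>+w\<in>cylinder n (insert b J) A. emeasure (P n (u - b) (w b)) B \<partial>Q)"
          using markov[OF Q b ub past B] by simp
        also have "\<dots> = (\<integral>\<^sup>+w. indicator (cylinder n J A) w * (emeasure (P n (u - b) (w b)) B * indicator (A b) (w b)) \<partial>Q)"
          by (rule nn_integral_cong) (auto simp: cylinder_def sp split: split_indicator)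
        also have "\<dots> = (\<integral>\<^sup>+w. emeasure (P n (u - b) (w b)) B * indicator (A b) (w b) \<partial>density Q (indicator (cylinder n J A)))"
          using C by (subst nn_integral_density) auto
        also have "\<dots> = (\<integral>\<^sup>+z. emeasure (P n (u - b) z) B * indicator (A b) z \<partial>\<mu> Q)"
          unfolding \<mu>_def using m k Ab by (subst nn_integral_distr) auto
        finally show ?thesis .
      qed
      from this[OF Q1] this[OF Q2] show "emeasure Q1 {w\<in>cylinder n (insert b J) A. w u \<in> B} = emeasure Q2 {w\<in>cylinder n (insert b J) A. w u \<in> B}"
        using \<open>\<mu> Q1 = \<mu> Q2\<close> by simp
    qed
  qed
  have cyl': "emeasure Q1 (cylinder n J A) = emeasure Q2 (cylinder n J A)"
    if J: "finite J" "J \<subseteq> {0..}" "\<forall>u\<in>J. A u \<in> sets (Mpow n)" for J A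
  proof -
    \<comment> \<open>An additional time with no constraint attached turns \<open>cyl\<close> into a
      statement about the cylinder alone; the inserted 0 covers the empty set of times.\<close>
    define u where "u = Max (insert 0 J)"
    have u: "u \<ge> 0" "\<forall>j\<in>J. j \<le> u" using J(1) by (auto simp: u_def)
    have "{w\<in>cylinder n J A. w u \<in> space (Mpow n)} = cylinder n J A"
      using measurable_space[OF measurable_Cpow_eval[OF u(1)]] by (auto simp: cylinder_def)
    moreover have "emeasure Q1 {w\<in>cylinder n J A. w u \<in> space (Mpow n)} = emeasure Q2 {w\<in>cylinder n J A. w u \<in> space (Mpow n)}"
      by (rule cyl[OF J, rule_format]) (use u in auto)
    ultimately show ?thesis by simp
  qed
  show ?thesis
  proof (rule measure_eqI)
    show "sets Q1 = sets Q2" using s1 s2 by simp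
    \<comment> \<open>Events of \<open>Cpow n\<close> are traces of events of the full product.
      After pushing both laws to that product, agreement on finitely many coordinates determines
      them.\<close>
    let ?N = "PiM {0..} (\<lambda>_. Mpow n :: (nat \<Rightarrow> 'a) measure)"
    have id: "(\<lambda>w. w) \<in> Cpow n \<rightarrow>\<^sub>M ?N"
      unfolding Cpow_def by (intro measurable_restrict_space1) simp
    then have id1: "(\<lambda>w. w) \<in> Q1 \<rightarrow>\<^sub>M ?N" and id2: "(\<lambda>w. w) \<in> Q2 \<rightarrow>\<^sub>M ?N"
      by (simp_all add: measurable_cong_sets[OF s1 refl] measurable_cong_sets[OF s2 refl])
    have eq: "distr Q1 ?N (\<lambda>w. w) = distr Q2 ?N (\<lambda>w. w)"
    proof (rule measure_eqI_PiM_infinite)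
      fix A :: "real \<Rightarrow> (nat \<Rightarrow> 'a) set" and J assume J: "finite J" "J \<subseteq> {0::real..}" "\<And>i. i \<in> J \<Longrightarrow> A i \<in> sets (Mpow n)"
      have pe: "prod_emb {0..} (\<lambda>_. Mpow n) J (PiE J A) \<in> sets ?N"
        using J by (intro sets_PiM_I) auto
      have sub: "space (Cpow n) \<subseteq> space ?N" using measurable_space[OF id] by auto
      have "prod_emb {0..} (\<lambda>_. Mpow n) J (PiE J A) \<inter> space (Cpow n) = cylinder n J A"
      proof -
        have "w \<in> extensional {0..} \<and> (\<forall>i\<in>{0..}. w i \<in> space (Mpow n))" if "w \<in> space (Cpow n)" for w :: "real \<Rightarrow> nat \<Rightarrow> 'a"
          using subsetD[OF sub that] by (simp add: space_PiM PiE_iff)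
        then show ?thesis
          by (intro set_eqI) (auto simp: prod_emb_iff cylinder_def restrict_PiE_iff)
      qed
      then show "emeasure (distr Q1 ?N (\<lambda>w. w)) (prod_emb {0..} (\<lambda>_. Mpow n) J (PiE J A))
         = emeasure (distr Q2 ?N (\<lambda>w. w)) (prod_emb {0..} (\<lambda>_. Mpow n) J (PiE J A))"
        using J cyl'[of J A] by (simp add: emeasure_distr[OF id1 pe] emeasure_distr[OF id2 pe] sp1 sp2)
    next
      interpret D: prob_space "distr Q1 ?N (\<lambda>w. w)" by (rule Q1.prob_space_distr[OF id1])
      show "finite_measure (distr Q1 ?N (\<lambda>w. w))" by unfold_locales
    qed simp_all
    fix B assume "B \<in> sets Q1"
    then obtain B' where B': "B' \<in> sets ?N" "B = B' \<inter> space (Cpow n)"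
      unfolding s1 by (auto simp: Cpow_def sets_restrict_space space_restrict_space
          dest: sets.sets_into_space)
    have "emeasure (distr Q1 ?N (\<lambda>w. w)) B' = emeasure (distr Q2 ?N (\<lambda>w. w)) B'" by (simp add: eq)
    then show "emeasure Q1 B = emeasure Q2 B"
      using B' by (simp add: emeasure_distr[OF id1 B'(1)] emeasure_distr[OF id2 B'(1)] sp1 sp2)
  qed
qed

lemma path_law_eqI:
  assumes "feller_transition_function n (P n)" "is_path_law P n x Q"
  shows "path_law P n x = Q"
  unfolding path_law_def using assms is_path_law_unique by blast

text \<open>For fixed \<open>s\<close>, \<open>t\<close> and \<open>B\<close>, both sides of the
  Markov identity are finite measures in the past event, so it suffices to compare them on the
  \<pi>-system of cylinders.\<close>

lemma is_path_lawI:
  fixes P :: "'a::{heine_borel,polish_space} transition"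
  assumes feller: "feller_transition_function n (P n)"
    and Q: "prob_space Q" "sets Q = sets (Cpow n)" "AE w in Q. w 0 = x"
    and cyl: "\<And>s t J A B. 0 \<le> s \<Longrightarrow> 0 \<le> t \<Longrightarrow> finite J \<Longrightarrow> J \<subseteq> {0..s} \<Longrightarrow> \<forall>u\<in>J. A u \<in> sets (Mpow n) \<Longrightarrow>
      B \<in> sets (Mpow n) \<Longrightarrow> emeasure Q {w\<in>cylinder n J A. w (s + t) \<in> B} =
        (\<integral>\<^sup>+w\<in>cylinder n J A. emeasure (P n t (w s)) B \<partial>Q)"
  shows "is_path_law P n x Q"
  unfolding is_path_law_def
proof (intro conjI allI impI ballI Q)
  fix s t :: real and A :: "(real \<Rightarrow> nat \<Rightarrow> 'a) set" and B :: "(nat \<Rightarrow> 'a) set"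
  assume s: "0 \<le> s" and t: "0 \<le> t" and A: "A \<in> past n s" and B: "B \<in> sets (Mpow n)"
  interpret Q: prob_space Q by fact
  have sp: "space Q = space (Cpow n)" using Q(2) by (rule sets_eq_imp_space_eq)
  have eval: "(\<lambda>w. w u) \<in> Q \<rightarrow>\<^sub>M Mpow n" if "u \<ge> 0" for u
    using measurable_Cpow_eval[OF that] by (simp add: measurable_cong_sets[OF Q(2) refl])
  define B' where "B' = {w\<in>space Q. w (s + t) \<in> B}"
  have B': "B' \<in> sets Q"
    using measurable_sets[OF eval B, of "s + t"] s t by (auto simp: B'_def vimage_def Int_def conj_commute)
  have k: "(\<lambda>w. emeasure (P n t (w s)) B) \<in> borel_measurable Q"
    by (rule measurable_compose[OF eval[OF s] kernel_measurable[where P=P, OF feller t B]])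
  define \<mu> where "\<mu> = density Q (indicator B')"
  define \<nu> where "\<nu> = density Q (\<lambda>w. emeasure (P n t (w s)) B)"
  have \<mu>: "emeasure \<mu> A = emeasure Q {w\<in>A. w (s + t) \<in> B}" if "A \<in> sets Q" for A
  proof -
    have "{w\<in>A. w (s + t) \<in> B} = B' \<inter> A" using sets.sets_into_space[OF that] by (auto simp: B'_def)
    then show ?thesis
      unfolding \<mu>_def using B' that by (subst emeasure_density) (auto simp flip: indicator_inter_arith)
  qed
  have \<nu>: "emeasure \<nu> A = (\<integral>\<^sup>+w\<in>A. emeasure (P n t (w s)) B \<partial>Q)" if "A \<in> sets Q" for A
    unfolding \<nu>_def using k that by (rule emeasure_density)
  have le1: "emeasure (P n t (w s)) B \<le> 1" if "w \<in> space Q" for w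
    by (rule prob_space.emeasure_le_1[OF kernel_prob_space(1)[where P=P, OF feller t measurable_space[OF eval[OF s] that]]])
  have sets: "cylinder n J A \<in> sets Q" if "finite J" "J \<subseteq> {0..s}" "\<forall>u\<in>J. A u \<in> sets (Mpow n)" for J A
    unfolding Q(2) by (rule cylinder_sets) (use that in auto)
  have "emeasure \<mu> A = emeasure \<nu> A"
  proof (rule emeasure_eq_on_sigma_sets[where G="cylinders n s"])
    show "finite_measure \<mu>"
      by (rule finite_measureI) (simp add: \<mu> \<mu>_def[THEN arg_cong[where f=space]])
    have "emeasure \<nu> (space \<nu>) = (\<integral>\<^sup>+w\<in>space Q. emeasure (P n t (w s)) B \<partial>Q)"
      by (simp add: \<nu>_def \<nu>[OF sets.top, unfolded \<nu>_def])
    also have "\<dots> \<le> (\<integral>\<^sup>+w. 1 \<partial>Q)"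
      by (intro nn_integral_mono) (auto intro: le1 split: split_indicator)
    finally have "emeasure \<nu> (space \<nu>) \<le> (\<integral>\<^sup>+w. 1 \<partial>Q)" .
    then show "finite_measure \<nu>"
      by (intro finite_measureI) (auto simp: Q.emeasure_space_1 top_unique)
    show "cylinders n s \<subseteq> sets \<mu>" using sets by (auto simp: \<mu>_def cylinders_def)
    show "A \<in> sigma_sets (space \<mu>) (cylinders n s)"
      using A by (simp add: past_eq_cylinders \<mu>_def sp)
    show *: "emeasure \<mu> C = emeasure \<nu> C" if "C \<in> cylinders n s" for C
      using that cyl[OF s t _ _ _ B] sets by (auto simp: cylinders_def \<mu> \<nu>)
    \<comment> \<open>Equality of the total masses is the case of a cylinder without times.\<close>
    have "space \<mu> = cylinder n {} (\<lambda>_. {})" by (simp add: cylinder_def \<mu>_def sp)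
    then have "space \<mu> \<in> cylinders n s" by (auto simp: cylinders_def intro!: exI[of _ "{}"] exI[of _ "\<lambda>_. {}"])
    then show "emeasure \<mu> (space \<mu>) = emeasure \<nu> (space \<mu>)" by (rule *)
  qed (simp_all add: Int_stable_cylinders \<mu>_def \<nu>_def)
  then show "emeasure Q {w\<in>A. w (s + t) \<in> B} = (\<integral>\<^sup>+w\<in>A. emeasure (P n t (w s)) B \<partial>Q)"
    using past_sets[OF A] Q(2) by (simp add: \<mu> \<nu>)
qed

section \<open>Independence of past and future of a flow\<close>

lemma measurable_Fspace_eval: "(\<lambda>g. g z) \<in> Fspace \<rightarrow>\<^sub>M borel"
  unfolding Fspace_def by (intro measurable_restrict_space1 measurable_component_singleton) simp

lemma space_Fspace: "space Fspace = {f. f \<in> borel \<rightarrow>\<^sub>M borel}"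
  by (simp add: Fspace_def space_restrict_space space_PiM)

lemma measurable_FspaceI:
  assumes "\<And>\<omega>. \<omega> \<in> space N \<Longrightarrow> G \<omega> \<in> space Fspace" "\<And>z. (\<lambda>\<omega>. G \<omega> z) \<in> N \<rightarrow>\<^sub>M borel"
  shows "G \<in> N \<rightarrow>\<^sub>M Fspace"
proof -
  have "G \<in> N \<rightarrow>\<^sub>M PiM UNIV (\<lambda>_. borel)"
    by (rule measurable_PiM_single') (simp_all add: assms(2))
  then show ?thesis
    unfolding Fspace_def using assms(1) by (intro measurable_restrict_space2) (auto simp: space_Fspace)
qed

lemma space_Mpow2_pair: "pair x y \<in> space (Mpow 2)"
  by (simp add: space_Mpow pair_def)

lemma pair_measurable:
  assumes "X \<in> N \<rightarrow>\<^sub>M borel" "Y \<in> N \<rightarrow>\<^sub>M borel"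
  shows "(\<lambda>\<omega>. pair (X \<omega>) (Y \<omega>)) \<in> N \<rightarrow>\<^sub>M Mpow 2"
  unfolding Mpow_def pair_def
  by (rule measurable_restrict) (use assms in auto)

text \<open>\<open>Mpow_top n\<close> is a topology on extensional functions, whereas Borel sets
  belong to a topology on a type. Composition with the restriction map \<open>e\<close> gives a
  continuous function on all of \<open>nat \<Rightarrow> 'a\<close>, where the Borel sets are the
  product \<sigma>-algebra, and \<open>e\<close> undoes the extension of a point by
  \<open>undefined\<close>.\<close>

lemma C0_measurable:
  fixes f :: "(nat \<Rightarrow> 'a::{heine_borel,polish_space}) \<Rightarrow> real"
  assumes "f \<in> C0 (Mpow_top n)"
  shows "f \<in> borel_measurable (Mpow n)"
proof -
  define e where "e = (\<lambda>z :: nat \<Rightarrow> 'a. \<lambda>i\<in>{..<n}. z i)"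
  have "continuous_map euclidean (Mpow_top n) e"
    unfolding Mpow_top_def e_def continuous_map_componentwise by auto
  moreover have "continuous_map (Mpow_top n) euclideanreal f"
    using assms unfolding C0_def by simp
  ultimately have "continuous_map euclidean euclideanreal (f \<circ> e)"
    by (rule continuous_map_compose)
  then have "f \<circ> e \<in> borel_measurable borel"
    by (intro borel_measurable_continuous_onI) simp
  then have fe: "(\<lambda>z. f (e z)) \<in> borel_measurable (PiM UNIV (\<lambda>_. borel :: 'a measure))"
    by (simp add: o_def measurable_cong_sets[OF sets_PiM_equal_borel refl])
  have "(\<lambda>z i. if i < n then z i else undefined) \<in> Mpow n \<rightarrow>\<^sub>M PiM UNIV (\<lambda>_. borel)"
  proof (rule measurable_PiM_single')
    show "(\<lambda>z. if i < n then z i else undefined) \<in> Mpow n \<rightarrow>\<^sub>M borel" for i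
      unfolding Mpow_def by (cases "i < n") (auto intro: measurable_component_singleton)
  qed simp
  from measurable_compose[OF this fe] show ?thesis
  proof (rule measurable_cong[THEN iffD1, rotated])
    fix z assume "z \<in> space (Mpow n :: (nat \<Rightarrow> 'a) measure)"
    then have "e (\<lambda>i. if i < n then z i else undefined) = z"
      by (auto simp: space_Mpow e_def PiE_iff extensional_def restrict_def fun_eq_iff)
    then show "f (e (\<lambda>i. if i < n then z i else undefined)) = f z" by simp
  qed
qed

locale flow =
  fixes P :: "'a::{heine_borel,polish_space} transition"
    and \<Omega> :: "'w measure"
    and \<psi> :: "real \<Rightarrow> real \<Rightarrow> 'w \<Rightarrow> 'a \<Rightarrow> 'a"
  assumes transition: "consistent_coalescing P" and flow: "stochastic_flow P \<Omega> \<psi>"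
begin

sublocale prob_space \<Omega>
  using flow by (simp add: stochastic_flow_def)

lemma feller2: "feller_transition_function 2 (P 2)"
  using transition by (simp add: consistent_coalescing_def)

lemma \<psi>_measurable: "s \<le> t \<Longrightarrow> \<psi> s t \<in> \<Omega> \<rightarrow>\<^sub>M Fspace"
  using flow by (simp add: stochastic_flow_def)

lemma \<psi>_eval_measurable: "s \<le> t \<Longrightarrow> (\<lambda>\<omega>. \<psi> s t \<omega> z) \<in> borel_measurable \<Omega>"
  by (rule measurable_compose[OF \<psi>_measurable measurable_Fspace_eval])

text \<open>The body of \<open>SF2\<close> for a given \<open>J\<close>, named so that one witness
  can be fixed for all later statements.\<close>

definition is_comp :: "(real \<Rightarrow> ('a \<Rightarrow> 'a) \<Rightarrow> 'a \<Rightarrow> 'a) \<Rightarrow> bool"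
  where "is_comp J \<longleftrightarrow> (\<forall>t\<ge>0. (\<lambda>(g, x). J t g x) \<in> Fspace \<Otimes>\<^sub>M borel \<rightarrow>\<^sub>M borel) \<and>
      (\<forall>s t u x. s \<le> t \<and> t \<le> u \<longrightarrow>
        (AE \<omega> in \<Omega>. J (t - s) (\<psi> s t \<omega>) x = \<psi> s t \<omega> x) \<and>
        (AE \<omega> in \<Omega>. \<psi> s u \<omega> x = J (u - t) (\<psi> t u \<omega>) (\<psi> s t \<omega> x)) \<and>
        (\<forall>\<omega>\<in>space \<Omega>. \<psi> s s \<omega> x = x))"

definition J :: "real \<Rightarrow> ('a \<Rightarrow> 'a) \<Rightarrow> 'a \<Rightarrow> 'a"
  where "J = (SOME J. is_comp J)"

lemma is_comp_J: "is_comp J"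
proof -
  have "\<exists>J. is_comp J"
    using flow unfolding stochastic_flow_def SF2_def is_comp_def by blast
  then show ?thesis unfolding J_def by (rule someI_ex)
qed

lemma J_measurable: "t \<ge> 0 \<Longrightarrow> (\<lambda>(g, x). J t g x) \<in> Fspace \<Otimes>\<^sub>M borel \<rightarrow>\<^sub>M borel"
  using is_comp_J by (simp add: is_comp_def)

lemma J_AE: "s \<le> t \<Longrightarrow> AE \<omega> in \<Omega>. J (t - s) (\<psi> s t \<omega>) x = \<psi> s t \<omega> x"
  using is_comp_J unfolding is_comp_def by blast

lemma J_compose: "s \<le> t \<Longrightarrow> t \<le> u \<Longrightarrow> AE \<omega> in \<Omega>. \<psi> s u \<omega> x = J (u - t) (\<psi> t u \<omega>) (\<psi> s t \<omega> x)"
  using is_comp_J unfolding is_comp_def by blast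

lemma \<psi>_refl: "\<omega> \<in> space \<Omega> \<Longrightarrow> \<psi> s s \<omega> x = x"
  using is_comp_J unfolding is_comp_def by blast

lemma J_measurable_compose:
  assumes "t \<ge> 0" "G \<in> N \<rightarrow>\<^sub>M Fspace" "Z \<in> N \<rightarrow>\<^sub>M borel"
  shows "(\<lambda>\<omega>. J t (G \<omega>) (Z \<omega>)) \<in> N \<rightarrow>\<^sub>M borel"
  using measurable_compose[OF measurable_Pair[OF assms(2,3)] J_measurable[OF assms(1)]] by simp

section \<open>Independence over a finite time grid\<close>

definition chain_gen :: "(nat \<Rightarrow> real) \<Rightarrow> nat \<Rightarrow> 'w set set"
  where "chain_gen t i = {\<psi> (t i) (t (Suc i)) -` G \<inter> space \<Omega> | G. G \<in> sets Fspace}"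

definition chain :: "(nat \<Rightarrow> real) \<Rightarrow> nat \<Rightarrow> nat \<Rightarrow> 'w measure"
  where "chain t a b = sigma (space \<Omega>) (\<Union>i\<in>{a..<b}. chain_gen t i)"

lemma space_chain [simp]: "space (chain t a b) = space \<Omega>"
  by (simp add: chain_def space_measure_of_conv)

lemma sets_chain: "sets (chain t a b) = sigma_sets (space \<Omega>) (\<Union>i\<in>{a..<b}. chain_gen t i)"
  unfolding chain_def by (rule sets_measure_of) (auto simp: chain_gen_def)

lemma chain_mono: "a' \<le> a \<Longrightarrow> b \<le> b' \<Longrightarrow> sets (chain t a b) \<subseteq> sets (chain t a' b')"
  unfolding sets_chain by (intro sigma_sets_mono' UN_mono) auto

text \<open>Iterating \<open>J\<close> expresses a long increment, almost surely, through the
  consecutive ones. The increment itself need not be measurable for the \<sigma>-algebra of the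
  chain, hence the version \<open>Z\<close>.\<close>

lemma chain_value:
  assumes t: "\<forall>i<n. t i \<le> t (Suc i)" and ab: "a \<le> b" "b \<le> n"
  shows "t a \<le> t b \<and> (\<exists>Z. Z \<in> chain t a b \<rightarrow>\<^sub>M borel \<and> (AE \<omega> in \<Omega>. \<psi> (t a) (t b) \<omega> z = Z \<omega>))"
  using ab
proof (induction b rule: dec_induct)
  case base
  have "(\<lambda>_. z) \<in> chain t a a \<rightarrow>\<^sub>M borel" by simp
  moreover have "AE \<omega> in \<Omega>. \<psi> (t a) (t a) \<omega> z = z" by (rule AE_I2) (rule \<psi>_refl)
  ultimately show ?case by blast
next
  case (step b)
  then obtain Z where le: "t a \<le> t b" and Z: "Z \<in> chain t a b \<rightarrow>\<^sub>M borel" and eq: "AE \<omega> in \<Omega>. \<psi> (t a) (t b) \<omega> z = Z \<omega>"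
    by auto
  have tb: "t b \<le> t (Suc b)" using t step.prems by simp
  define Z' where "Z' \<omega> = J (t (Suc b) - t b) (\<psi> (t b) (t (Suc b)) \<omega>) (Z \<omega>)" for \<omega>
  have "Z' \<in> chain t a (Suc b) \<rightarrow>\<^sub>M borel"
    unfolding Z'_def
  proof (rule J_measurable_compose)
    show "\<psi> (t b) (t (Suc b)) \<in> chain t a (Suc b) \<rightarrow>\<^sub>M Fspace"
    proof (rule measurableI)
      show "\<psi> (t b) (t (Suc b)) \<omega> \<in> space Fspace" if "\<omega> \<in> space (chain t a (Suc b))" for \<omega>
        using measurable_space[OF \<psi>_measurable[OF tb]] that by simp
      fix G assume "G \<in> sets (Fspace :: ('a \<Rightarrow> 'a) measure)"
      then have "\<psi> (t b) (t (Suc b)) -` G \<inter> space \<Omega> \<in> chain_gen t b" by (auto simp: chain_gen_def)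
      then show "\<psi> (t b) (t (Suc b)) -` G \<inter> space (chain t a (Suc b)) \<in> sets (chain t a (Suc b))"
        unfolding sets_chain space_chain using step.hyps by (intro sigma_sets.Basic UN_I[of b]) auto
    qed
    show "Z \<in> chain t a (Suc b) \<rightarrow>\<^sub>M borel"
      using measurable_mono[OF _ _ chain_mono, of borel borel a a b "Suc b" t] Z by auto
  qed (use tb in simp)
  moreover have "AE \<omega> in \<Omega>. \<psi> (t a) (t (Suc b)) \<omega> z = Z' \<omega>"
    using J_compose[OF le tb, of z] eq by eventually_elim (simp add: Z'_def)
  ultimately show ?case using le tb by auto
qed

text \<open>The independent generators are grouped into the two blocks before and after grid index
  \<open>m\<close>; \<open>I\<close> indexes the blocks by a Boolean.\<close>

lemma chain_indep:
  assumes t: "\<forall>i<n. t i \<le> t (Suc i)" and m: "m \<le> n"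
    and A: "A \<in> sets (chain t 0 m)" and B: "B \<in> sets (chain t m n)"
  shows "prob (A \<inter> B) = prob A * prob B"
proof -
  have "indep_vars (\<lambda>_. Fspace) (\<lambda>i. \<psi> (t i) (t (Suc i))) {..<n}"
    using flow t unfolding stochastic_flow_def SF3_def by blast
  then have ind: "indep_sets (chain_gen t) {..<n}"
    unfolding indep_vars_def2 chain_gen_def by simp
  define I where "I j = (if j then {0..<m} else {m..<n})" for j
  have U: "(\<Union>j\<in>UNIV. I j) = {..<n}" using m by (auto simp: I_def UNIV_bool)
  have "indep_sets (\<lambda>j. sigma_sets (space \<Omega>) (\<Union>i\<in>I j. chain_gen t i)) UNIV"
  proof (rule indep_sets_collect_sigma)
    show "indep_sets (chain_gen t) (\<Union>j\<in>UNIV. I j)" unfolding U by (rule ind)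
    show "disjoint_family_on I UNIV" by (auto simp: disjoint_family_on_def I_def)
    fix i j assume "i \<in> I j"
    show "Int_stable (chain_gen t i)"
    proof (rule Int_stableI)
      fix a b assume "a \<in> chain_gen t i" "b \<in> chain_gen t i"
      then obtain G H where "a = \<psi> (t i) (t (Suc i)) -` G \<inter> space \<Omega>" "G \<in> sets Fspace"
        "b = \<psi> (t i) (t (Suc i)) -` H \<inter> space \<Omega>" "H \<in> sets Fspace"
        unfolding chain_gen_def by blast
      then show "a \<inter> b \<in> chain_gen t i"
        unfolding chain_gen_def by (intro CollectI exI[of _ "G \<inter> H"]) auto
    qed
  qed
  from indep_setsD[OF this, of UNIV "case_bool A B"] A B show ?thesis
    unfolding sets_chain by (simp add: UNIV_bool I_def ac_simps split: bool.split)
qed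

text \<open>Agreement with a flow event is required almost surely only. In this way every measurable
  modification of a one-point motion, in particular a continuous one, is measurable for the
  \<sigma>-algebra of the same time set.\<close>

definition flow_events :: "real set \<Rightarrow> 'w set set"
  where "flow_events I = {A \<in> events. \<exists>u v z C. u \<in> I \<and> v \<in> I \<and> u \<le> v \<and> C \<in> sets borel \<and>
    (AE \<omega> in \<Omega>. \<omega> \<in> A \<longleftrightarrow> \<psi> u v \<omega> z \<in> C)}"

definition flow_algebra :: "real set \<Rightarrow> 'w measure"
  where "flow_algebra I = sigma (space \<Omega>) (flow_events I)"

lemma space_flow_algebra [simp]: "space (flow_algebra I) = space \<Omega>"
  by (simp add: flow_algebra_def space_measure_of_conv)

lemma sets_flow_algebra: "sets (flow_algebra I) = sigma_sets (space \<Omega>) (flow_events I)"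
  unfolding flow_algebra_def
  by (rule sets_measure_of) (auto simp: flow_events_def dest: sets.sets_into_space)

lemma flow_algebra_events: "sets (flow_algebra I) \<subseteq> events"
  unfolding sets_flow_algebra by (rule sets.sigma_sets_subset) (auto simp: flow_events_def)

lemma measurable_from_flow_algebra:
  "f \<in> flow_algebra I \<rightarrow>\<^sub>M N \<Longrightarrow> f \<in> \<Omega> \<rightarrow>\<^sub>M N"
  using measurable_mono[of N N "flow_algebra I" \<Omega>] flow_algebra_events by auto

lemma measurable_flow_algebraI:
  assumes Y: "Y \<in> borel_measurable \<Omega>" and eq: "AE \<omega> in \<Omega>. Y \<omega> = \<psi> u v \<omega> z"
    and I: "u \<in> I" "v \<in> I" "u \<le> v"
  shows "Y \<in> flow_algebra I \<rightarrow>\<^sub>M borel"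
proof (rule measurableI)
  fix C :: "'a set" assume C: "C \<in> sets borel"
  have "AE \<omega> in \<Omega>. \<omega> \<in> Y -` C \<inter> space \<Omega> \<longleftrightarrow> \<psi> u v \<omega> z \<in> C"
    using eq AE_space by eventually_elim auto
  then have "Y -` C \<inter> space \<Omega> \<in> flow_events I"
    unfolding flow_events_def using measurable_sets[OF Y C] C I by blast
  then show "Y -` C \<inter> space (flow_algebra I) \<in> sets (flow_algebra I)"
    unfolding sets_flow_algebra by (simp add: sigma_sets.Basic)
qed simp

lemma \<psi>_flow_algebra:
  assumes "u \<in> I" "v \<in> I" "u \<le> v"
  shows "\<psi> u v \<in> flow_algebra I \<rightarrow>\<^sub>M Fspace"
proof (rule measurable_FspaceI)
  show "\<psi> u v \<omega> \<in> space Fspace" if "\<omega> \<in> space (flow_algebra I)" for \<omega>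
    using measurable_space[OF \<psi>_measurable[OF assms(3)]] that by simp
  show "(\<lambda>\<omega>. \<psi> u v \<omega> z) \<in> flow_algebra I \<rightarrow>\<^sub>M borel" for z
    by (rule measurable_flow_algebraI[where z=z, OF \<psi>_eval_measurable _ assms]) (simp_all add: assms)
qed

definition flow_cylinders :: "real set \<Rightarrow> 'w set set"
  where "flow_cylinders I = {space \<Omega> \<inter> \<Inter>F | F. finite F \<and> F \<subseteq> flow_events I}"

lemma Int_stable_flow_cylinders: "Int_stable (flow_cylinders I)"
proof (rule Int_stableI)
  fix a b assume "a \<in> flow_cylinders I" "b \<in> flow_cylinders I"
  then obtain F G where "a = space \<Omega> \<inter> \<Inter>F" "finite F" "F \<subseteq> flow_events I"
    "b = space \<Omega> \<inter> \<Inter>G" "finite G" "G \<subseteq> flow_events I"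
    unfolding flow_cylinders_def by blast
  then show "a \<inter> b \<in> flow_cylinders I"
    unfolding flow_cylinders_def by (intro CollectI exI[of _ "F \<union> G"]) auto
qed

lemma flow_events_cylinders: "flow_events I \<subseteq> flow_cylinders I"
proof
  fix A assume A: "A \<in> flow_events I"
  then have "A = space \<Omega> \<inter> \<Inter>{A}" using sets.sets_into_space by (auto simp: flow_events_def)
  with A show "A \<in> flow_cylinders I"
    unfolding flow_cylinders_def by (intro CollectI exI[of _ "{A}"]) auto
qed

lemma flow_cylinders_flow_algebra: "flow_cylinders I \<subseteq> sets (flow_algebra I)"
proof
  fix A assume "A \<in> flow_cylinders I"
  then obtain F where F: "A = space \<Omega> \<inter> \<Inter>F" "finite F" "F \<subseteq> flow_events I"
    unfolding flow_cylinders_def by blast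
  have "space \<Omega> \<inter> \<Inter>F \<in> sets (flow_algebra I)"
    using F(2,3)
  proof (induction F rule: finite_induct)
    case empty then show ?case using sets.top[of "flow_algebra I"] by simp
  next
    case (insert E F)
    have "E \<in> sets (flow_algebra I)" "space \<Omega> \<inter> \<Inter>F \<in> sets (flow_algebra I)"
      using insert by (simp_all add: sets_flow_algebra sigma_sets.Basic)
    then have "E \<inter> (space \<Omega> \<inter> \<Inter>F) \<in> sets (flow_algebra I)" by (rule sets.Int)
    also have "E \<inter> (space \<Omega> \<inter> \<Inter>F) = space \<Omega> \<inter> \<Inter>(insert E F)" by auto
    finally show ?case .
  qed
  then show "A \<in> sets (flow_algebra I)" by (simp add: F(1))
qed

text \<open>Each of the finitely many events concerns an increment between grid times, which
  \<open>chain_value\<close> replaces by a version in the chain; finitely many null sets do no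
  harm.\<close>

lemma flow_cylinder_chain:
  assumes t: "\<forall>i<n. t i \<le> t (Suc i)"
    and F: "finite F" "\<And>E. E \<in> F \<Longrightarrow> E \<in> events \<and> (\<exists>i j z C. a \<le> i \<and> i \<le> j \<and> j \<le> b \<and> C \<in> sets borel \<and>
      (AE \<omega> in \<Omega>. \<omega> \<in> E \<longleftrightarrow> \<psi> (t i) (t j) \<omega> z \<in> C))"
    and b: "b \<le> n"
  shows "\<exists>A'\<in>sets (chain t a b). AE \<omega> in \<Omega>. \<omega> \<in> space \<Omega> \<inter> \<Inter>F \<longleftrightarrow> \<omega> \<in> A'"
  using F
proof (induction F rule: finite_induct)
  case empty
  have "space \<Omega> \<in> sets (chain t a b)" using sets.top[of "chain t a b"] by simp
  then show ?case by (intro bexI[of _ "space \<Omega>"]) auto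
next
  case (insert E F)
  then obtain A' where A': "A' \<in> sets (chain t a b)" "AE \<omega> in \<Omega>. \<omega> \<in> space \<Omega> \<inter> \<Inter>F \<longleftrightarrow> \<omega> \<in> A'"
    by auto
  obtain i j z C where ij: "a \<le> i" "i \<le> j" "j \<le> b" "C \<in> sets borel"
    and AE: "AE \<omega> in \<Omega>. \<omega> \<in> E \<longleftrightarrow> \<psi> (t i) (t j) \<omega> z \<in> C"
    using insert.prems[of E] by auto
  obtain Z where Z: "Z \<in> chain t i j \<rightarrow>\<^sub>M borel" "AE \<omega> in \<Omega>. \<psi> (t i) (t j) \<omega> z = Z \<omega>"
    using chain_value[OF t ij(2), of z] ij(3) b by auto
  have "Z -` C \<inter> space \<Omega> \<in> sets (chain t a b)"
    using measurable_sets[OF Z(1) ij(4)] chain_mono[OF ij(1,3), of t] by auto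
  moreover have "AE \<omega> in \<Omega>. \<omega> \<in> space \<Omega> \<inter> \<Inter>(insert E F) \<longleftrightarrow> \<omega> \<in> A' \<inter> (Z -` C \<inter> space \<Omega>)"
    using A'(2) AE Z(2) AE_space by eventually_elim auto
  ultimately show ?case using A'(1) by (intro bexI[of _ "A' \<inter> (Z -` C \<inter> space \<Omega>)"]) auto
qed

text \<open>Only finitely many times occur. Sorted together with \<open>s\<close> they form one
  grid, and the index of \<open>s\<close> splits it into a past and a future block to which
  \<open>chain_indep\<close> applies.\<close>

lemma flow_cylinders_indep:
  assumes A: "A \<in> flow_cylinders {..s}" and B: "B \<in> flow_cylinders {s..}"
  shows "prob (A \<inter> B) = prob A * prob B"
proof -
  obtain F where F: "A = space \<Omega> \<inter> \<Inter>F" "finite F" "F \<subseteq> flow_events {..s}"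
    using A unfolding flow_cylinders_def by blast
  obtain G where G: "B = space \<Omega> \<inter> \<Inter>G" "finite G" "G \<subseteq> flow_events {s..}"
    using B unfolding flow_cylinders_def by blast
  have times: "\<forall>E\<in>H. \<exists>p. fst p \<in> I \<and> snd p \<in> I \<and> fst p \<le> snd p \<and>
      (\<exists>z C. C \<in> sets borel \<and> (AE \<omega> in \<Omega>. \<omega> \<in> E \<longleftrightarrow> \<psi> (fst p) (snd p) \<omega> z \<in> C))"
    if H: "H \<subseteq> flow_events I" for H I
  proof
    fix E assume "E \<in> H"
    then have "E \<in> flow_events I" using H by (rule subsetD[rotated])
    then obtain u v z C where "u \<in> I" "v \<in> I" "u \<le> v" "C \<in> sets borel" "AE \<omega> in \<Omega>. \<omega> \<in> E \<longleftrightarrow> \<psi> u v \<omega> z \<in> C"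
      unfolding flow_events_def by (elim CollectE conjE exE)
    then show "\<exists>p. fst p \<in> I \<and> snd p \<in> I \<and> fst p \<le> snd p \<and>
        (\<exists>z C. C \<in> sets borel \<and> (AE \<omega> in \<Omega>. \<omega> \<in> E \<longleftrightarrow> \<psi> (fst p) (snd p) \<omega> z \<in> C))"
      by (intro exI[of _ "(u, v)"]) auto
  qed
  from bchoice[OF times[OF F(3)]] obtain p where p: "\<forall>E\<in>F. fst (p E) \<in> {..s} \<and> snd (p E) \<in> {..s} \<and> fst (p E) \<le> snd (p E) \<and>
      (\<exists>z C. C \<in> sets borel \<and> (AE \<omega> in \<Omega>. \<omega> \<in> E \<longleftrightarrow> \<psi> (fst (p E)) (snd (p E)) \<omega> z \<in> C))" ..
  from bchoice[OF times[OF G(3)]] obtain q where q: "\<forall>E\<in>G. fst (q E) \<in> {s..} \<and> snd (q E) \<in> {s..} \<and> fst (q E) \<le> snd (q E) \<and>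
      (\<exists>z C. C \<in> sets borel \<and> (AE \<omega> in \<Omega>. \<omega> \<in> E \<longleftrightarrow> \<psi> (fst (q E)) (snd (q E)) \<omega> z \<in> C))" ..
  define u v u' v' where "u E = fst (p E)" and "v E = snd (p E)" and "u' E = fst (q E)" and "v' E = snd (q E)" for E
  have uv: "u E \<le> v E \<and> v E \<le> s \<and>
      (\<exists>z C. C \<in> sets borel \<and> (AE \<omega> in \<Omega>. \<omega> \<in> E \<longleftrightarrow> \<psi> (u E) (v E) \<omega> z \<in> C))" if "E \<in> F" for E
    using bspec[OF p that] by (simp add: u_def v_def)
  have uv': "s \<le> u' E \<and> u' E \<le> v' E \<and>
      (\<exists>z C. C \<in> sets borel \<and> (AE \<omega> in \<Omega>. \<omega> \<in> E \<longleftrightarrow> \<psi> (u' E) (v' E) \<omega> z \<in> C))" if "E \<in> G" for E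
    using bspec[OF q that] by (simp add: u'_def v'_def)
  \<comment> \<open>Including \<open>s\<close> guarantees that it is a grid point, even if no event
    mentions it.\<close>
  define T where "T = insert s (u ` F \<union> v ` F \<union> u' ` G \<union> v' ` G)"
  define L where "L = sorted_list_of_set T"
  have T: "finite T" "T \<noteq> {}" using F(2) G(2) by (auto simp: T_def)
  have L: "set L = T" "sorted L" "distinct L" "length L = card T"
    using T by (simp_all add: L_def)
  define n where "n = card T - 1"
  have len: "length L = Suc n" using T L(4) by (simp add: n_def card_gt_0_iff Suc_diff_1)
  define t where "t i = L ! i" for i
  have t: "\<forall>i<n. t i \<le> t (Suc i)"
    using L(2) len by (auto simp: t_def sorted_iff_nth_mono)
  have idx: "\<exists>i\<le>n. t i = x" if "x \<in> T" for x
    using that L(1) len by (metis in_set_conv_nth less_Suc_eq_le t_def)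
  \<comment> \<open>The list is sorted without repetitions, so an inequality between times carries
    over to the indices.\<close>
  have le: "i \<le> j" if "t i \<le> t j" "i \<le> n" "j \<le> n" for i j
  proof (rule ccontr)
    assume "\<not> i \<le> j"
    then have "t j < t i"
      using L(2,3) len that unfolding t_def by (metis not_le less_Suc_eq_le order_le_less sorted_nth_mono nth_eq_iff_index_eq less_imp_le)
    with that show False by simp
  qed
  obtain m where m: "m \<le> n" "t m = s" using idx[of s] by (auto simp: T_def)
  have "\<exists>A'\<in>sets (chain t 0 m). AE \<omega> in \<Omega>. \<omega> \<in> space \<Omega> \<inter> \<Inter>F \<longleftrightarrow> \<omega> \<in> A'"
  proof (rule flow_cylinder_chain[OF t F(2) _ m(1)])
    fix E assume E: "E \<in> F"
    obtain i j where ij: "i \<le> n" "t i = u E" "j \<le> n" "t j = v E"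
      using idx[of "u E"] idx[of "v E"] E by (auto simp: T_def)
    have "i \<le> j" "j \<le> m" using le[of i j] le[of j m] ij m uv[OF E] by auto
    moreover obtain z C where "C \<in> sets borel" "AE \<omega> in \<Omega>. \<omega> \<in> E \<longleftrightarrow> \<psi> (t i) (t j) \<omega> z \<in> C"
      using uv[OF E] unfolding ij(2,4) by blast
    moreover have "E \<in> events" using subsetD[OF F(3) E] by (simp add: flow_events_def)
    ultimately show "E \<in> events \<and> (\<exists>i j z C. 0 \<le> i \<and> i \<le> j \<and> j \<le> m \<and> C \<in> sets borel \<and>
      (AE \<omega> in \<Omega>. \<omega> \<in> E \<longleftrightarrow> \<psi> (t i) (t j) \<omega> z \<in> C))" by blast
  qed
  then obtain A' where A': "A' \<in> sets (chain t 0 m)" "AE \<omega> in \<Omega>. \<omega> \<in> A \<longleftrightarrow> \<omega> \<in> A'"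
    unfolding F(1) by blast
  have "\<exists>B'\<in>sets (chain t m n). AE \<omega> in \<Omega>. \<omega> \<in> space \<Omega> \<inter> \<Inter>G \<longleftrightarrow> \<omega> \<in> B'"
  proof (rule flow_cylinder_chain[OF t G(2) _ order_refl])
    fix E assume E: "E \<in> G"
    obtain i j where ij: "i \<le> n" "t i = u' E" "j \<le> n" "t j = v' E"
      using idx[of "u' E"] idx[of "v' E"] E by (auto simp: T_def)
    have "m \<le> i" "i \<le> j" using le[of i j] le[of m i] ij m uv'[OF E] by auto
    moreover obtain z C where "C \<in> sets borel" "AE \<omega> in \<Omega>. \<omega> \<in> E \<longleftrightarrow> \<psi> (t i) (t j) \<omega> z \<in> C"
      using uv'[OF E] unfolding ij(2,4) by blast
    moreover have "E \<in> events" using subsetD[OF G(3) E] by (simp add: flow_events_def)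
    ultimately show "E \<in> events \<and> (\<exists>i j z C. m \<le> i \<and> i \<le> j \<and> j \<le> n \<and> C \<in> sets borel \<and>
      (AE \<omega> in \<Omega>. \<omega> \<in> E \<longleftrightarrow> \<psi> (t i) (t j) \<omega> z \<in> C))" using ij(3) by blast
  qed
  then obtain B' where B': "B' \<in> sets (chain t m n)" "AE \<omega> in \<Omega>. \<omega> \<in> B \<longleftrightarrow> \<omega> \<in> B'"
    unfolding G(1) by blast
  have chain_events: "sets (chain t a b) \<subseteq> events" if "b \<le> n" for a b
    unfolding sets_chain
  proof (rule sets.sigma_sets_subset, rule UN_least)
    fix i assume "i \<in> {a..<b}"
    then have "t i \<le> t (Suc i)" using t that by simp
    then show "chain_gen t i \<subseteq> events"
      using measurable_sets[OF \<psi>_measurable] by (auto simp: chain_gen_def)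
  qed
  have ev: "A' \<in> events" "B' \<in> events" using A'(1) B'(1) chain_events m by auto
  have "A \<in> events" "B \<in> events"
    using A B flow_cylinders_flow_algebra flow_algebra_events by blast+
  note ev' = this
  have "prob (A \<inter> B) = prob (A' \<inter> B')"
  proof (rule finite_measure_eq_AE)
    show "AE \<omega> in \<Omega>. \<omega> \<in> A \<inter> B \<longleftrightarrow> \<omega> \<in> A' \<inter> B'" using A'(2) B'(2) by eventually_elim auto
  qed (use ev ev' in auto)
  moreover have "prob A = prob A'" by (rule finite_measure_eq_AE[OF A'(2) ev'(1) ev(1)])
  moreover have "prob B = prob B'" by (rule finite_measure_eq_AE[OF B'(2) ev'(2) ev(2)])
  moreover have "prob (A' \<inter> B') = prob A' * prob B'" by (rule chain_indep[OF t m(1) A'(1) B'(1)])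
  ultimately show ?thesis by simp
qed

lemma flow_algebra_indep: "indep_set (sets (flow_algebra {..s})) (sets (flow_algebra {s..}))"
proof -
  have cyl: "flow_cylinders I \<subseteq> events" for I
    using flow_cylinders_flow_algebra flow_algebra_events by (rule order_trans)
  have sig: "sets (flow_algebra I) \<subseteq> sigma_sets (space \<Omega>) (flow_cylinders I)" for I
    unfolding sets_flow_algebra by (rule sigma_sets_mono') (rule flow_events_cylinders)
  have "indep_set (flow_cylinders {..s}) (flow_cylinders {s..})"
    unfolding indep_sets2_eq using cyl flow_cylinders_indep by blast
  then have "indep_set (sigma_sets (space \<Omega>) (flow_cylinders {..s})) (sigma_sets (space \<Omega>) (flow_cylinders {s..}))"
    by (rule indep_set_sigma_sets[OF _ Int_stable_flow_cylinders Int_stable_flow_cylinders])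
  then show ?thesis
    unfolding indep_sets2_eq using sig flow_algebra_events by blast
qed

lemma flow_algebra_prob_Int:
  "A \<in> sets (flow_algebra {..s}) \<Longrightarrow> B \<in> sets (flow_algebra {s..}) \<Longrightarrow> prob (A \<inter> B) = prob A * prob B"
  using flow_algebra_indep indep_setD by blast

text \<open>Past and increment are independent, so the joint law of the sample point, seen through
  the past, and of \<open>\<psi> s t\<close> is a product measure. Inside the integral the increment
  may then be taken from an independent sample \<omega>'.\<close>

lemma flow_fubini:
  fixes h :: "'w \<times> ('a \<Rightarrow> 'a) \<Rightarrow> ennreal"
  assumes st: "s \<le> t" and h: "h \<in> borel_measurable (flow_algebra {..s} \<Otimes>\<^sub>M Fspace)"
  shows "(\<integral>\<^sup>+\<omega>. h (\<omega>, \<psi> s t \<omega>) \<partial>\<Omega>) = (\<integral>\<^sup>+\<omega>. (\<integral>\<^sup>+\<omega>'. h (\<omega>, \<psi> s t \<omega>') \<partial>\<Omega>) \<partial>\<Omega>)"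
proof -
  have id: "(\<lambda>\<omega>. \<omega>) \<in> \<Omega> \<rightarrow>\<^sub>M flow_algebra {..s}"
    by (rule measurable_from_flow_algebra[of _ "{..s}"]) simp
  have G: "\<psi> s t \<in> flow_algebra {s..} \<rightarrow>\<^sub>M Fspace" by (rule \<psi>_flow_algebra) (use st in auto)
  interpret D1: prob_space "distr \<Omega> (flow_algebra {..s}) (\<lambda>\<omega>. \<omega>)" by (rule prob_space_distr[OF id])
  interpret D2: prob_space "distr \<Omega> Fspace (\<psi> s t)" by (rule prob_space_distr[OF \<psi>_measurable[OF st]])
  have pm: "(\<lambda>\<omega>. (\<omega>, \<psi> s t \<omega>)) \<in> \<Omega> \<rightarrow>\<^sub>M flow_algebra {..s} \<Otimes>\<^sub>M Fspace"
    by (intro measurable_Pair id \<psi>_measurable st)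
  have eq: "distr \<Omega> (flow_algebra {..s}) (\<lambda>\<omega>. \<omega>) \<Otimes>\<^sub>M distr \<Omega> Fspace (\<psi> s t)
      = distr \<Omega> (flow_algebra {..s} \<Otimes>\<^sub>M Fspace) (\<lambda>\<omega>. (\<omega>, \<psi> s t \<omega>))"
  proof (rule pair_measure_eqI)
    show "sigma_finite_measure (distr \<Omega> (flow_algebra {..s}) (\<lambda>\<omega>. \<omega>))" "sigma_finite_measure (distr \<Omega> Fspace (\<psi> s t))" ..
    show "sets (distr \<Omega> (flow_algebra {..s}) (\<lambda>\<omega>. \<omega>) \<Otimes>\<^sub>M distr \<Omega> Fspace (\<psi> s t))
      = sets (distr \<Omega> (flow_algebra {..s} \<Otimes>\<^sub>M Fspace) (\<lambda>\<omega>. (\<omega>, \<psi> s t \<omega>)))"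
      by simp
    fix A B assume "A \<in> sets (distr \<Omega> (flow_algebra {..s}) (\<lambda>\<omega>. \<omega>))" "B \<in> sets (distr \<Omega> Fspace (\<psi> s t))"
    then have A: "A \<in> sets (flow_algebra {..s})" and B: "B \<in> sets Fspace" by auto
    have Asp: "A \<subseteq> space \<Omega>" using sets.sets_into_space[OF A] by simp
    have "prob (A \<inter> (\<psi> s t -` B \<inter> space \<Omega>)) = prob A * prob (\<psi> s t -` B \<inter> space \<Omega>)"
      using measurable_sets[OF G B] by (intro flow_algebra_prob_Int[OF A]) simp
    moreover have "(\<lambda>\<omega>. (\<omega>, \<psi> s t \<omega>)) -` (A \<times> B) \<inter> space \<Omega> = A \<inter> (\<psi> s t -` B \<inter> space \<Omega>)"
      using Asp by auto
    moreover have "(\<lambda>\<omega>. \<omega>) -` A \<inter> space \<Omega> = A" using Asp by auto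
    ultimately show "emeasure (distr \<Omega> (flow_algebra {..s}) (\<lambda>\<omega>. \<omega>)) A * emeasure (distr \<Omega> Fspace (\<psi> s t)) B
      = emeasure (distr \<Omega> (flow_algebra {..s} \<Otimes>\<^sub>M Fspace) (\<lambda>\<omega>. (\<omega>, \<psi> s t \<omega>))) (A \<times> B)"
      using A B by (simp add: emeasure_distr[OF id] emeasure_distr[OF \<psi>_measurable[OF st]] emeasure_distr[OF pm]
          pair_measureI emeasure_eq_measure ennreal_mult)
  qed
  interpret D: pair_sigma_finite "distr \<Omega> (flow_algebra {..s}) (\<lambda>\<omega>. \<omega>)" "distr \<Omega> Fspace (\<psi> s t)" ..
  have hD: "h \<in> borel_measurable (distr \<Omega> (flow_algebra {..s}) (\<lambda>\<omega>. \<omega>) \<Otimes>\<^sub>M distr \<Omega> Fspace (\<psi> s t))"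
    unfolding eq using h by simp
  have inner: "(\<integral>\<^sup>+g. h (\<omega>, g) \<partial>distr \<Omega> Fspace (\<psi> s t)) = (\<integral>\<^sup>+\<omega>'. h (\<omega>, \<psi> s t \<omega>') \<partial>\<Omega>)" if "\<omega> \<in> space \<Omega>" for \<omega>
  proof (rule nn_integral_distr[OF \<psi>_measurable[OF st]])
    show "(\<lambda>g. h (\<omega>, g)) \<in> borel_measurable (distr \<Omega> Fspace (\<psi> s t))"
      using measurable_compose[OF measurable_Pair1' h, of \<omega>] that by simp
  qed
  have "(\<integral>\<^sup>+\<omega>. h (\<omega>, \<psi> s t \<omega>) \<partial>\<Omega>) = (\<integral>\<^sup>+p. h p \<partial>distr \<Omega> (flow_algebra {..s} \<Otimes>\<^sub>M Fspace) (\<lambda>\<omega>. (\<omega>, \<psi> s t \<omega>)))"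
    by (rule nn_integral_distr[OF pm, symmetric]) (simp add: h)
  also have "\<dots> = (\<integral>\<^sup>+\<omega>. (\<integral>\<^sup>+g. h (\<omega>, g) \<partial>distr \<Omega> Fspace (\<psi> s t)) \<partial>distr \<Omega> (flow_algebra {..s}) (\<lambda>\<omega>. \<omega>))"
    unfolding eq[symmetric] by (rule D2.nn_integral_fst[OF hD, symmetric])
  also have "\<dots> = (\<integral>\<^sup>+\<omega>. (\<integral>\<^sup>+g. h (\<omega>, g) \<partial>distr \<Omega> Fspace (\<psi> s t)) \<partial>\<Omega>)"
  proof (rule nn_integral_distr[OF id])
    show "(\<lambda>\<omega>. \<integral>\<^sup>+g. h (\<omega>, g) \<partial>distr \<Omega> Fspace (\<psi> s t)) \<in> borel_measurable (distr \<Omega> (flow_algebra {..s}) (\<lambda>\<omega>. \<omega>))"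
      using D2.borel_measurable_nn_integral_fst[OF hD] by simp
  qed
  also have "\<dots> = (\<integral>\<^sup>+\<omega>. (\<integral>\<^sup>+\<omega>'. h (\<omega>, \<psi> s t \<omega>') \<partial>\<Omega>) \<partial>\<Omega>)"
    by (rule nn_integral_cong) (rule inner)
  finally show ?thesis .
qed

subsection \<open>The two-point motion\<close>

text \<open>\<open>SF1\<close> prescribes integrals of \<open>C0\<close> functions only; by
  \<open>Mpow_measure_eqI\<close> these determine the law.\<close>

lemma two_point_law:
  assumes "s \<le> t"
  shows "distr \<Omega> (Mpow 2) (\<lambda>\<omega>. pair (\<psi> s t \<omega> x) (\<psi> s t \<omega> y)) = P 2 (t - s) (pair x y)"
proof (rule Mpow_measure_eqI)
  have m: "(\<lambda>\<omega>. pair (\<psi> s t \<omega> x) (\<psi> s t \<omega> y)) \<in> \<Omega> \<rightarrow>\<^sub>M Mpow 2"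
    by (intro pair_measurable \<psi>_eval_measurable assms)
  show "prob_space (distr \<Omega> (Mpow 2) (\<lambda>\<omega>. pair (\<psi> s t \<omega> x) (\<psi> s t \<omega> y)))"
    by (rule prob_space_distr[OF m])
  have st: "t - s \<ge> 0" using assms by simp
  note k = kernel_prob_space[where P=P, OF feller2 st space_Mpow2_pair]
  show "prob_space (P 2 (t - s) (pair x y))" by (rule k(1))
  show sets: "sets (P 2 (t - s) (pair x y)) = sets (Mpow 2)" by (rule k(2))
  fix f :: "(nat \<Rightarrow> 'a) \<Rightarrow> real" assume f: "f \<in> C0 (Mpow_top 2)"
  have eq: "(\<lambda>i\<in>{..<2}. \<psi> s t \<omega> (pair x y i)) = pair (\<psi> s t \<omega> x) (\<psi> s t \<omega> y)" for \<omega>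
    by (auto simp: pair_def)
  have *: "(\<integral>\<omega>. f (pair (\<psi> s t \<omega> x) (\<psi> s t \<omega> y)) \<partial>\<Omega>) = (\<integral>z. f z \<partial>P 2 (t - s) (pair x y))"
  proof -
    have "SF1 P \<Omega> \<psi>" using flow by (simp add: stochastic_flow_def)
    from this[unfolded SF1_def, rule_format, of 2 s t f "pair x y"] show ?thesis
      using assms f space_Mpow2_pair[of x y] by (simp add: eq)
  qed
  have "f \<in> borel_measurable (Mpow 2)" by (rule C0_measurable[OF f])
  then show "(\<integral>z. f z \<partial>distr \<Omega> (Mpow 2) (\<lambda>\<omega>. pair (\<psi> s t \<omega> x) (\<psi> s t \<omega> y))) = (\<integral>z. f z \<partial>P 2 (t - s) (pair x y))"
    using * by (simp add: integral_distr[OF m])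
qed simp

text \<open>With the past sample \<omega> frozen by \<open>flow_fubini\<close>, the starting points
  \<open>X \<omega>\<close> and \<open>Y \<omega>\<close> are constants. For constants
  \<open>J\<close> agrees almost surely with the flow, whose two-point law is the kernel.\<close>

lemma two_point_markov:
  assumes st: "s \<le> t" and A: "A \<in> sets (flow_algebra {..s})" and B: "B \<in> sets (Mpow 2)"
    and X: "X \<in> flow_algebra {..s} \<rightarrow>\<^sub>M borel" and Y: "Y \<in> flow_algebra {..s} \<rightarrow>\<^sub>M borel"
  shows "emeasure \<Omega> {\<omega>\<in>A. pair (J (t - s) (\<psi> s t \<omega>) (X \<omega>)) (J (t - s) (\<psi> s t \<omega>) (Y \<omega>)) \<in> B} =
    (\<integral>\<^sup>+\<omega>\<in>A. emeasure (P 2 (t - s) (pair (X \<omega>) (Y \<omega>))) B \<partial>\<Omega>)"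
proof -
  define h :: "'w \<times> ('a \<Rightarrow> 'a) \<Rightarrow> ennreal" where
    "h p = indicator A (fst p) * indicator B (pair (J (t - s) (snd p) (X (fst p))) (J (t - s) (snd p) (Y (fst p))))" for p
  have "(\<lambda>p. pair (J (t - s) (snd p) (X (fst p))) (J (t - s) (snd p) (Y (fst p)))) \<in> flow_algebra {..s} \<Otimes>\<^sub>M Fspace \<rightarrow>\<^sub>M Mpow 2"
    using st by (intro pair_measurable J_measurable_compose measurable_snd measurable_compose[OF measurable_fst X]
        measurable_compose[OF measurable_fst Y]) auto
  then have h: "h \<in> borel_measurable (flow_algebra {..s} \<Otimes>\<^sub>M Fspace)"
    unfolding h_def using A B
    by (intro borel_measurable_times_ennreal measurable_compose[OF measurable_fst borel_measurable_indicator]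
        measurable_compose[OF _ borel_measurable_indicator]) auto
  have Aev: "A \<in> events" using A flow_algebra_events by blast
  have inner: "(\<integral>\<^sup>+\<omega>'. h (\<omega>, \<psi> s t \<omega>') \<partial>\<Omega>) = emeasure (P 2 (t - s) (pair (X \<omega>) (Y \<omega>))) B * indicator A \<omega>" for \<omega>
  proof -
    have m: "(\<lambda>\<omega>'. pair (\<psi> s t \<omega>' (X \<omega>)) (\<psi> s t \<omega>' (Y \<omega>))) \<in> \<Omega> \<rightarrow>\<^sub>M Mpow 2"
      by (intro pair_measurable \<psi>_eval_measurable st)
    have "(\<integral>\<^sup>+\<omega>'. h (\<omega>, \<psi> s t \<omega>') \<partial>\<Omega>) = (\<integral>\<^sup>+\<omega>'. indicator A \<omega> * indicator B (pair (\<psi> s t \<omega>' (X \<omega>)) (\<psi> s t \<omega>' (Y \<omega>))) \<partial>\<Omega>)"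
    proof (rule nn_integral_cong_AE)
      show "AE \<omega>' in \<Omega>. h (\<omega>, \<psi> s t \<omega>') = indicator A \<omega> * indicator B (pair (\<psi> s t \<omega>' (X \<omega>)) (\<psi> s t \<omega>' (Y \<omega>)))"
        using J_AE[OF st, of "X \<omega>"] J_AE[OF st, of "Y \<omega>"] by eventually_elim (simp add: h_def)
    qed
    also have "\<dots> = indicator A \<omega> * (\<integral>\<^sup>+\<omega>'. indicator B (pair (\<psi> s t \<omega>' (X \<omega>)) (\<psi> s t \<omega>' (Y \<omega>))) \<partial>\<Omega>)"
      by (rule nn_integral_cmult) (rule measurable_compose[OF m borel_measurable_indicator[OF B]])
    also have "(\<integral>\<^sup>+\<omega>'. indicator B (pair (\<psi> s t \<omega>' (X \<omega>)) (\<psi> s t \<omega>' (Y \<omega>))) \<partial>\<Omega>)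
        = (\<integral>\<^sup>+z. indicator B z \<partial>distr \<Omega> (Mpow 2) (\<lambda>\<omega>'. pair (\<psi> s t \<omega>' (X \<omega>)) (\<psi> s t \<omega>' (Y \<omega>))))"
      by (rule nn_integral_distr[symmetric, OF m]) (simp add: borel_measurable_indicator[OF B])
    also have "\<dots> = emeasure (P 2 (t - s) (pair (X \<omega>) (Y \<omega>))) B"
      unfolding two_point_law[OF st]
      by (rule nn_integral_indicator) (use st B in \<open>simp add: kernel_prob_space(2)[where P=P, OF feller2 _ space_Mpow2_pair]\<close>)
    finally show ?thesis by (simp add: mult.commute)
  qed
  have "{\<omega>\<in>A. pair (J (t - s) (\<psi> s t \<omega>) (X \<omega>)) (J (t - s) (\<psi> s t \<omega>) (Y \<omega>)) \<in> B} \<in> events"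
  proof -
    have "(\<lambda>\<omega>. pair (J (t - s) (\<psi> s t \<omega>) (X \<omega>)) (J (t - s) (\<psi> s t \<omega>) (Y \<omega>))) \<in> \<Omega> \<rightarrow>\<^sub>M Mpow 2"
      using st by (intro pair_measurable J_measurable_compose \<psi>_measurable
          measurable_from_flow_algebra[OF X] measurable_from_flow_algebra[OF Y]) auto
    from measurable_sets[OF this B] Aev have
      "A \<inter> ((\<lambda>\<omega>. pair (J (t - s) (\<psi> s t \<omega>) (X \<omega>)) (J (t - s) (\<psi> s t \<omega>) (Y \<omega>))) -` B \<inter> space \<Omega>) \<in> events" by auto
    then show ?thesis
      by (rule back_subst[where P="\<lambda>S. S \<in> events"]) (use sets.sets_into_space[OF Aev] in auto)
  qed
  then have "emeasure \<Omega> {\<omega>\<in>A. pair (J (t - s) (\<psi> s t \<omega>) (X \<omega>)) (J (t - s) (\<psi> s t \<omega>) (Y \<omega>)) \<in> B}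
    = (\<integral>\<^sup>+\<omega>. indicator {\<omega>\<in>A. pair (J (t - s) (\<psi> s t \<omega>) (X \<omega>)) (J (t - s) (\<psi> s t \<omega>) (Y \<omega>)) \<in> B} \<omega> \<partial>\<Omega>)"
    by simp
  also have "\<dots> = (\<integral>\<^sup>+\<omega>. h (\<omega>, \<psi> s t \<omega>) \<partial>\<Omega>)"
    by (rule nn_integral_cong) (simp add: h_def split: split_indicator)
  also have "\<dots> = (\<integral>\<^sup>+\<omega>\<in>A. emeasure (P 2 (t - s) (pair (X \<omega>) (Y \<omega>))) B \<partial>\<Omega>)"
    unfolding flow_fubini[OF st h] inner ..
  finally show ?thesis .
qed

end

section \<open>Continuous modifications of the flow\<close>

text \<open>The sum of all thresholds up to \<open>j\<close> dominates the \<open>j\<close>-th one,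
  and adding \<open>j\<close> makes the sequence strictly increasing.\<close>

lemma strict_mono_diagonal:
  assumes "\<And>j :: nat. \<forall>\<^sub>F n in sequentially. P j n"
  shows "\<exists>r :: nat \<Rightarrow> nat. strict_mono r \<and> (\<forall>j. P j (r j))"
proof -
  have "\<forall>j. \<exists>N. \<forall>n\<ge>N. P j n" using assms by (simp add: eventually_sequentially)
  then obtain N where N: "\<And>j n. n \<ge> N j \<Longrightarrow> P j n" by metis
  define r where "r j = (\<Sum>i\<le>j. N i) + j" for j
  have "strict_mono r" unfolding strict_mono_Suc_iff r_def by simp
  moreover have "N j \<le> r j" for j
    using member_le_sum[of j "{..j}" N] by (simp add: r_def trans_le_add1)
  ultimately show ?thesis using N by blast
qed

text \<open>All countably many sequences are controlled at once by the partial sums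
  \<open>c j\<close>, which dominate the \<open>i\<close>-th sequence as soon as
  \<open>i \<le> j\<close> and tend to 0 in L1; a subsequence of them converges to 0 almost
  surely.\<close>

lemma (in prob_space) L1_diagonal_subsequence:
  fixes a :: "nat \<Rightarrow> nat \<Rightarrow> 'a \<Rightarrow> real"
  assumes int: "\<And>i k. integrable M (a i k)" and nonneg: "\<And>i k \<omega>. 0 \<le> a i k \<omega>"
    and lim: "\<And>i. (\<lambda>k. \<integral>\<omega>. a i k \<omega> \<partial>M) \<longlonglongrightarrow> 0"
  shows "\<exists>r :: nat \<Rightarrow> nat. strict_mono r \<and> (AE \<omega> in M. \<forall>i. (\<lambda>k. a i (r k) \<omega>) \<longlonglongrightarrow> 0)"
proof -
  \<comment> \<open>The square compensates for the \<open>Suc j\<close> summands of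
    \<open>c j\<close>, so that the mean of \<open>c j\<close> is at most 1 / (j + 1).\<close>
  have "\<forall>\<^sub>F k in sequentially. \<forall>i\<in>{..j}. (\<integral>\<omega>. a i k \<omega> \<partial>M) < 1 / (real (Suc j) * real (Suc j))" for j
    by (rule eventually_ball_finite) (auto intro!: order_tendstoD(2)[OF lim])
  then obtain r :: "nat \<Rightarrow> nat" where r: "strict_mono r" "\<And>j. \<forall>i\<in>{..j}. (\<integral>\<omega>. a i (r j) \<omega> \<partial>M) < 1 / (real (Suc j) * real (Suc j))"
    using strict_mono_diagonal[of "\<lambda>j k. \<forall>i\<in>{..j}. (\<integral>\<omega>. a i k \<omega> \<partial>M) < 1 / (real (Suc j) * real (Suc j))"] by blast
  define c where "c j \<omega> = (\<Sum>i\<le>j. a i (r j) \<omega>)" for j \<omega>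
  have c_int: "integrable M (c j)" for j unfolding c_def using int by simp
  have c_nonneg: "0 \<le> c j \<omega>" for j \<omega> unfolding c_def by (intro sum_nonneg nonneg)
  have "(\<lambda>j. \<integral>\<omega>. norm (c j \<omega>) \<partial>M) \<longlonglongrightarrow> 0"
  proof (rule Lim_null_comparison[OF always_eventually LIMSEQ_inverse_real_of_nat], rule allI)
    fix j
    have "(\<integral>\<omega>. norm (c j \<omega>) \<partial>M) = (\<Sum>i\<le>j. \<integral>\<omega>. a i (r j) \<omega> \<partial>M)"
      using c_nonneg by (simp add: c_def int Bochner_Integration.integral_sum)
    also have "\<dots> \<le> (\<Sum>i\<le>j. 1 / (real (Suc j) * real (Suc j)))"
      using r(2)[of j] by (intro sum_mono) (auto intro: less_imp_le)
    also have "\<dots> = inverse (real (Suc j))" by (simp add: field_simps del: of_nat_Suc)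
    finally show "norm (\<integral>\<omega>. norm (c j \<omega>) \<partial>M) \<le> inverse (real (Suc j))" by simp
  qed
  then obtain q :: "nat \<Rightarrow> nat" where q: "strict_mono q" "AE \<omega> in M. (\<lambda>j. c (q j) \<omega>) \<longlonglongrightarrow> 0"
    using tendsto_L1_AE_subseq[where u=c, OF c_int] by blast
  have "AE \<omega> in M. \<forall>i. (\<lambda>k. a i ((r \<circ> q) k) \<omega>) \<longlonglongrightarrow> 0"
    using q(2)
  proof eventually_elim
    case (elim \<omega>)
    show ?case
    proof
      fix i
      show "(\<lambda>k. a i ((r \<circ> q) k) \<omega>) \<longlonglongrightarrow> 0"
      proof (rule Lim_null_comparison[OF _ elim])
        show "\<forall>\<^sub>F k in sequentially. norm (a i ((r \<circ> q) k) \<omega>) \<le> c (q k) \<omega>"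
          unfolding eventually_sequentially
        proof (intro exI[of _ i] allI impI)
          fix k assume "i \<le> k"
          then have "i \<le> q k" using strict_mono_imp_increasing[OF q(1), of k] by simp
          then show "norm (a i ((r \<circ> q) k) \<omega>) \<le> c (q k) \<omega>"
            unfolding c_def using nonneg member_le_sum[of i "{..q k}" "\<lambda>i. a i (r (q k)) \<omega>"] by simp
        qed
      qed
    qed
  qed
  then show ?thesis using strict_mono_o[OF r(1) q(1)] by blast
qed

context path_metric
begin

text \<open>Tent functions around the points of a countable dense set with rational radii: a
  countable family of test functions for \<open>SF4\<close> and \<open>SF5\<close>. They belong to
  \<open>C0\<close> because closed balls are compact.\<close>

definition bump :: "nat \<Rightarrow> 'a \<Rightarrow> real"
  where "bump i x = (case from_nat_into (dense_set \<times> (\<rat> \<inter> {0<..})) i of (d, q) \<Rightarrow> max 0 (1 - dist x d / q))"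

lemma bump_cases:
  obtains d q where "q > 0" "bump i = (\<lambda>x. max 0 (1 - dist x d / q))"
proof -
  have ne: "(dense_set \<times> (\<rat> \<inter> {0<..})) \<noteq> ({} :: ('a \<times> real) set)"
    using dense_set(2)[of UNIV] Rats_1 by (auto simp del: Rats_1)
  obtain d q where dq: "from_nat_into (dense_set \<times> (\<rat> \<inter> {0<..})) i = (d, q :: real)"
    by (cases "from_nat_into (dense_set \<times> (\<rat> \<inter> {0::real<..})) i")
  have "q > 0" using from_nat_into[OF ne, of i] by (simp add: dq)
  then show ?thesis using dq by (intro that[of q d]) (auto simp: bump_def)
qed

lemma bump_bounds: "0 \<le> bump i x" "bump i x \<le> 1"
proof -
  obtain d q where "q > 0" "bump i = (\<lambda>x. max 0 (1 - dist x d / q))" by (rule bump_cases)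
  then show "0 \<le> bump i x" "bump i x \<le> 1" by simp_all
qed

lemma bump_C0: "bump i \<in> C0 euclidean"
proof -
  obtain d q where q: "q > 0" and b: "bump i = (\<lambda>x. max 0 (1 - dist x d / q))" by (rule bump_cases)
  have "continuous_on UNIV (bump i)" unfolding b using q by (intro continuous_intros) auto
  moreover have "vanishes_at_infinity euclidean (bump i)"
    unfolding vanishes_at_infinity_def
  proof (intro allI impI exI conjI ballI)
    show "compactin euclidean (cball d q)" by simp
    show "\<bar>bump i x\<bar> < e" if "0 < e" "x \<in> topspace euclidean - cball d q" for e x
      using that q by (simp add: b dist_commute)
  qed
  ultimately show ?thesis by (simp add: C0_def)
qed

lemma bump_measurable: "bump i \<in> borel_measurable borel"
  using bump_C0[of i] by (intro borel_measurable_continuous_onI) (simp add: C0_def)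

text \<open>A single tent of radius less than e/2, centred within e/4 of \<open>y\<close>, suffices
  for each \<open>e\<close>: it is positive at \<open>y\<close>, hence eventually positive at
  \<open>Y k\<close>, which confines \<open>Y k\<close> to the tent.\<close>

lemma bump_convergence:
  assumes "\<And>i. (\<lambda>k. bump i (Y k)) \<longlonglongrightarrow> bump i y"
  shows "Y \<longlonglongrightarrow> y"
proof (rule tendstoI)
  fix e :: real assume e: "e > 0"
  obtain d where d: "d \<in> dense_set" "dist y d < e / 4"
    using dense_set(2)[of "ball y (e/4)"] e by auto
  obtain q where q: "q \<in> \<rat>" "e / 4 < q" "q < e / 2"
    using Rats_dense_in_real[of "e/4" "e/2"] e by auto
  have "countable (dense_set \<times> (\<rat> \<inter> {0::real<..}))"
    using countable_rat dense_set(1) by (intro countable_SIGMA countable_Int1)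
  moreover have "(d, q) \<in> dense_set \<times> (\<rat> \<inter> {0<..})" using d q e by simp
  ultimately have "\<exists>i. from_nat_into (dense_set \<times> (\<rat> \<inter> {0<..})) i = (d, q)"
    by (rule from_nat_into_surj)
  then obtain i where "from_nat_into (dense_set \<times> (\<rat> \<inter> {0<..})) i = (d, q)" ..
  then have b: "bump i x = max 0 (1 - dist x d / q)" for x by (simp add: bump_def)
  have q0: "q > 0" using q e by simp
  have "0 < bump i y" using d q q0 by (simp add: b field_simps)
  then have "\<forall>\<^sub>F k in sequentially. 0 < bump i (Y k)"
    by (rule order_tendstoD(1)[OF assms])
  then show "\<forall>\<^sub>F k in sequentially. dist (Y k) y < e"
  proof eventually_elim
    case (elim k)
    then have "0 < 1 - dist (Y k) d / q" by (simp add: b)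
    then have "dist (Y k) d < q" using q0 by (simp add: field_simps)
    then show ?case using d q dist_triangle2[of "Y k" y d] by linarith
  qed
qed

end

locale skeleton_flow = flow P \<Omega> \<psi> + path_metric \<delta>
  for P :: "'a::{heine_borel,polish_space} transition"
    and \<Omega> :: "'w measure" and \<psi> :: "real \<Rightarrow> real \<Rightarrow> 'w \<Rightarrow> 'a \<Rightarrow> 'a"
    and \<delta> :: "(real \<Rightarrow> 'a) \<Rightarrow> (real \<Rightarrow> 'a) \<Rightarrow> real" +
  fixes S :: "nat \<Rightarrow> real" and X :: "nat \<Rightarrow> 'a" and \<Phi> :: "'w \<Rightarrow> nat \<Rightarrow> 'a path"
  assumes dense: "closure (range (\<lambda>n. (S n, X n))) = UNIV"
    and skeleton: "random_skeleton \<Omega> \<psi> S X \<Phi>"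
    and TF4: "AE \<omega> in \<Omega>. \<Phi> \<omega> \<in> skeletons \<delta>"
begin

lemma \<Phi>_paths: "\<omega> \<in> space \<Omega> \<Longrightarrow> \<Phi> \<omega> n \<in> paths"
  and \<Phi>_fst: "\<omega> \<in> space \<Omega> \<Longrightarrow> fst (\<Phi> \<omega> n) = S n"
  and \<Phi>_start: "\<omega> \<in> space \<Omega> \<Longrightarrow> snd (\<Phi> \<omega> n) (S n) = X n"
  and \<Phi>_snd_measurable: "S n \<le> t \<Longrightarrow> (\<lambda>\<omega>. snd (\<Phi> \<omega> n) t) \<in> borel_measurable \<Omega>"
  and \<Phi>_AE: "S n \<le> t \<Longrightarrow> AE \<omega> in \<Omega>. snd (\<Phi> \<omega> n) t = \<psi> (S n) t \<omega> (X n)"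
  using skeleton by (simp_all add: random_skeleton_def)

lemma \<Phi>_cylinder: "cylinder_measurable \<Omega> (\<lambda>\<omega>. \<Phi> \<omega> n)"
  unfolding cylinder_measurable_def
proof (intro conjI allI)
  show "(\<lambda>\<omega>. \<Phi> \<omega> n) \<in> space \<Omega> \<rightarrow> paths" using \<Phi>_paths by auto
  show "(\<lambda>\<omega>. fst (\<Phi> \<omega> n)) \<in> borel_measurable \<Omega>"
    by (subst measurable_cong[where g="\<lambda>_. S n"]) (simp_all add: \<Phi>_fst)
  fix t
  have "(\<lambda>\<omega>. snd (\<Phi> \<omega> n) (max (S n) t)) \<in> borel_measurable \<Omega>" by (rule \<Phi>_snd_measurable) simp
  then show "(\<lambda>\<omega>. extend (\<Phi> \<omega> n) t) \<in> borel_measurable \<Omega>"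
    by (rule measurable_cong[THEN iffD1, rotated]) (simp add: extend_def \<Phi>_fst)
qed

section \<open>Mean-square continuity of the flow, tested on the bumps\<close>

definition sq_diff :: "nat \<Rightarrow> ('w \<Rightarrow> 'a) \<Rightarrow> ('w \<Rightarrow> 'a) \<Rightarrow> real"
  where "sq_diff i Y Z = (\<integral>\<omega>. (bump i (Y \<omega>) - bump i (Z \<omega>))\<^sup>2 \<partial>\<Omega>)"

lemma sq_bump_le: "(bump i x - bump i y)\<^sup>2 \<le> 1"
proof -
  have "\<bar>bump i x - bump i y\<bar> \<le> 1" using bump_bounds[of i x] bump_bounds[of i y] by linarith
  then show ?thesis by (simp add: abs_square_le_1)
qed

lemma sq_bump_integrable:
  assumes "Y \<in> borel_measurable \<Omega>" "Z \<in> borel_measurable \<Omega>"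
  shows "integrable \<Omega> (\<lambda>\<omega>. (bump i (Y \<omega>) - bump i (Z \<omega>))\<^sup>2)"
proof (rule integrable_const_bound[where B=1])
  show "AE \<omega> in \<Omega>. norm ((bump i (Y \<omega>) - bump i (Z \<omega>))\<^sup>2) \<le> 1"
    by (intro AE_I2) (simp add: sq_bump_le)
  show "(\<lambda>\<omega>. (bump i (Y \<omega>) - bump i (Z \<omega>))\<^sup>2) \<in> borel_measurable \<Omega>"
    using measurable_compose[OF assms(1) bump_measurable] measurable_compose[OF assms(2) bump_measurable]
    by (intro borel_measurable_power borel_measurable_diff)
qed

lemma sq_diff_nonneg: "0 \<le> sq_diff i Y Z"
  unfolding sq_diff_def by (intro Bochner_Integration.integral_nonneg) simp

lemma sq_diff_le_1: "sq_diff i Y Z \<le> 1"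
proof -
  have "(\<integral>\<omega>. (bump i (Y \<omega>) - bump i (Z \<omega>))\<^sup>2 \<partial>\<Omega>) \<le> 1"
  proof (cases "integrable \<Omega> (\<lambda>\<omega>. (bump i (Y \<omega>) - bump i (Z \<omega>))\<^sup>2)")
    case True
    then have "(\<integral>\<omega>. (bump i (Y \<omega>) - bump i (Z \<omega>))\<^sup>2 \<partial>\<Omega>) \<le> (\<integral>\<omega>. 1 \<partial>\<Omega>)"
      by (intro integral_mono) (auto simp: sq_bump_le)
    then show ?thesis by (simp add: prob_space)
  qed (simp add: not_integrable_integral_eq)
  then show ?thesis by (simp add: sq_diff_def)
qed

lemma sq_diff_cong_AE:
  assumes "Y \<in> borel_measurable \<Omega>" "Z \<in> borel_measurable \<Omega>" "Y' \<in> borel_measurable \<Omega>" "Z' \<in> borel_measurable \<Omega>"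
    and "AE \<omega> in \<Omega>. Y \<omega> = Y' \<omega>" "AE \<omega> in \<Omega>. Z \<omega> = Z' \<omega>"
  shows "sq_diff i Y Z = sq_diff i Y' Z'"
  unfolding sq_diff_def
proof (rule integral_cong_AE)
  show "AE \<omega> in \<Omega>. (bump i (Y \<omega>) - bump i (Z \<omega>))\<^sup>2 = (bump i (Y' \<omega>) - bump i (Z' \<omega>))\<^sup>2"
    using assms(5,6) by eventually_elim simp
qed (use sq_bump_integrable assms in blast)+

lemma sq_diff_triangle:
  assumes "Y \<in> borel_measurable \<Omega>" "Z \<in> borel_measurable \<Omega>" "W \<in> borel_measurable \<Omega>"
  shows "sq_diff i Y W \<le> 2 * sq_diff i Y Z + 2 * sq_diff i Z W"
proof -
  have "sq_diff i Y W \<le> (\<integral>\<omega>. 2 * (bump i (Y \<omega>) - bump i (Z \<omega>))\<^sup>2 + 2 * (bump i (Z \<omega>) - bump i (W \<omega>))\<^sup>2 \<partial>\<Omega>)"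
    unfolding sq_diff_def
  proof (rule integral_mono)
    fix \<omega>
    have "0 \<le> ((bump i (Y \<omega>) - bump i (Z \<omega>)) - (bump i (Z \<omega>) - bump i (W \<omega>)))\<^sup>2" by simp
    then show "(bump i (Y \<omega>) - bump i (W \<omega>))\<^sup>2 \<le> 2 * (bump i (Y \<omega>) - bump i (Z \<omega>))\<^sup>2 + 2 * (bump i (Z \<omega>) - bump i (W \<omega>))\<^sup>2"
      by (simp add: power2_eq_square algebra_simps)
  qed (use assms in \<open>auto intro!: sq_bump_integrable\<close>)
  also have "\<dots> = 2 * sq_diff i Y Z + 2 * sq_diff i Z W"
    unfolding sq_diff_def using assms by (simp add: sq_bump_integrable)
  finally show ?thesis .
qed

text \<open>\<open>SF5\<close> gives a limit over points different from \<open>x\<close>. The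
  expression vanishes at \<open>x\<close>, so it is continuous there and the sequence may also take
  the value \<open>x\<close>.\<close>

lemma flow_space_continuous:
  assumes "s \<le> t" "y \<longlonglongrightarrow> x"
  shows "(\<lambda>k. sq_diff i (\<lambda>\<omega>. \<psi> s t \<omega> (y k)) (\<lambda>\<omega>. \<psi> s t \<omega> x)) \<longlonglongrightarrow> 0"
proof -
  have "SF5 \<Omega> \<psi>" using flow by (simp add: stochastic_flow_def)
  then have "((\<lambda>z. sq_diff i (\<lambda>\<omega>. \<psi> s t \<omega> z) (\<lambda>\<omega>. \<psi> s t \<omega> x)) \<longlongrightarrow> 0) (at x)"
    unfolding SF5_def sq_diff_def using bump_C0 assms(1) by blast
  moreover have "sq_diff i (\<lambda>\<omega>. \<psi> s t \<omega> x) (\<lambda>\<omega>. \<psi> s t \<omega> x) = 0" by (simp add: sq_diff_def)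
  ultimately have "isCont (\<lambda>z. sq_diff i (\<lambda>\<omega>. \<psi> s t \<omega> z) (\<lambda>\<omega>. \<psi> s t \<omega> x)) x"
    by (simp add: isCont_def)
  from isCont_tendsto_compose[OF this assms(2)] show ?thesis by (simp add: sq_diff_def)
qed

text \<open>Starting time and starting point move together. Since the supremum over space in
  \<open>SF4\<close> is uniform, the time can be changed at the moving point \<open>y k\<close>
  first, and \<open>SF5\<close> handles the remaining change of the point.\<close>

lemma flow_continuous:
  assumes st: "s \<le> t" and u: "\<And>k. u k \<le> t" and lim: "u \<longlonglongrightarrow> s" "y \<longlonglongrightarrow> x"
  shows "(\<lambda>k. sq_diff i (\<lambda>\<omega>. \<psi> (u k) t \<omega> (y k)) (\<lambda>\<omega>. \<psi> s t \<omega> x)) \<longlonglongrightarrow> 0"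
proof -
  define g where "g p = (SUP z. sq_diff i (\<lambda>\<omega>. \<psi> (fst p) (snd p) \<omega> z) (\<lambda>\<omega>. \<psi> s t \<omega> z))" for p
  have "SF4 \<Omega> \<psi>" using flow by (simp add: stochastic_flow_def)
  from this[unfolded SF4_def, rule_format, OF bump_C0[of i] st]
  have "(g \<longlongrightarrow> 0) (at (s, t) within {(u, v). u \<le> v})"
    unfolding g_def sq_diff_def case_prod_unfold .
  moreover have "g (s, t) = 0" by (simp add: g_def sq_diff_def)
  ultimately have cont: "continuous (at (s, t) within {(u, v). u \<le> v}) g"
    by (simp add: continuous_within)
  have "(\<lambda>k. (u k, t)) \<longlonglongrightarrow> (s, t)" using lim by (intro tendsto_Pair) auto
  with u have "(\<forall>k. (u k, t) \<in> {(u, v). u \<le> v}) \<and> (\<lambda>k. (u k, t)) \<longlonglongrightarrow> (s, t)" by simp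
  then have "(g \<circ> (\<lambda>k. (u k, t))) \<longlonglongrightarrow> g (s, t)"
    by (rule cont[unfolded continuous_within_sequentially, THEN spec, THEN mp])
  then have g0: "(\<lambda>k. g (u k, t)) \<longlonglongrightarrow> 0" using \<open>g (s, t) = 0\<close> by (simp add: o_def)
  have le: "sq_diff i (\<lambda>\<omega>. \<psi> (u k) t \<omega> (y k)) (\<lambda>\<omega>. \<psi> s t \<omega> (y k)) \<le> g (u k, t)" for k
    unfolding g_def fst_conv snd_conv
    by (rule cSUP_upper) (auto intro!: bdd_aboveI[of _ 1] sq_diff_le_1)
  have "(\<lambda>k. 2 * g (u k, t) + 2 * sq_diff i (\<lambda>\<omega>. \<psi> s t \<omega> (y k)) (\<lambda>\<omega>. \<psi> s t \<omega> x)) \<longlonglongrightarrow> 2 * 0 + 2 * 0"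
    by (intro tendsto_intros g0 flow_space_continuous st lim)
  then have lim': "(\<lambda>k. 2 * g (u k, t) + 2 * sq_diff i (\<lambda>\<omega>. \<psi> s t \<omega> (y k)) (\<lambda>\<omega>. \<psi> s t \<omega> x)) \<longlonglongrightarrow> 0"
    by simp
  show ?thesis
  proof (rule Lim_null_comparison[OF always_eventually lim'], rule allI)
    fix k
    have "sq_diff i (\<lambda>\<omega>. \<psi> (u k) t \<omega> (y k)) (\<lambda>\<omega>. \<psi> s t \<omega> x)
      \<le> 2 * sq_diff i (\<lambda>\<omega>. \<psi> (u k) t \<omega> (y k)) (\<lambda>\<omega>. \<psi> s t \<omega> (y k))
        + 2 * sq_diff i (\<lambda>\<omega>. \<psi> s t \<omega> (y k)) (\<lambda>\<omega>. \<psi> s t \<omega> x)"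
      by (intro sq_diff_triangle \<psi>_eval_measurable st u)
    then show "norm (sq_diff i (\<lambda>\<omega>. \<psi> (u k) t \<omega> (y k)) (\<lambda>\<omega>. \<psi> s t \<omega> x))
      \<le> 2 * g (u k, t) + 2 * sq_diff i (\<lambda>\<omega>. \<psi> s t \<omega> (y k)) (\<lambda>\<omega>. \<psi> s t \<omega> x)"
      using le[of k] sq_diff_nonneg by simp
  qed
qed

text \<open>Pairs of a bump and a time of \<open>T\<close> are enumerated by
  \<open>prod_decode\<close>, so one diagonal subsequence serves all bumps and all times; the bumps
  together detect convergence in \<open>M\<close>.\<close>

lemma pointwise_subsequence:
  fixes Z :: "nat \<Rightarrow> 'w \<Rightarrow> 'a path" and W :: "real \<Rightarrow> 'w \<Rightarrow> 'a"
  assumes Z: "\<And>k t. (\<lambda>\<omega>. extend (Z k \<omega>) t) \<in> borel_measurable \<Omega>"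
    and T: "countable T" and W: "\<And>t. t \<in> T \<Longrightarrow> W t \<in> borel_measurable \<Omega>"
    and lim: "\<And>t i. t \<in> T \<Longrightarrow> (\<lambda>k. sq_diff i (\<lambda>\<omega>. extend (Z k \<omega>) t) (W t)) \<longlonglongrightarrow> 0"
  shows "\<exists>r :: nat \<Rightarrow> nat. strict_mono r \<and> (AE \<omega> in \<Omega>. \<forall>t\<in>T. (\<lambda>k. extend (Z (r k) \<omega>) t) \<longlonglongrightarrow> W t \<omega>)"
proof (cases "T = {}")
  case True
  then show ?thesis by (intro exI[of _ id]) (simp add: strict_mono_id)
next
  case False
  define \<tau> where "\<tau> j = from_nat_into T j" for j
  have \<tau>: "\<tau> j \<in> T" for j using False by (simp add: \<tau>_def from_nat_into)
  define a where "a m k \<omega> = (bump (fst (prod_decode m)) (extend (Z k \<omega>) (\<tau> (snd (prod_decode m))))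
      - bump (fst (prod_decode m)) (W (\<tau> (snd (prod_decode m))) \<omega>))\<^sup>2" for m k \<omega>
  have "\<exists>r :: nat \<Rightarrow> nat. strict_mono r \<and> (AE \<omega> in \<Omega>. \<forall>m. (\<lambda>k. a m (r k) \<omega>) \<longlonglongrightarrow> 0)"
  proof (rule L1_diagonal_subsequence)
    show "integrable \<Omega> (a m k)" for m k
      unfolding a_def by (intro sq_bump_integrable Z W \<tau>)
    show "0 \<le> a m k \<omega>" for m k \<omega> by (simp add: a_def)
    show "(\<lambda>k. \<integral>\<omega>. a m k \<omega> \<partial>\<Omega>) \<longlonglongrightarrow> 0" for m
      using lim[OF \<tau>, of "fst (prod_decode m)" "snd (prod_decode m)"] by (simp add: a_def sq_diff_def)
  qed
  then obtain r :: "nat \<Rightarrow> nat" where r: "strict_mono r" "AE \<omega> in \<Omega>. \<forall>m. (\<lambda>k. a m (r k) \<omega>) \<longlonglongrightarrow> 0" by blast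
  have "AE \<omega> in \<Omega>. \<forall>t\<in>T. (\<lambda>k. extend (Z (r k) \<omega>) t) \<longlonglongrightarrow> W t \<omega>"
    using r(2)
  proof eventually_elim
    case (elim \<omega>)
    show ?case
    proof
      fix t assume "t \<in> T"
      then obtain j where j: "t = \<tau> j" using from_nat_into_surj[OF T] by (auto simp: \<tau>_def)
      show "(\<lambda>k. extend (Z (r k) \<omega>) t) \<longlonglongrightarrow> W t \<omega>"
      proof (rule bump_convergence)
        fix i
        have "(\<lambda>k. (bump i (extend (Z (r k) \<omega>) t) - bump i (W t \<omega>))\<^sup>2) \<longlonglongrightarrow> 0"
          using elim[rule_format, of "prod_encode (i, j)"] by (simp add: a_def j)
        then have "(\<lambda>k. bump i (extend (Z (r k) \<omega>) t) - bump i (W t \<omega>)) \<longlonglongrightarrow> 0"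
          using tendsto_real_sqrt by (fastforce simp: tendsto_rabs_zero_iff)
        then show "(\<lambda>k. bump i (extend (Z (r k) \<omega>) t)) \<longlonglongrightarrow> bump i (W t \<omega>)"
          by (simp add: LIM_zero_iff)
      qed
    qed
  qed
  with r(1) show ?thesis by blast
qed

text \<open>The element \<^term>\<open>undefined\<close> serves as an arbitrary base point of \<open>M\<close>.\<close>

definition region :: "nat \<Rightarrow> (real \<times> 'a) set"
  where "region N = cball (0, undefined) (real N)"

text \<open>A random compact set of paths when \<Phi> is a skeleton. The closure is taken so that
  limits of skeleton paths are included.\<close>

definition tight :: "'w \<Rightarrow> nat \<Rightarrow> 'a path set"
  where "tight \<omega> N = path_topology \<delta> closure_of skeleton_set (\<Phi> \<omega>) (region N)"

lemma relatively_compact_tight: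
  "\<Phi> \<omega> \<in> skeletons \<delta> \<Longrightarrow> relatively_compact_in (path_topology \<delta>) (skeleton_set (\<Phi> \<omega>) (region N))"
  by (rule skeletonsD(4)) (simp_all add: region_def)

text \<open>Mean-square convergence yields pointwise convergence at all rational times after
  \<open>s\<close> along a subsequence. Within the compact set \<open>tight \<omega> N\<close>,
  where \<open>N\<close> may depend on \<omega>, this already implies convergence of paths.\<close>

lemma path_subsequence:
  fixes Z :: "nat \<Rightarrow> 'w \<Rightarrow> 'a path" and W :: "real \<Rightarrow> 'w \<Rightarrow> 'a"
  assumes Z: "\<And>k t. (\<lambda>\<omega>. extend (Z k \<omega>) t) \<in> borel_measurable \<Omega>"
    and tight: "AE \<omega> in \<Omega>. \<exists>N. \<forall>k. Z k \<omega> \<in> tight \<omega> N"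
    and s: "AE \<omega> in \<Omega>. (\<lambda>k. fst (Z k \<omega>)) \<longlonglongrightarrow> s"
    and W: "\<And>t. s < t \<Longrightarrow> W t \<in> borel_measurable \<Omega>"
    and lim: "\<And>t i. s < t \<Longrightarrow> (\<lambda>k. sq_diff i (\<lambda>\<omega>. extend (Z k \<omega>) t) (W t)) \<longlonglongrightarrow> 0"
  shows "\<exists>r :: nat \<Rightarrow> nat. strict_mono r \<and> (AE \<omega> in \<Omega>. \<exists>f. fst f = s \<and>
    limitin (path_topology \<delta>) (\<lambda>k. Z (r k) \<omega>) f sequentially \<and> (\<forall>t\<in>\<rat>. s < t \<longrightarrow> extend f t = W t \<omega>))"
proof -
  define T where "T = \<rat> \<inter> {s<..}"
  have "countable T" unfolding T_def using countable_rat by (rule countable_Int1)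
  then have "\<exists>r :: nat \<Rightarrow> nat. strict_mono r \<and> (AE \<omega> in \<Omega>. \<forall>t\<in>T. (\<lambda>k. extend (Z (r k) \<omega>) t) \<longlonglongrightarrow> W t \<omega>)"
    by (intro pointwise_subsequence Z W lim) (auto simp: T_def)
  then obtain r :: "nat \<Rightarrow> nat" where r: "strict_mono r" "AE \<omega> in \<Omega>. \<forall>t\<in>T. (\<lambda>k. extend (Z (r k) \<omega>) t) \<longlonglongrightarrow> W t \<omega>" by blast
  have "AE \<omega> in \<Omega>. \<exists>f. fst f = s \<and>
    limitin (path_topology \<delta>) (\<lambda>k. Z (r k) \<omega>) f sequentially \<and> (\<forall>t\<in>\<rat>. s < t \<longrightarrow> extend f t = W t \<omega>)"
    using r(2) tight s TF4
  proof eventually_elim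
    case (elim \<omega>)
    obtain N where N: "\<And>k. Z k \<omega> \<in> tight \<omega> N" using elim(2) by blast
    have conv: "(\<lambda>k. extend (Z (r k) \<omega>) t) \<longlonglongrightarrow> W t \<omega>" if "t \<in> \<rat>" "s < t" for t
      using elim(1) that by (simp add: T_def)
    have fst: "(\<lambda>k. fst (Z (r k) \<omega>)) \<longlonglongrightarrow> s"
      using LIMSEQ_subseq_LIMSEQ[OF elim(3) r(1)] by (simp add: o_def)
    obtain f where "fst f = s" "limitin (path_topology \<delta>) (\<lambda>k. Z (r k) \<omega>) f sequentially"
      "\<forall>t\<in>\<rat>. s < t \<longrightarrow> extend f t = W t \<omega>"
      using relatively_compact_pointwise_limit[OF relatively_compact_tight[OF elim(4)] N[unfolded tight_def] fst conv]
      by metis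
    then show ?case by blast
  qed
  with r(1) show ?thesis by blast
qed

lemma path_subsequence_to:
  fixes Z :: "nat \<Rightarrow> 'w \<Rightarrow> 'a path" and V :: "'w \<Rightarrow> 'a path"
  assumes Z: "\<And>k t. (\<lambda>\<omega>. extend (Z k \<omega>) t) \<in> borel_measurable \<Omega>"
    and tight: "AE \<omega> in \<Omega>. \<exists>N. \<forall>k. Z k \<omega> \<in> tight \<omega> N"
    and s: "AE \<omega> in \<Omega>. (\<lambda>k. fst (Z k \<omega>)) \<longlonglongrightarrow> s"
    and V: "cylinder_measurable \<Omega> V" "\<And>\<omega>. \<omega> \<in> space \<Omega> \<Longrightarrow> fst (V \<omega>) = s"
    and lim: "\<And>t i. s < t \<Longrightarrow> (\<lambda>k. sq_diff i (\<lambda>\<omega>. extend (Z k \<omega>) t) (\<lambda>\<omega>. extend (V \<omega>) t)) \<longlonglongrightarrow> 0"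
  shows "\<exists>r :: nat \<Rightarrow> nat. strict_mono r \<and>
    (AE \<omega> in \<Omega>. limitin (path_topology \<delta>) (\<lambda>k. Z (r k) \<omega>) (V \<omega>) sequentially)"
proof -
  have Vt: "(\<lambda>\<omega>. extend (V \<omega>) t) \<in> borel_measurable \<Omega>" for t
    using V(1) by (simp add: cylinder_measurable_def)
  obtain r :: "nat \<Rightarrow> nat" where r: "strict_mono r" "AE \<omega> in \<Omega>. \<exists>f. fst f = s \<and>
    limitin (path_topology \<delta>) (\<lambda>k. Z (r k) \<omega>) f sequentially \<and> (\<forall>t\<in>\<rat>. s < t \<longrightarrow> extend f t = extend (V \<omega>) t)"
    using path_subsequence[where W="\<lambda>t \<omega>. extend (V \<omega>) t", OF Z tight s Vt lim] by blast
  have "AE \<omega> in \<Omega>. limitin (path_topology \<delta>) (\<lambda>k. Z (r k) \<omega>) (V \<omega>) sequentially"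
    using r(2) AE_space
  proof eventually_elim
    case (elim \<omega>)
    then obtain f where f: "fst f = s" "limitin (path_topology \<delta>) (\<lambda>k. Z (r k) \<omega>) f sequentially"
      "\<forall>t\<in>\<rat>. s < t \<longrightarrow> extend f t = extend (V \<omega>) t" by blast
    have "f \<in> paths" using limitin_topspace[OF f(2)] by simp
    moreover have "V \<omega> \<in> paths" using V(1) elim(2) by (auto simp: cylinder_measurable_def)
    ultimately have "f = V \<omega>" using f V(2)[OF elim(2)] by (intro paths_eqI_right) auto
    with f(2) show ?case by simp
  qed
  with r(1) show ?thesis by blast
qed

text \<open>The last clause keeps the modification in the compact sets of the skeleton. Without it,
  sequences of modifications could not be fed into \<open>path_subsequence\<close> again.\<close>

definition is_modification :: "real \<Rightarrow> 'a \<Rightarrow> ('w \<Rightarrow> 'a path) \<Rightarrow> bool"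
  where "is_modification s y V \<longleftrightarrow> cylinder_measurable \<Omega> V \<and> (\<forall>\<omega>\<in>space \<Omega>. fst (V \<omega>) = s) \<and>
    (\<forall>t\<ge>s. AE \<omega> in \<Omega>. extend (V \<omega>) t = \<psi> s t \<omega> y) \<and>
    (AE \<omega> in \<Omega>. \<forall>N. dist (0, undefined) (s, y) < real N \<longrightarrow> V \<omega> \<in> tight \<omega> N)"

lemma modification_exists: "\<exists>V. is_modification s y V"
proof -
  have "(s, y) \<in> closure (range (\<lambda>n. (S n, X n)))" by (simp add: dense)
  then obtain p where p: "\<And>k. p k \<in> range (\<lambda>n. (S n, X n))" "p \<longlonglongrightarrow> (s, y)"
    unfolding closure_sequential by blast
  have "\<forall>k. \<exists>n. p k = (S n, X n)" using p(1) by auto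
  then obtain n where n: "\<And>k. p k = (S (n k), X (n k))" by metis
  have S_lim: "(\<lambda>k. S (n k)) \<longlonglongrightarrow> s" and X_lim: "(\<lambda>k. X (n k)) \<longlonglongrightarrow> y"
    using tendsto_fst[OF p(2)] tendsto_snd[OF p(2)] by (simp_all add: n)
  define Z where "Z k \<omega> = \<Phi> \<omega> (n k)" for k \<omega>
  have Zm: "(\<lambda>\<omega>. extend (Z k \<omega>) t) \<in> borel_measurable \<Omega>" for k t
    using \<Phi>_cylinder[of "n k"] by (simp add: Z_def cylinder_measurable_def)
  have Z_in: "Z k \<omega> \<in> tight \<omega> N"
    if "\<omega> \<in> space \<Omega>" "\<Phi> \<omega> \<in> skeletons \<delta>" "dist (0, undefined) (p k) \<le> real N" for k \<omega> N
  proof -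
    have "restrict_from (S (n k)) (\<Phi> \<omega> (n k)) \<in> skeleton_set (\<Phi> \<omega>) (region N)"
      by (rule skeleton_set_restrict)
        (use that in \<open>simp_all add: active_def \<Phi>_fst \<Phi>_start region_def n\<close>)
    moreover have "restrict_from (S (n k)) (\<Phi> \<omega> (n k)) = \<Phi> \<omega> (n k)"
      using restrict_from_fst[OF \<Phi>_paths[OF that(1)], of "n k"] by (simp add: \<Phi>_fst that(1))
    ultimately show ?thesis
      unfolding tight_def Z_def using skeleton_set_closure[OF that(2)] by metis
  qed
  obtain N0 where N0: "\<And>k. dist (0, undefined) (p k) \<le> real N0"
  proof -
    have "bounded (range p)" using p(2) by (rule convergent_imp_bounded)
    then obtain e where "\<forall>x\<in>range p. dist (0, undefined) x \<le> e" unfolding bounded_any_center[where a="(0, undefined)"] by blast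
    moreover obtain N where "e \<le> real N" using real_arch_simple by blast
    ultimately show ?thesis using that by (meson order_trans rangeI)
  qed
  have Z_lim: "(\<lambda>k. sq_diff i (\<lambda>\<omega>. extend (Z k \<omega>) t) (\<lambda>\<omega>. \<psi> s t \<omega> y)) \<longlonglongrightarrow> 0"
    if t: "s < t" for t i
  proof -
    \<comment> \<open>The minimum keeps the starting time below \<open>t\<close> for every
      \<open>k\<close>. Since \<open>S (n k)\<close> tends to \<open>s < t\<close>, it is eventually
      \<open>S (n k)\<close> itself.\<close>
    have "(\<lambda>k. sq_diff i (\<lambda>\<omega>. \<psi> (min (S (n k)) t) t \<omega> (X (n k))) (\<lambda>\<omega>. \<psi> s t \<omega> y)) \<longlonglongrightarrow> 0"
    proof (rule flow_continuous)
      have "(\<lambda>k. min (S (n k)) t) \<longlonglongrightarrow> min s t" by (intro tendsto_intros S_lim)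
      then show "(\<lambda>k. min (S (n k)) t) \<longlonglongrightarrow> s" using t by simp
    qed (use t X_lim in auto)
    moreover have "\<forall>\<^sub>F k in sequentially. sq_diff i (\<lambda>\<omega>. \<psi> (min (S (n k)) t) t \<omega> (X (n k))) (\<lambda>\<omega>. \<psi> s t \<omega> y)
        = sq_diff i (\<lambda>\<omega>. extend (Z k \<omega>) t) (\<lambda>\<omega>. \<psi> s t \<omega> y)"
      using order_tendstoD(2)[OF S_lim t]
    proof eventually_elim
      case (elim k)
      show ?case
      proof (rule sq_diff_cong_AE)
        show "AE \<omega> in \<Omega>. \<psi> (min (S (n k)) t) t \<omega> (X (n k)) = extend (Z k \<omega>) t"
          using \<Phi>_AE[OF less_imp_le[OF elim]] AE_space
          by eventually_elim (use elim in \<open>simp add: Z_def extend_eq_snd \<Phi>_fst\<close>)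
      qed (use t elim Zm in \<open>auto intro!: \<psi>_eval_measurable\<close>)
    qed
    ultimately show ?thesis by (rule Lim_transform_eventually)
  qed
  obtain r :: "nat \<Rightarrow> nat" where r: "strict_mono r" "AE \<omega> in \<Omega>. \<exists>f. fst f = s \<and>
      limitin (path_topology \<delta>) (\<lambda>k. Z (r k) \<omega>) f sequentially \<and> (\<forall>t\<in>\<rat>. s < t \<longrightarrow> extend f t = \<psi> s t \<omega> y)"
  proof -
    have "AE \<omega> in \<Omega>. \<exists>N. \<forall>k. Z k \<omega> \<in> tight \<omega> N"
      using TF4 AE_space by eventually_elim (use Z_in N0 in blast)
    moreover have "AE \<omega> in \<Omega>. (\<lambda>k. fst (Z k \<omega>)) \<longlonglongrightarrow> s"
      by (rule AE_I2) (simp add: Z_def \<Phi>_fst S_lim)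
    ultimately have "\<exists>r :: nat \<Rightarrow> nat. strict_mono r \<and> (AE \<omega> in \<Omega>. \<exists>f. fst f = s \<and>
      limitin (path_topology \<delta>) (\<lambda>k. Z (r k) \<omega>) f sequentially \<and> (\<forall>t\<in>\<rat>. s < t \<longrightarrow> extend f t = \<psi> s t \<omega> y))"
      by (intro path_subsequence[where W="\<lambda>t \<omega>. \<psi> s t \<omega> y"] Zm \<psi>_eval_measurable
          Z_lim less_imp_le)
    then show ?thesis using that by blast
  qed
  \<comment> \<open>A measurable event of full probability on which the limit exists. Off it
    \<open>V\<close> will be a constant path, so that \<open>V\<close> is a path everywhere. Its
    measurability is that of a pointwise limit and does not depend on the choice operator.\<close>
  obtain \<Omega>1 where \<Omega>1': "\<Omega>1 \<subseteq> {\<omega>\<in>space \<Omega>. \<exists>f. fst f = s \<and>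
      limitin (path_topology \<delta>) (\<lambda>k. Z (r k) \<omega>) f sequentially \<and> (\<forall>t\<in>\<rat>. s < t \<longrightarrow> extend f t = \<psi> s t \<omega> y)}"
    and \<Omega>1: "\<Omega>1 \<in> events" "prob \<Omega>1 = 1"
    by (rule AE_E_prob[OF r(2)])
  have lim1: "\<exists>f. fst f = s \<and>
      limitin (path_topology \<delta>) (\<lambda>k. Z (r k) \<omega>) f sequentially \<and> (\<forall>t\<in>\<rat>. s < t \<longrightarrow> extend f t = \<psi> s t \<omega> y)"
    if "\<omega> \<in> \<Omega>1" for \<omega>
    using subsetD[OF \<Omega>1' that] by simp
  have AE1: "AE \<omega> in \<Omega>. \<omega> \<in> \<Omega>1" using \<Omega>1 by (simp add: AE_in_set_eq_1)
  define V where "V \<omega> = (if \<omega> \<in> \<Omega>1 then SOME f. fst f = s \<and>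
      limitin (path_topology \<delta>) (\<lambda>k. Z (r k) \<omega>) f sequentially else restrict_from s (s, \<lambda>t\<in>{s..}. y))" for \<omega>
  have V1: "fst (V \<omega>) = s" "limitin (path_topology \<delta>) (\<lambda>k. Z (r k) \<omega>) (V \<omega>) sequentially" if "\<omega> \<in> \<Omega>1" for \<omega>
  proof -
    from lim1[OF that] have "\<exists>f. fst f = s \<and> limitin (path_topology \<delta>) (\<lambda>k. Z (r k) \<omega>) f sequentially" by blast
    from someI_ex[OF this] show "fst (V \<omega>) = s" "limitin (path_topology \<delta>) (\<lambda>k. Z (r k) \<omega>) (V \<omega>) sequentially"
      using that by (simp_all add: V_def)
  qed
  have const: "restrict_from s (s, \<lambda>t\<in>{s..}. y) \<in> paths"
    by (rule restrict_from_paths) (auto simp: paths_def intro: continuous_on_cong[THEN iffD1, OF refl _ continuous_on_const])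
  have V_path: "V \<omega> \<in> paths" for \<omega>
    using limitin_topspace[OF V1(2)] const by (cases "\<omega> \<in> \<Omega>1") (auto simp: V_def)
  have V_fst: "fst (V \<omega>) = s" for \<omega>
    using V1(1) by (cases "\<omega> \<in> \<Omega>1") (auto simp: V_def)
  have V_meas: "(\<lambda>\<omega>. extend (V \<omega>) t) \<in> borel_measurable \<Omega>" for t
  proof (rule borel_measurable_LIMSEQ_metric)
    show "(\<lambda>\<omega>. if \<omega> \<in> \<Omega>1 then extend (Z (r k) \<omega>) t else extend (restrict_from s (s, \<lambda>t\<in>{s..}. y)) t) \<in> borel_measurable \<Omega>" for k
      using \<Omega>1(1) Zm by (intro measurable_If_set) auto
    show "(\<lambda>k. if \<omega> \<in> \<Omega>1 then extend (Z (r k) \<omega>) t else extend (restrict_from s (s, \<lambda>t\<in>{s..}. y)) t) \<longlonglongrightarrow> extend (V \<omega>) t"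
      if "\<omega> \<in> space \<Omega>" for \<omega>
    proof (cases "\<omega> \<in> \<Omega>1")
      case True
      have "(\<lambda>k. extend (Z (r k) \<omega>) t) \<longlonglongrightarrow> extend (V \<omega>) t"
        by (rule limitin_path_eval[OF _ V1(2)[OF True]]) (simp add: Z_def \<Phi>_paths that)
      with True show ?thesis by simp
    qed (simp add: V_def)
  qed
  have V_AE: "AE \<omega> in \<Omega>. extend (V \<omega>) t = \<psi> s t \<omega> y" if "s \<le> t" for t
  \<comment> \<open>The convergence of the flow concerns times after \<open>s\<close>. At
    \<open>s\<close> itself the value is the limit of the starting points
    \<open>X (n k)\<close>.\<close>
  proof (cases "s = t")
    case True
    show ?thesis
      using AE1 AE_space
    proof eventually_elim
      case (elim \<omega>)
      have "(\<lambda>k. snd (Z (r k) \<omega>) (fst (Z (r k) \<omega>))) \<longlonglongrightarrow> snd (V \<omega>) (fst (V \<omega>))"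
        by (rule limitin_path_start[OF _ V1(2)[OF elim(1)]]) (simp add: Z_def \<Phi>_paths elim(2))
      then have "(\<lambda>k. X (n (r k))) \<longlonglongrightarrow> snd (V \<omega>) s"
        by (simp add: Z_def \<Phi>_fst \<Phi>_start elim(2) V_fst)
      moreover have "(\<lambda>k. X (n (r k))) \<longlonglongrightarrow> y"
        using LIMSEQ_subseq_LIMSEQ[OF X_lim r(1)] by (simp add: o_def)
      ultimately have "snd (V \<omega>) s = y" by (rule LIMSEQ_unique)
      then show ?case using True \<psi>_refl[OF elim(2)] by (simp add: extend_eq_snd V_fst)
    qed
  next
    case False
    then have st: "s < t" using that by simp
    \<comment> \<open>The limit has been identified at rational times only. For the fixed real time
      \<open>t\<close>, a further subsequence, which may depend on \<open>t\<close>, identifies it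
      almost surely.\<close>
    have "\<exists>q :: nat \<Rightarrow> nat. strict_mono q \<and> (AE \<omega> in \<Omega>. \<forall>t\<in>{t}. (\<lambda>k. extend (Z (r (q k)) \<omega>) t) \<longlonglongrightarrow> \<psi> s t \<omega> y)"
    proof (rule pointwise_subsequence[where Z="\<lambda>k. Z (r k)" and W="\<lambda>t \<omega>. \<psi> s t \<omega> y"])
      fix t' i assume "t' \<in> {t}"
      then have "(\<lambda>k. sq_diff i (\<lambda>\<omega>. extend (Z k \<omega>) t') (\<lambda>\<omega>. \<psi> s t' \<omega> y)) \<longlonglongrightarrow> 0"
        using Z_lim[of t' i] st by simp
      from LIMSEQ_subseq_LIMSEQ[OF this r(1)]
      show "(\<lambda>k. sq_diff i (\<lambda>\<omega>. extend (Z (r k) \<omega>) t') (\<lambda>\<omega>. \<psi> s t' \<omega> y)) \<longlonglongrightarrow> 0" by (simp add: o_def)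
    qed (use Zm st in \<open>auto intro!: \<psi>_eval_measurable\<close>)
    then obtain q :: "nat \<Rightarrow> nat" where q: "strict_mono q" "AE \<omega> in \<Omega>. (\<lambda>k. extend (Z (r (q k)) \<omega>) t) \<longlonglongrightarrow> \<psi> s t \<omega> y"
      by auto
    show ?thesis
      using q(2) AE1 AE_space
    proof eventually_elim
      case (elim \<omega>)
      have "(\<lambda>k. extend (Z (r k) \<omega>) t) \<longlonglongrightarrow> extend (V \<omega>) t"
        by (rule limitin_path_eval[OF _ V1(2)[OF elim(2)]]) (simp add: Z_def \<Phi>_paths elim(3))
      from LIMSEQ_subseq_LIMSEQ[OF this q(1)] elim(1) show ?case
        unfolding o_def by (rule LIMSEQ_unique)
    qed
  qed
  have "AE \<omega> in \<Omega>. \<forall>N. dist (0, undefined) (s, y) < real N \<longrightarrow> V \<omega> \<in> tight \<omega> N"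
    using AE1 AE_space TF4
  proof eventually_elim
    case (elim \<omega>)
    show ?case
    proof (intro allI impI)
      \<comment> \<open>The strict inequality makes the approximating starting points eventually lie
        in \<open>region N\<close>; the closed set \<open>tight \<omega> N\<close> then contains the
        limit.\<close>
      fix N assume N: "dist (0, undefined) (s, y) < real N"
      have "(\<lambda>k. dist (0, undefined) (p k)) \<longlonglongrightarrow> dist (0, undefined) (s, y)"
        by (intro tendsto_intros p(2))
      from LIMSEQ_subseq_LIMSEQ[OF this r(1)]
      have "(\<lambda>k. dist (0, undefined) (p (r k))) \<longlonglongrightarrow> dist (0, undefined) (s, y)" by (simp add: o_def)
      from order_tendstoD(2)[OF this N]
      have "\<forall>\<^sub>F k in sequentially. Z (r k) \<omega> \<in> tight \<omega> N"
        by eventually_elim (use Z_in[OF elim(2,3)] in \<open>auto intro: less_imp_le\<close>)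
      then show "V \<omega> \<in> tight \<omega> N"
        using limitin_closedin[OF V1(2)[OF elim(1)], of "tight \<omega> N"] by (simp add: tight_def)
    qed
  qed
  then have "is_modification s y V"
    unfolding is_modification_def cylinder_measurable_def
    using V_path V_fst V_meas V_AE by simp
  then show ?thesis by blast
qed

definition \<Psi> :: "real \<Rightarrow> 'a \<Rightarrow> 'w \<Rightarrow> 'a path"
  where "\<Psi> s y = (SOME V. is_modification s y V)"

lemma \<Psi>_modification: "is_modification s y (\<Psi> s y)"
  unfolding \<Psi>_def using modification_exists by (rule someI_ex)

lemma \<Psi>_cylinder: "cylinder_measurable \<Omega> (\<Psi> s y)"
  and \<Psi>_fst: "\<omega> \<in> space \<Omega> \<Longrightarrow> fst (\<Psi> s y \<omega>) = s"
  and \<Psi>_AE: "s \<le> t \<Longrightarrow> AE \<omega> in \<Omega>. extend (\<Psi> s y \<omega>) t = \<psi> s t \<omega> y"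
  and \<Psi>_tight: "AE \<omega> in \<Omega>. \<forall>N. dist (0, undefined) (s, y) < real N \<longrightarrow> \<Psi> s y \<omega> \<in> tight \<omega> N"
  using \<Psi>_modification[of s y] by (simp_all add: is_modification_def)

lemma \<Psi>_paths: "\<omega> \<in> space \<Omega> \<Longrightarrow> \<Psi> s y \<omega> \<in> paths"
  using \<Psi>_cylinder[of s y] by (auto simp: cylinder_measurable_def)

lemma \<Psi>_measurable: "(\<lambda>\<omega>. extend (\<Psi> s y \<omega>) t) \<in> borel_measurable \<Omega>"
  using \<Psi>_cylinder[of s y] by (simp add: cylinder_measurable_def)

text \<open>Applied to arbitrary sequences, almost sure convergence along a subsequence expresses
  continuity in probability with respect to the starting point.\<close>

lemma \<Psi>_continuous:
  assumes "y \<longlonglongrightarrow> x"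
  shows "\<exists>r :: nat \<Rightarrow> nat. strict_mono r \<and>
    (AE \<omega> in \<Omega>. limitin (path_topology \<delta>) (\<lambda>k. \<Psi> s (y (r k)) \<omega>) (\<Psi> s x \<omega>) sequentially)"
proof (rule path_subsequence_to[where Z="\<lambda>k. \<Psi> s (y k)"])
  have "(\<lambda>k. (s, y k)) \<longlonglongrightarrow> (s, x)" by (intro tendsto_intros assms)
  then have "bounded (range (\<lambda>k. (s, y k)))" by (rule convergent_imp_bounded)
  then obtain e where e: "\<forall>p\<in>range (\<lambda>k. (s, y k)). dist (0, undefined) p \<le> e"
    unfolding bounded_any_center[where a="(0, undefined)"] by blast
  obtain N where N: "e < real N" using reals_Archimedean2 by blast
  have "AE \<omega> in \<Omega>. \<forall>k. \<forall>N. dist (0, undefined) (s, y k) < real N \<longrightarrow> \<Psi> s (y k) \<omega> \<in> tight \<omega> N"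
    by (subst AE_all_countable) (intro allI \<Psi>_tight)
  then show "AE \<omega> in \<Omega>. \<exists>N. \<forall>k. \<Psi> s (y k) \<omega> \<in> tight \<omega> N"
  proof eventually_elim
    case (elim \<omega>)
    have "dist (0, undefined) (s, y k) < real N" for k
      using e N by (meson le_less_trans rangeI)
    with elim show ?case by blast
  qed
  show "AE \<omega> in \<Omega>. (\<lambda>k. fst (\<Psi> s (y k) \<omega>)) \<longlonglongrightarrow> s"
    by (rule AE_I2) (simp add: \<Psi>_fst)
  fix t i assume t: "s < t"
  have "sq_diff i (\<lambda>\<omega>. extend (\<Psi> s (y k) \<omega>) t) (\<lambda>\<omega>. extend (\<Psi> s x \<omega>) t)
      = sq_diff i (\<lambda>\<omega>. \<psi> s t \<omega> (y k)) (\<lambda>\<omega>. \<psi> s t \<omega> x)" for k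
    using t by (intro sq_diff_cong_AE \<Psi>_measurable \<psi>_eval_measurable \<Psi>_AE) auto
  then show "(\<lambda>k. sq_diff i (\<lambda>\<omega>. extend (\<Psi> s (y k) \<omega>) t) (\<lambda>\<omega>. extend (\<Psi> s x \<omega>) t)) \<longlonglongrightarrow> 0"
    using flow_space_continuous[OF less_imp_le[OF t] assms, of i] by simp
qed (use \<Psi>_measurable \<Psi>_cylinder \<Psi>_fst in auto)

end

section \<open>Separation probabilities\<close>

text \<open>Path laws and the metric \<open>d_0\<close> refer to paths that start at time 0, so
  paths started at \<open>s\<close> are translated before they are compared.\<close>

definition shift :: "real \<Rightarrow> 'a path \<Rightarrow> 'a path"
  where "shift s f = (0, \<lambda>t\<in>{0..}. extend f (s + t))"

lemma fst_shift [simp]: "fst (shift s f) = 0"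
  by (simp add: shift_def)

lemma extend_shift: "extend (shift s f) t = extend f (s + max 0 t)"
  by (simp add: shift_def extend_def)

lemma shift_paths:
  assumes "f \<in> paths" shows "shift s f \<in> paths"
proof -
  have "continuous_on {0..} (\<lambda>t. extend f (s + t))"
    using continuous_on_extend[OF assms] by (rule continuous_on_compose2) (auto intro!: continuous_intros)
  then have "continuous_on {0..} (\<lambda>t\<in>{0..}. extend f (s + t))"
    by (subst continuous_on_cong[OF refl, of _ _ "\<lambda>t. extend f (s + t)"]) auto
  then show ?thesis by (simp add: paths_iff shift_def)
qed

lemma space_Cpow:
  "space (Cpow n) = {w \<in> extensional {0..}. (\<forall>t\<ge>0. w t \<in> space (Mpow n)) \<and>
    (\<forall>i<n. continuous_on {0..} (\<lambda>t. w t i))}" (is "?L = ?R")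
proof -
  have "continuous_map (top_of_set {0..}) (Mpow_top n) w \<longleftrightarrow>
      (\<forall>t\<ge>0. w t \<in> space (Mpow n)) \<and> (\<forall>i<n. continuous_on {0..} (\<lambda>t. w t i))" for w :: "real \<Rightarrow> nat \<Rightarrow> 'a"
    unfolding Mpow_top_def continuous_map_componentwise
    by (auto simp: space_Mpow PiE_iff image_subset_iff)
  then show ?thesis
    by (intro set_eqI) (simp add: Cpow_def space_restrict_space space_PiM PiE_iff, blast)
qed

lemma pair_apply: "pair x y 0 = x" "pair x y 1 = y" "pair x y (Suc 0) = y"
  by (simp_all add: pair_def)

context path_metric
begin

lemma cylinder_measurable_shift:
  assumes "cylinder_measurable N F"
  shows "cylinder_measurable N (\<lambda>\<omega>. shift s (F \<omega>))"
  using assms unfolding cylinder_measurable_def by (simp add: extend_shift Pi_iff shift_paths)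

lemma limitin_shift:
  assumes F: "\<And>n. F n \<in> paths" and lim: "limitin (path_topology \<delta>) F f sequentially"
  shows "limitin (path_topology \<delta>) (\<lambda>n. shift s (F n)) (shift s f) sequentially"
proof -
  have fp: "f \<in> paths" and pd: "(\<lambda>n. path_dist \<delta> (F n) f) \<longlonglongrightarrow> 0"
    using lim by (simp_all add: limitin_path_topology_iff[OF F])
  have unif: "uniform_limit K (\<lambda>n. extend (F n)) (extend f) sequentially" if "compact K" for K
    using pd that path_dist_tendsto_iff[OF F fp] by auto
  have Fs: "shift s (F n) \<in> paths" for n by (rule shift_paths[OF F])
  have "(\<lambda>n. path_dist \<delta> (shift s (F n)) (shift s f)) \<longlonglongrightarrow> 0"
    unfolding path_dist_tendsto_iff[OF Fs shift_paths[OF fp]]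
  proof (intro conjI allI impI)
    fix K :: "real set" assume K: "compact K"
    have "compact ((\<lambda>t. s + max 0 t) ` K)"
      by (intro compact_continuous_image K continuous_intros)
    from unif[OF this] show "uniform_limit K (\<lambda>n. extend (shift s (F n))) (extend (shift s f)) sequentially"
      unfolding uniform_limit_iff extend_shift by simp
  qed simp
  then show ?thesis
    using shift_paths[OF fp] by (simp add: limitin_path_topology_iff[OF Fs])
qed

lemma path_dist_limit:
  assumes F: "\<And>n. F n \<in> paths" "limitin (path_topology \<delta>) F f sequentially"
    and G: "\<And>n. G n \<in> paths" "limitin (path_topology \<delta>) G g sequentially"
  shows "(\<lambda>n. path_dist \<delta> (F n) (G n)) \<longlonglongrightarrow> path_dist \<delta> f g"
proof -
  have f: "f \<in> paths" "(\<lambda>n. path_dist \<delta> (F n) f) \<longlonglongrightarrow> 0" using F(2) by (simp_all add: limitin_path_topology_iff[OF F(1)])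
  have g: "g \<in> paths" "(\<lambda>n. path_dist \<delta> (G n) g) \<longlonglongrightarrow> 0" using G(2) by (simp_all add: limitin_path_topology_iff[OF G(1)])
  have "(\<lambda>n. path_dist \<delta> (F n) (G n) - path_dist \<delta> f g) \<longlonglongrightarrow> 0"
  proof (rule Lim_null_comparison[OF always_eventually tendsto_add_zero[OF f(2) g(2)]], rule allI)
    fix n
    have "path_dist \<delta> (F n) (G n) \<le> path_dist \<delta> (F n) f + path_dist \<delta> f (G n)"
      "path_dist \<delta> f (G n) \<le> path_dist \<delta> f g + path_dist \<delta> g (G n)"
      "path_dist \<delta> f g \<le> path_dist \<delta> f (F n) + path_dist \<delta> (F n) g"
      "path_dist \<delta> (F n) g \<le> path_dist \<delta> (F n) (G n) + path_dist \<delta> (G n) g"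
      using F(1) G(1) f(1) g(1) by (auto intro: PM.triangle)
    then show "norm (path_dist \<delta> (F n) (G n) - path_dist \<delta> f g) \<le> path_dist \<delta> (F n) f + path_dist \<delta> (G n) g"
      by (simp add: PM.commute[of g "G n"] PM.commute[of f "F n"] abs_le_iff)
  qed
  then show ?thesis by (simp add: LIM_zero_iff)
qed

lemma cylinder_measurable_coord:
  assumes "i < n" shows "cylinder_measurable (Cpow n) (coord_path i :: _ \<Rightarrow> 'a path)"
  unfolding cylinder_measurable_def
proof (intro conjI allI)
  show "coord_path i \<in> space (Cpow n) \<rightarrow> (paths :: 'a path set)"
  proof
    fix w :: "real \<Rightarrow> nat \<Rightarrow> 'a" assume "w \<in> space (Cpow n)"
    then have "continuous_on {0..} (\<lambda>t. w t i)" using assms by (simp add: space_Cpow)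
    then have "continuous_on {0..} (\<lambda>t\<in>{0..}. w t i)"
      by (subst continuous_on_cong[OF refl, of _ _ "\<lambda>t. w t i"]) auto
    then show "coord_path i w \<in> paths" by (simp add: paths_iff coord_path_def)
  qed
  show "(\<lambda>w :: real \<Rightarrow> nat \<Rightarrow> 'a. fst (coord_path i w)) \<in> borel_measurable (Cpow n)"
    by (simp add: coord_path_def)
  fix t
  have "(\<lambda>w. w (max 0 t)) \<in> Cpow n \<rightarrow>\<^sub>M (Mpow n :: (nat \<Rightarrow> 'a) measure)"
    by (rule measurable_Cpow_eval) simp
  moreover have "(\<lambda>z. z i) \<in> (Mpow n :: (nat \<Rightarrow> 'a) measure) \<rightarrow>\<^sub>M borel"
    unfolding Mpow_def using assms by (intro measurable_component_singleton) simp
  ultimately have "(\<lambda>w. w (max 0 t) i) \<in> Cpow n \<rightarrow>\<^sub>M (borel :: 'a measure)"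
    by (rule measurable_compose)
  then show "(\<lambda>w. extend (coord_path i w) t) \<in> Cpow n \<rightarrow>\<^sub>M (borel :: 'a measure)"
    by (simp add: extend_def coord_path_def)
qed

end

context skeleton_flow
begin

lemma \<Psi>_past_measurable: "s \<le> t \<Longrightarrow> t \<le> u \<Longrightarrow> (\<lambda>\<omega>. extend (\<Psi> s x \<omega>) t) \<in> flow_algebra {..u} \<rightarrow>\<^sub>M borel"
  by (rule measurable_flow_algebraI[where z=x, OF \<Psi>_measurable \<Psi>_AE]) auto

lemma \<Psi>_future_measurable: "s \<le> t \<Longrightarrow> (\<lambda>\<omega>. extend (\<Psi> s x \<omega>) t) \<in> flow_algebra {s..} \<rightarrow>\<^sub>M borel"
  by (rule measurable_flow_algebraI[where z=x, OF \<Psi>_measurable \<Psi>_AE]) auto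

definition two_point_path :: "real \<Rightarrow> 'a \<Rightarrow> 'a \<Rightarrow> 'w \<Rightarrow> real \<Rightarrow> nat \<Rightarrow> 'a"
  where "two_point_path s x y \<omega> = (\<lambda>t\<in>{0..}. pair (extend (\<Psi> s x \<omega>) (s + t)) (extend (\<Psi> s y \<omega>) (s + t)))"

lemma coord_two_point_path:
  "coord_path 0 (two_point_path s x y \<omega>) = shift s (\<Psi> s x \<omega>)"
  "coord_path 1 (two_point_path s x y \<omega>) = shift s (\<Psi> s y \<omega>)"
  unfolding coord_path_def shift_def two_point_path_def by (auto simp: pair_apply)

lemma two_point_path_measurable: "two_point_path s x y \<in> \<Omega> \<rightarrow>\<^sub>M Cpow 2"
  unfolding Cpow_def
proof (rule measurable_restrict_space2)
  show "two_point_path s x y \<in> \<Omega> \<rightarrow>\<^sub>M PiM {0..} (\<lambda>_. Mpow 2)"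
    unfolding two_point_path_def
    by (rule measurable_restrict) (intro pair_measurable \<Psi>_measurable)
  show "two_point_path s x y \<in> space \<Omega> \<rightarrow> {w. continuous_map (top_of_set {0..}) (Mpow_top 2) w}"
  proof
    fix \<omega> assume \<omega>: "\<omega> \<in> space \<Omega>"
    have "continuous_on {0..} (\<lambda>t. extend (\<Psi> s z \<omega>) (s + t))" for z
      using continuous_on_extend[OF \<Psi>_paths[OF \<omega>]]
      by (rule continuous_on_compose2) (auto intro!: continuous_intros)
    then have c: "continuous_on {0..} (\<lambda>t. if i = 0 then extend (\<Psi> s x \<omega>) (s + t) else extend (\<Psi> s y \<omega>) (s + t))" for i :: nat
      by (cases "i = 0") simp_all
    have "continuous_on {0..} (\<lambda>t. two_point_path s x y \<omega> t i)" if "i < 2" for i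
      using c[of i] by (rule continuous_on_eq) (use that in \<open>simp add: two_point_path_def pair_def\<close>)
    then show "two_point_path s x y \<omega> \<in> {w. continuous_map (top_of_set {0..}) (Mpow_top 2) w}"
      unfolding Mpow_top_def continuous_map_componentwise mem_Collect_eq
      by (auto simp: two_point_path_def pair_def)
  qed
qed

text \<open>The modifications satisfy the two-point Markov property because the flow does. The left
  side does not involve \<open>s\<close>: the transition functions are homogeneous in time, so any
  starting time realises the same law.\<close>

lemma two_point_path_law: "path_law P 2 (pair x y) = distr \<Omega> (Cpow 2) (two_point_path s x y)"
proof (rule path_law_eqI[where P=P, OF feller2], rule is_path_lawI[where P=P, OF feller2])
  note m = two_point_path_measurable[of s x y]
  show "prob_space (distr \<Omega> (Cpow 2) (two_point_path s x y))" by (rule prob_space_distr[OF m])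
  show "sets (distr \<Omega> (Cpow 2) (two_point_path s x y)) = sets (Cpow 2)" by simp
  have "AE \<omega> in \<Omega>. two_point_path s x y \<omega> 0 = pair x y"
    using \<Psi>_AE[OF order_refl, of s x] \<Psi>_AE[OF order_refl, of s y] AE_space
    by eventually_elim (simp add: two_point_path_def \<psi>_refl)
  moreover have "{w\<in>space (Cpow 2). w 0 = pair x y} \<in> sets (Cpow 2)"
  proof -
    have "pair x y \<in> extensional {..<2}" by (simp add: pair_def)
    then have "{pair x y} = PiE {..<2} (\<lambda>i. {pair x y i})" by (rule PiE_singleton[symmetric])
    also have "\<dots> \<in> sets (Mpow 2)"
      unfolding Mpow_def by (rule sets_PiM_I_finite) simp_all
    finally have "(\<lambda>w. w 0) -` {pair x y} \<inter> space (Cpow 2) \<in> sets (Cpow 2)"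
      by (rule measurable_sets[OF measurable_Cpow_eval[OF order_refl]])
    then show ?thesis
      by (rule back_subst[where P="\<lambda>S. S \<in> sets (Cpow 2)"]) auto
  qed
  ultimately show "AE w in distr \<Omega> (Cpow 2) (two_point_path s x y). w 0 = pair x y"
    by (subst AE_distr_iff[OF m]) auto
next
  note m = two_point_path_measurable[of s x y]
  fix a t :: real and K :: "real set" and A :: "real \<Rightarrow> (nat \<Rightarrow> 'a) set" and B :: "(nat \<Rightarrow> 'a) set"
  assume a: "0 \<le> a" and t: "0 \<le> t" and K: "finite K" "K \<subseteq> {0..a}" "\<forall>u\<in>K. A u \<in> sets (Mpow 2)" and B: "B \<in> sets (Mpow 2)"
  define C where "C = {\<omega>\<in>space \<Omega>. \<forall>u\<in>K. pair (extend (\<Psi> s x \<omega>) (s + u)) (extend (\<Psi> s y \<omega>) (s + u)) \<in> A u}"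
  have C: "C \<in> sets (flow_algebra {..s + a})"
  proof -
    have "{\<omega>\<in>space (flow_algebra {..s + a}). \<forall>u\<in>K. pair (extend (\<Psi> s x \<omega>) (s + u)) (extend (\<Psi> s y \<omega>) (s + u)) \<in> A u} \<in> sets (flow_algebra {..s + a})"
    proof (rule sets.sets_Collect_finite_All)
      fix u assume u: "u \<in> K"
      then have u': "0 \<le> u" "u \<le> a" and Au: "A u \<in> sets (Mpow 2)" using K by auto
      have "(\<lambda>\<omega>. pair (extend (\<Psi> s x \<omega>) (s + u)) (extend (\<Psi> s y \<omega>) (s + u))) \<in> flow_algebra {..s + a} \<rightarrow>\<^sub>M Mpow 2"
        using u' by (intro pair_measurable \<Psi>_past_measurable) auto
      from measurable_sets[OF this Au] show "{\<omega>\<in>space (flow_algebra {..s + a}). pair (extend (\<Psi> s x \<omega>) (s + u)) (extend (\<Psi> s y \<omega>) (s + u)) \<in> A u} \<in> sets (flow_algebra {..s + a})"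
        by (simp add: vimage_def Int_def conj_commute)
    qed (rule K)
    then show ?thesis by (simp add: C_def)
  qed
  then have Cev: "C \<in> events" using flow_algebra_events by blast
  have Kcyl: "finite K" "K \<subseteq> {0..}" "\<forall>u\<in>K. A u \<in> sets (Mpow 2)" using K by auto
  have cyl: "two_point_path s x y \<omega> \<in> cylinder 2 K A \<longleftrightarrow> \<omega> \<in> C" if \<omega>: "\<omega> \<in> space \<Omega>" for \<omega>
  proof -
    have "(\<forall>u\<in>K. two_point_path s x y \<omega> u \<in> A u) \<longleftrightarrow>
        (\<forall>u\<in>K. pair (extend (\<Psi> s x \<omega>) (s + u)) (extend (\<Psi> s y \<omega>) (s + u)) \<in> A u)"
      using K(2) by (intro ball_cong refl) (auto simp: two_point_path_def)
    then show ?thesis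
      using measurable_space[OF m \<omega>] \<omega> by (simp add: cylinder_def C_def)
  qed
  \<comment> \<open>The state after time \<open>a\<close>, measurable for the past of
    \<open>s + a\<close>. The state after a further time \<open>t\<close> is almost surely
    \<open>J\<close> applied to it, the form required by \<open>two_point_markov\<close>.\<close>
  define X' where "X' z \<omega> = extend (\<Psi> s z \<omega>) (s + a)" for z \<omega>
  have X': "X' z \<in> flow_algebra {..s + a} \<rightarrow>\<^sub>M borel" for z
    unfolding X'_def using a by (intro \<Psi>_past_measurable) auto
  have "AE \<omega> in \<Omega>. extend (\<Psi> s z \<omega>) (s + (a + t)) = J t (\<psi> (s + a) (s + a + t) \<omega>) (X' z \<omega>)" for z
  proof -
    have "AE \<omega> in \<Omega>. extend (\<Psi> s z \<omega>) (s + (a + t)) = \<psi> s (s + (a + t)) \<omega> z" using a t by (intro \<Psi>_AE) auto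
    moreover have "AE \<omega> in \<Omega>. extend (\<Psi> s z \<omega>) (s + a) = \<psi> s (s + a) \<omega> z" using a by (intro \<Psi>_AE) auto
    moreover have "AE \<omega> in \<Omega>. \<psi> s (s + a + t) \<omega> z = J (s + a + t - (s + a)) (\<psi> (s + a) (s + a + t) \<omega>) (\<psi> s (s + a) \<omega> z)"
      using a t by (intro J_compose) auto
    ultimately show ?thesis by eventually_elim (simp add: X'_def add.assoc)
  qed
  note step = this
  have cylm: "cylinder 2 K A \<in> sets (Cpow 2)" by (rule cylinder_sets[OF Kcyl])
  have set1: "{w\<in>cylinder 2 K A. w (a + t) \<in> B} \<in> sets (Cpow 2)"
  proof -
    have "{w\<in>cylinder 2 K A. w (a + t) \<in> B} = cylinder 2 K A \<inter> ((\<lambda>w. w (a + t)) -` B \<inter> space (Cpow 2))"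
      by (auto simp: cylinder_def)
    then show ?thesis
      using cylm measurable_sets[OF measurable_Cpow_eval B, of "a + t"] a t by auto
  qed
  have "emeasure (distr \<Omega> (Cpow 2) (two_point_path s x y)) {w\<in>cylinder 2 K A. w (a + t) \<in> B}
      = emeasure \<Omega> (two_point_path s x y -` {w\<in>cylinder 2 K A. w (a + t) \<in> B} \<inter> space \<Omega>)"
    by (rule emeasure_distr[OF m set1])
  also have "\<dots> = emeasure \<Omega> {\<omega>\<in>C. pair (J (s + a + t - (s + a)) (\<psi> (s + a) (s + a + t) \<omega>) (X' x \<omega>))
      (J (s + a + t - (s + a)) (\<psi> (s + a) (s + a + t) \<omega>) (X' y \<omega>)) \<in> B}"
  proof (rule emeasure_eq_AE)
    show "AE \<omega> in \<Omega>. \<omega> \<in> two_point_path s x y -` {w\<in>cylinder 2 K A. w (a + t) \<in> B} \<inter> space \<Omega> \<longleftrightarrow>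
      \<omega> \<in> {\<omega>\<in>C. pair (J (s + a + t - (s + a)) (\<psi> (s + a) (s + a + t) \<omega>) (X' x \<omega>))
      (J (s + a + t - (s + a)) (\<psi> (s + a) (s + a + t) \<omega>) (X' y \<omega>)) \<in> B}"
      using step[of x] step[of y] AE_space
    proof eventually_elim
      case (elim \<omega>)
      have "two_point_path s x y \<omega> (a + t) = pair (J t (\<psi> (s + a) (s + a + t) \<omega>) (X' x \<omega>)) (J t (\<psi> (s + a) (s + a + t) \<omega>) (X' y \<omega>))"
        using a t by (simp add: two_point_path_def elim(1,2))
      then show ?case using cyl[OF elim(3)] elim(3) by simp
    qed
    show "two_point_path s x y -` {w\<in>cylinder 2 K A. w (a + t) \<in> B} \<inter> space \<Omega> \<in> events"
      by (rule measurable_sets[OF m set1])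
    have "(\<lambda>\<omega>. pair (J (s + a + t - (s + a)) (\<psi> (s + a) (s + a + t) \<omega>) (X' x \<omega>)) (J (s + a + t - (s + a)) (\<psi> (s + a) (s + a + t) \<omega>) (X' y \<omega>))) \<in> \<Omega> \<rightarrow>\<^sub>M Mpow 2"
      using t by (intro pair_measurable J_measurable_compose \<psi>_measurable measurable_from_flow_algebra[OF X']) auto
    from sets.Int[OF Cev measurable_sets[OF this B]]
    show "{\<omega>\<in>C. pair (J (s + a + t - (s + a)) (\<psi> (s + a) (s + a + t) \<omega>) (X' x \<omega>))
      (J (s + a + t - (s + a)) (\<psi> (s + a) (s + a + t) \<omega>) (X' y \<omega>)) \<in> B} \<in> events"
      by (rule back_subst[where P="\<lambda>S. S \<in> events"]) (auto simp: C_def)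
  qed
  also have "\<dots> = (\<integral>\<^sup>+\<omega>\<in>C. emeasure (P 2 (s + a + t - (s + a)) (pair (X' x \<omega>) (X' y \<omega>))) B \<partial>\<Omega>)"
    using t by (intro two_point_markov C B X') simp
  also have "\<dots> = (\<integral>\<^sup>+\<omega>. emeasure (P 2 t (two_point_path s x y \<omega> a)) B * indicator (cylinder 2 K A) (two_point_path s x y \<omega>) \<partial>\<Omega>)"
  proof (rule nn_integral_cong)
    fix \<omega> assume "\<omega> \<in> space \<Omega>"
    then show "emeasure (P 2 (s + a + t - (s + a)) (pair (X' x \<omega>) (X' y \<omega>))) B * indicator C \<omega>
      = emeasure (P 2 t (two_point_path s x y \<omega> a)) B * indicator (cylinder 2 K A) (two_point_path s x y \<omega>)"
      using cyl a by (simp add: indicator_def two_point_path_def X'_def)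
  qed
  also have "\<dots> = (\<integral>\<^sup>+w\<in>cylinder 2 K A. emeasure (P 2 t (w a)) B \<partial>distr \<Omega> (Cpow 2) (two_point_path s x y))"
  proof (rule nn_integral_distr[OF m, symmetric])
    have "(\<lambda>w. emeasure (P 2 t (w a)) B) \<in> borel_measurable (Cpow 2)"
      by (rule measurable_compose[OF measurable_Cpow_eval[OF a] kernel_measurable[where P=P, OF feller2 t B]])
    then show "(\<lambda>w. emeasure (P 2 t (w a)) B * indicator (cylinder 2 K A) w) \<in> borel_measurable (distr \<Omega> (Cpow 2) (two_point_path s x y))"
      using cylm by (simp add: borel_measurable_times_ennreal borel_measurable_indicator)
  qed
  finally show "emeasure (distr \<Omega> (Cpow 2) (two_point_path s x y)) {w\<in>cylinder 2 K A. w (a + t) \<in> B}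
    = (\<integral>\<^sup>+w\<in>cylinder 2 K A. emeasure (P 2 t (w a)) B \<partial>distr \<Omega> (Cpow 2) (two_point_path s x y))" .
qed

definition \<Psi>_dist :: "real \<Rightarrow> 'a \<Rightarrow> 'a \<Rightarrow> 'w \<Rightarrow> real"
  where "\<Psi>_dist s x y \<omega> = path_dist \<delta> (shift s (\<Psi> s x \<omega>)) (shift s (\<Psi> s y \<omega>))"

lemma \<Psi>_dist_measurable: "\<Psi>_dist s x y \<in> borel_measurable \<Omega>"
  unfolding \<Psi>_dist_def by (intro measurable_path_dist cylinder_measurable_shift \<Psi>_cylinder)

text \<open>The starting time \<open>s\<close> is free. Time 0 serves for properties of the function
  itself, while a general \<open>s\<close> is needed where the future after \<open>s\<close> has to
  be independent of the past.\<close>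

lemma separation_prob_eq:
  "separation_prob P \<delta> k x y = prob {\<omega>\<in>space \<Omega>. 1 / 2 ^ k \<le> \<Psi>_dist s x y \<omega>}"
proof -
  have [measurable]: "(\<lambda>w. path_dist \<delta> (coord_path 0 w) (coord_path 1 w)) \<in> borel_measurable (Cpow 2)"
    by (intro measurable_path_dist cylinder_measurable_coord) simp_all
  have "{w\<in>space (Cpow 2). 1 / 2 ^ k \<le> path_dist \<delta> (coord_path 0 w) (coord_path 1 w)} \<in> sets (Cpow 2)"
    by measurable
  then have "separation_prob P \<delta> k x y =
    prob (two_point_path s x y -` {w\<in>space (Cpow 2). 1 / 2 ^ k \<le> path_dist \<delta> (coord_path 0 w) (coord_path 1 w)} \<inter> space \<Omega>)"
    unfolding separation_prob_def two_point_path_law[of x y s]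
    by (rule measure_distr[OF two_point_path_measurable])
  also have "two_point_path s x y -` {w\<in>space (Cpow 2). 1 / 2 ^ k \<le> path_dist \<delta> (coord_path 0 w) (coord_path 1 w)} \<inter> space \<Omega>
      = {\<omega>\<in>space \<Omega>. 1 / 2 ^ k \<le> \<Psi>_dist s x y \<omega>}"
    using measurable_space[OF two_point_path_measurable[of s x y]]
    by (auto simp: coord_two_point_path[unfolded One_nat_def] \<Psi>_dist_def)
  finally show ?thesis .
qed

lemma separation_prob_le_1: "separation_prob P \<delta> k x y \<le> 1"
  by (simp add: separation_prob_eq[of _ _ _ 0])

lemma separation_prob_refl: "separation_prob P \<delta> k x x = 0"
proof -
  have "{\<omega>\<in>space \<Omega>. 1 / 2 ^ k \<le> \<Psi>_dist 0 x x \<omega>} = {}"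
    using shift_paths[OF \<Psi>_paths] by (auto simp: \<Psi>_dist_def not_le)
  then show ?thesis unfolding separation_prob_eq[of _ _ _ 0] by (simp only: measure_empty)
qed

text \<open>Along a common subsequence the distances converge almost surely. If they are at least
  2^-k infinitely often, so is their limit, and continuity from above on the decreasing events
  \<open>E m\<close> preserves the lower bound \<open>c\<close>.\<close>

lemma separation_prob_usc:
  assumes x: "x \<longlonglongrightarrow> x'" and y: "y \<longlonglongrightarrow> y'" and c: "\<And>j. c \<le> separation_prob P \<delta> k (x j) (y j)"
  shows "c \<le> separation_prob P \<delta> k x' y'"
proof -
  obtain r :: "nat \<Rightarrow> nat" where r: "strict_mono r" "AE \<omega> in \<Omega>. limitin (path_topology \<delta>) (\<lambda>j. \<Psi> 0 (x (r j)) \<omega>) (\<Psi> 0 x' \<omega>) sequentially"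
    using \<Psi>_continuous[OF x, of 0] by blast
  have "(\<lambda>j. y (r j)) \<longlonglongrightarrow> y'" using LIMSEQ_subseq_LIMSEQ[OF y r(1)] by (simp add: o_def)
  from \<Psi>_continuous[OF this, of 0] obtain q :: "nat \<Rightarrow> nat" where q: "strict_mono q"
    "AE \<omega> in \<Omega>. limitin (path_topology \<delta>) (\<lambda>j. \<Psi> 0 (y (r (q j))) \<omega>) (\<Psi> 0 y' \<omega>) sequentially"
    by blast
  define D where "D j \<omega> = \<Psi>_dist 0 (x (r (q j))) (y (r (q j))) \<omega>" for j \<omega>
  have D_lim: "AE \<omega> in \<Omega>. (\<lambda>j. D j \<omega>) \<longlonglongrightarrow> \<Psi>_dist 0 x' y' \<omega>"
    using r(2) q(2) AE_space
  proof eventually_elim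
    case (elim \<omega>)
    have "limitin (path_topology \<delta>) (\<lambda>j. \<Psi> 0 (x (r (q j))) \<omega>) (\<Psi> 0 x' \<omega>) sequentially"
      using limitin_subsequence[OF q(1) elim(1)] by (simp add: o_def)
    then show ?case
      unfolding D_def \<Psi>_dist_def
      by (intro path_dist_limit limitin_shift shift_paths \<Psi>_paths elim)
  qed
  have sep: "prob {\<omega>\<in>space \<Omega>. 1 / 2 ^ k \<le> D j \<omega>} \<ge> c" for j
    using c[of "r (q j)"] by (simp add: D_def separation_prob_eq[of _ _ _ 0])
  have Dm [measurable]: "D j \<in> borel_measurable \<Omega>" for j unfolding D_def by (rule \<Psi>_dist_measurable)
  have Dm' [measurable]: "\<Psi>_dist 0 x' y' \<in> borel_measurable \<Omega>" by (rule \<Psi>_dist_measurable)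
  define E where "E m = {\<omega>\<in>space \<Omega>. \<exists>j\<ge>m. 1 / 2 ^ k \<le> D j \<omega>}" for m
  have E: "E m \<in> events" for m unfolding E_def by measurable
  have "decseq E" unfolding decseq_def E_def by (blast intro: order_trans)
  then have "(\<lambda>m. prob (E m)) \<longlonglongrightarrow> prob (\<Inter>m. E m)"
    using E by (intro finite_Lim_measure_decseq) auto
  moreover have "c \<le> prob (E m)" for m
  proof -
    have "prob {\<omega>\<in>space \<Omega>. 1 / 2 ^ k \<le> D m \<omega>} \<le> prob (E m)"
      using E by (intro finite_measure_mono) (auto simp: E_def)
    then show ?thesis using sep[of m] by simp
  qed
  ultimately have "c \<le> prob (\<Inter>m. E m)" by (intro LIMSEQ_le_const) auto
  also have "\<dots> \<le> prob {\<omega>\<in>space \<Omega>. 1 / 2 ^ k \<le> \<Psi>_dist 0 x' y' \<omega>}"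
  proof (rule finite_measure_mono_AE)
    show "AE \<omega> in \<Omega>. \<omega> \<in> (\<Inter>m. E m) \<longrightarrow> \<omega> \<in> {\<omega>\<in>space \<Omega>. 1 / 2 ^ k \<le> \<Psi>_dist 0 x' y' \<omega>}"
      using D_lim AE_space
    proof eventually_elim
      case (elim \<omega>)
      show ?case
      proof
        assume "\<omega> \<in> (\<Inter>m. E m)"
        then have inf: "\<And>m. \<exists>j\<ge>m. 1 / 2 ^ k \<le> D j \<omega>" by (simp add: E_def)
        have "1 / 2 ^ k \<le> \<Psi>_dist 0 x' y' \<omega>"
        proof (rule ccontr)
          assume "\<not> ?thesis"
          then have "\<forall>\<^sub>F j in sequentially. D j \<omega> < 1 / 2 ^ k"
            by (intro order_tendstoD(2)[OF elim(1)]) simp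
          then show False using inf by (meson eventually_sequentially not_le)
        qed
        then show "\<omega> \<in> {\<omega>\<in>space \<Omega>. 1 / 2 ^ k \<le> \<Psi>_dist 0 x' y' \<omega>}" using elim(2) by simp
      qed
    qed
  qed measurable
  finally show ?thesis by (simp add: separation_prob_eq[of _ _ _ 0])
qed

section \<open>Positivity and measurability of the radii\<close>

lemma sup_separation_greater_iff:
  assumes "0 < r"
  shows "1 / 2 ^ k < (SUP y\<in>cball x r. separation_prob P \<delta> k x y) \<longleftrightarrow>
    (\<exists>y\<in>cball x r. 1 / 2 ^ k < separation_prob P \<delta> k x y)"
  by (rule less_cSUP_iff) (use assms in \<open>auto intro!: bdd_aboveI[of _ 1] separation_prob_le_1\<close>)

text \<open>For \<open>a\<close> up to the cap 2^-k the minimum in \<open>eps\<close> plays no part,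
  and the condition on radii becomes one on single points \<open>y\<close>. This removes the
  supremum and the infimum from all later arguments.\<close>

lemma eps_less_iff:
  assumes a: "a \<le> 1 / 2 ^ k"
  shows "eps P \<delta> k x < a \<longleftrightarrow> (\<exists>y. dist x y < a \<and> 1 / 2 ^ k < separation_prob P \<delta> k x y)"
proof -
  define R where "R = {r. r > 0 \<and> (SUP y\<in>cball x r. separation_prob P \<delta> k x y) > 1 / 2 ^ k}"
  have R: "R = {r. r > 0 \<and> (\<exists>y\<in>cball x r. 1 / 2 ^ k < separation_prob P \<delta> k x y)}"
    unfolding R_def using sup_separation_greater_iff by blast
  define I where "I = (INF r\<in>R. ereal r)"
  have I0: "0 \<le> I" unfolding I_def by (rule INF_greatest) (auto simp: R_def)
  have "eps P \<delta> k x = real_of_ereal (min (ereal (1 / 2 ^ k)) I)"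
    by (simp add: eps_def I_def R_def)
  then have "eps P \<delta> k x < a \<longleftrightarrow> I < ereal a"
    using I0 a by (cases I) (auto simp: min_def)
  also have "\<dots> \<longleftrightarrow> (\<exists>r\<in>R. r < a)" by (simp add: I_def INF_less_iff)
  also have "\<dots> \<longleftrightarrow> (\<exists>y. dist x y < a \<and> 1 / 2 ^ k < separation_prob P \<delta> k x y)"
  proof
    assume "\<exists>r\<in>R. r < a"
    then obtain r y where "r < a" "y \<in> cball x r" "1 / 2 ^ k < separation_prob P \<delta> k x y"
      unfolding R by blast
    then show "\<exists>y. dist x y < a \<and> 1 / 2 ^ k < separation_prob P \<delta> k x y"
      by (intro exI[of _ y]) auto
  next
    assume "\<exists>y. dist x y < a \<and> 1 / 2 ^ k < separation_prob P \<delta> k x y"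
    then obtain y where y: "dist x y < a" "1 / 2 ^ k < separation_prob P \<delta> k x y" by blast
    \<comment> \<open>The witnessing radius is \<open>dist x y\<close>, which must be positive; the
      separation probability vanishes on the diagonal.\<close>
    have "x \<noteq> y" using y(2) separation_prob_refl[of k x] by (auto simp: not_less)
    then have "dist x y \<in> R" unfolding R using y(2) by auto
    with y(1) show "\<exists>r\<in>R. r < a" by blast
  qed
  finally show ?thesis .
qed

text \<open>A radius 0 would give points tending to \<open>x\<close> with separation probability
  above 2^-k; by upper semicontinuity the bound would persist at \<open>x\<close> itself, where the
  probability is 0.\<close>

lemma eps_pos: "0 < eps P \<delta> k x"
proof (rule ccontr)
  assume "\<not> ?thesis"
  then have le: "eps P \<delta> k x \<le> 0" by simp
  have "\<exists>y. dist x y < inverse (real (Suc j)) \<and> 1 / 2 ^ k < separation_prob P \<delta> k x y" for j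
  proof -
    have "0 < min (inverse (real (Suc j))) (1 / 2 ^ k)" by simp
    then have "eps P \<delta> k x < min (inverse (real (Suc j))) (1 / 2 ^ k)" using le by linarith
    then show ?thesis using eps_less_iff[of "min (inverse (real (Suc j))) (1 / 2 ^ k)" k x] by auto
  qed
  then obtain y where y: "\<And>j. dist x (y j) < inverse (real (Suc j))" "\<And>j. 1 / 2 ^ k < separation_prob P \<delta> k x (y j)"
    by metis
  have "(\<lambda>j. dist (y j) x) \<longlonglongrightarrow> 0"
    by (rule Lim_null_comparison[OF _ LIMSEQ_inverse_real_of_nat])
      (use y(1) in \<open>auto intro!: always_eventually less_imp_le simp: dist_commute\<close>)
  then have "y \<longlonglongrightarrow> x" by (rule tendsto_dist_iff[THEN iffD2])
  from separation_prob_usc[OF tendsto_const[of x] this, of "1 / 2 ^ k" k] y(2)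
  have "1 / 2 ^ k \<le> separation_prob P \<delta> k x x" by (simp add: less_imp_le)
  moreover have "(0::real) < 1 / 2 ^ k" by simp
  ultimately show False by (simp only: separation_prob_refl)
qed

text \<open>The case \<open>a = eps P \<delta> k x\<close> of \<open>eps_less_iff\<close>: its left
  side is false, so no point in the open ball has larger separation probability.\<close>

lemma separation_prob_ball:
  assumes "dist x y < eps P \<delta> k x"
  shows "separation_prob P \<delta> k x y \<le> 1 / 2 ^ k"
  using eps_less_iff[OF eps_le[of P \<delta> k x], where x=x] assms by (meson less_irrefl not_le)

text \<open>The sublevel sets of \<open>eps\<close> are projections of \<open>\<sigma>\<close>-compact sets.\<close>

lemma eps_measurable: "eps P \<delta> k \<in> borel_measurable borel"
proof (rule borel_measurableI_less)
  fix a
  show "{x\<in>space borel. eps P \<delta> k x < a} \<in> sets borel"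
  proof (cases "a \<le> 1 / 2 ^ k")
    case False
    then have "{x\<in>space borel. eps P \<delta> k x < a} = UNIV"
      using eps_le[of P \<delta> k] by (auto simp: not_le intro: le_less_trans)
    then show ?thesis by simp
  next
    case True
    \<comment> \<open>The strict inequalities are replaced by weak ones with margin 1/(j+1), which
      upper semicontinuity makes closed; the ball makes the set compact.\<close>
    define F where "F j = {p \<in> cball undefined (real j). dist (fst p) (snd p) \<le> a - inverse (real (Suc j)) \<and>
        1 / 2 ^ k + inverse (real (Suc j)) \<le> separation_prob P \<delta> k (fst p) (snd p)}" for j
    have "compact (F j)" for j
    proof -
      have "closed {p. 1 / 2 ^ k + inverse (real (Suc j)) \<le> separation_prob P \<delta> k (fst p) (snd p)}"
        unfolding closed_sequential_limits
      proof (intro allI impI, elim conjE)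
        fix p l assume p: "\<forall>n. p n \<in> {p. 1 / 2 ^ k + inverse (real (Suc j)) \<le> separation_prob P \<delta> k (fst p) (snd p)}" "p \<longlonglongrightarrow> l"
        have "1 / 2 ^ k + inverse (real (Suc j)) \<le> separation_prob P \<delta> k (fst l) (snd l)"
          by (rule separation_prob_usc[OF tendsto_fst[OF p(2)] tendsto_snd[OF p(2)]]) (use p(1) in simp)
        then show "l \<in> {p. 1 / 2 ^ k + inverse (real (Suc j)) \<le> separation_prob P \<delta> k (fst p) (snd p)}" by simp
      qed
      moreover have "closed {p :: 'a \<times> 'a. dist (fst p) (snd p) \<le> a - inverse (real (Suc j))}"
        by (intro closed_Collect_le continuous_intros)
      ultimately have "compact (cball undefined (real j) \<inter> ({p. dist (fst p) (snd p) \<le> a - inverse (real (Suc j))} \<inter>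
        {p. 1 / 2 ^ k + inverse (real (Suc j)) \<le> separation_prob P \<delta> k (fst p) (snd p)}))"
        by (intro compact_Int_closed closed_Int) auto
      then show ?thesis by (rule back_subst[where P=compact]) (auto simp: F_def)
    qed
    then have "compact (fst ` F j)" for j
      by (intro compact_continuous_image continuous_intros)
    then have "(\<Union>j. fst ` F j) \<in> sets borel"
      by (intro sets.countable_UN'') (auto intro: borel_compact)
    also have "(\<Union>j. fst ` F j) = {x\<in>space borel. eps P \<delta> k x < a}"
    proof (intro set_eqI iffI)
      fix x assume "x \<in> (\<Union>j. fst ` F j)"
      then obtain j y where "(x, y) \<in> F j" by auto
      then have 1: "dist x y \<le> a - inverse (real (Suc j))"
        and 2: "1 / 2 ^ k + inverse (real (Suc j)) \<le> separation_prob P \<delta> k x y"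
        by (simp_all add: F_def del: of_nat_Suc)
      have "0 < inverse (real (Suc j))" by simp
      with 1 2 have "dist x y < a" "1 / 2 ^ k < separation_prob P \<delta> k x y" by linarith+
      then show "x \<in> {x\<in>space borel. eps P \<delta> k x < a}" using eps_less_iff[OF True] by auto
    next
      fix x assume "x \<in> {x\<in>space borel. eps P \<delta> k x < a}"
      then obtain y where y: "dist x y < a" "1 / 2 ^ k < separation_prob P \<delta> k x y"
        using eps_less_iff[OF True] by auto
      have ev: "\<forall>\<^sub>F j in sequentially. inverse (real (Suc j)) < c" if "c > 0" for c
        by (rule order_tendstoD(2)[OF LIMSEQ_inverse_real_of_nat that])
      obtain m where m: "dist undefined (x, y) \<le> real m" using real_arch_simple by blast
      have "\<forall>\<^sub>F j in sequentially. dist undefined (x, y) \<le> real j"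
        using eventually_ge_at_top[of m]
      proof eventually_elim
        case (elim j)
        then have "real m \<le> real j" by simp
        with m show ?case by (rule order_trans)
      qed
      moreover have "\<forall>\<^sub>F j in sequentially. inverse (real (Suc j)) < a - dist x y"
        by (rule ev) (use y in simp)
      moreover have "\<forall>\<^sub>F j in sequentially. inverse (real (Suc j)) < separation_prob P \<delta> k x y - 1 / 2 ^ k"
        by (rule ev) (use y in simp)
      ultimately have "\<forall>\<^sub>F j in sequentially. (x, y) \<in> F j"
        by eventually_elim (simp add: F_def)
      then obtain j where "(x, y) \<in> F j" using eventually_happens'[OF sequentially_bot] by blast
      then show "x \<in> (\<Union>j. fst ` F j)" by force
    qed
    finally show ?thesis .
  qed
qed

end

section \<open>The modification property\<close>

context skeleton_flow
begin

lemma \<Phi>_past_measurable: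
  assumes "S n \<le> s"
  shows "(\<lambda>\<omega>. snd (\<Phi> \<omega> n) s) \<in> flow_algebra {..s} \<rightarrow>\<^sub>M borel"
  by (rule measurable_flow_algebraI[OF \<Phi>_snd_measurable[OF assms] \<Phi>_AE[OF assms]]) (use assms in auto)

lemma \<Psi>_dist_future_measurable: "\<Psi>_dist s x y \<in> borel_measurable (flow_algebra {s..})"
proof -
  have "cylinder_measurable (flow_algebra {s..}) (\<lambda>\<omega>. shift s (\<Psi> s z \<omega>))" for z
    unfolding cylinder_measurable_def extend_shift
    by (simp add: Pi_iff shift_paths \<Psi>_paths \<Psi>_future_measurable)
  then show ?thesis unfolding \<Psi>_dist_def by (intro measurable_path_dist)
qed

text \<open>No realisation of the flow need be continuous in space. For a frozen past the starting
  points are constants, so \<open>flow_space_continuous\<close> applies to each sample, and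
  dominated convergence integrates over the past.\<close>

lemma flow_composed_convergence:
  assumes st: "s \<le> t" and Y: "Y \<in> flow_algebra {..s} \<rightarrow>\<^sub>M borel"
    and Yj: "\<And>j. Y' j \<in> flow_algebra {..s} \<rightarrow>\<^sub>M borel"
    and lim: "\<And>\<omega>. \<omega> \<in> space \<Omega> \<Longrightarrow> (\<lambda>j. Y' j \<omega>) \<longlonglongrightarrow> Y \<omega>"
  shows "(\<lambda>j. sq_diff i (\<lambda>\<omega>. J (t - s) (\<psi> s t \<omega>) (Y' j \<omega>)) (\<lambda>\<omega>. J (t - s) (\<psi> s t \<omega>) (Y \<omega>))) \<longlonglongrightarrow> 0"
proof -
  define h where "h j p = ennreal ((bump i (J (t - s) (snd p) (Y' j (fst p))) - bump i (J (t - s) (snd p) (Y (fst p))))\<^sup>2)"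
    for j :: nat and p :: "'w \<times> ('a \<Rightarrow> 'a)"
  define H where "H j \<omega> = (\<integral>\<^sup>+\<omega>'. h j (\<omega>, \<psi> s t \<omega>') \<partial>\<Omega>)" for j \<omega>
  have Jm: "(\<lambda>p. J (t - s) (snd p) (Z (fst p))) \<in> flow_algebra {..s} \<Otimes>\<^sub>M Fspace \<rightarrow>\<^sub>M borel"
    if "Z \<in> flow_algebra {..s} \<rightarrow>\<^sub>M borel" for Z
    using st by (intro J_measurable_compose measurable_snd measurable_compose[OF measurable_fst that]) auto
  have h: "h j \<in> borel_measurable (flow_algebra {..s} \<Otimes>\<^sub>M Fspace)" for j
    unfolding h_def
    by (intro measurable_compose[OF _ measurable_ennreal] borel_measurable_power borel_measurable_diff
        measurable_compose[OF Jm[OF Yj] bump_measurable] measurable_compose[OF Jm[OF Y] bump_measurable])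
  have J\<Omega>: "(\<lambda>\<omega>. J (t - s) (\<psi> s t \<omega>) (Z \<omega>)) \<in> borel_measurable \<Omega>"
    if "Z \<in> flow_algebra {..s} \<rightarrow>\<^sub>M borel" for Z
    using st by (intro J_measurable_compose \<psi>_measurable measurable_from_flow_algebra[OF that]) auto
  have H_eq: "H j \<omega> = ennreal (sq_diff i (\<lambda>\<omega>'. \<psi> s t \<omega>' (Y' j \<omega>)) (\<lambda>\<omega>'. \<psi> s t \<omega>' (Y \<omega>)))" for j \<omega>
  proof -
    have "H j \<omega> = (\<integral>\<^sup>+\<omega>'. ennreal ((bump i (\<psi> s t \<omega>' (Y' j \<omega>)) - bump i (\<psi> s t \<omega>' (Y \<omega>)))\<^sup>2) \<partial>\<Omega>)"
      unfolding H_def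
    proof (rule nn_integral_cong_AE)
      show "AE \<omega>' in \<Omega>. h j (\<omega>, \<psi> s t \<omega>') = ennreal ((bump i (\<psi> s t \<omega>' (Y' j \<omega>)) - bump i (\<psi> s t \<omega>' (Y \<omega>)))\<^sup>2)"
        using J_AE[OF st, of "Y' j \<omega>"] J_AE[OF st, of "Y \<omega>"] by eventually_elim (simp add: h_def)
    qed
    also have "\<dots> = ennreal (sq_diff i (\<lambda>\<omega>'. \<psi> s t \<omega>' (Y' j \<omega>)) (\<lambda>\<omega>'. \<psi> s t \<omega>' (Y \<omega>)))"
      unfolding sq_diff_def
      by (intro nn_integral_eq_integral sq_bump_integrable \<psi>_eval_measurable st) simp
    finally show ?thesis .
  qed
  have H_meas: "H j \<in> borel_measurable \<Omega>" for j
  proof -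
    have "(\<lambda>p. (fst p, \<psi> s t (snd p))) \<in> flow_algebra {..s} \<Otimes>\<^sub>M \<Omega> \<rightarrow>\<^sub>M flow_algebra {..s} \<Otimes>\<^sub>M Fspace"
      by (intro measurable_Pair measurable_fst measurable_compose[OF measurable_snd \<psi>_measurable[OF st]])
    from measurable_compose[OF this h]
    have "(\<lambda>(\<omega>, \<omega>'). h j (\<omega>, \<psi> s t \<omega>')) \<in> borel_measurable (flow_algebra {..s} \<Otimes>\<^sub>M \<Omega>)"
      by (simp add: case_prod_unfold)
    then have "H j \<in> borel_measurable (flow_algebra {..s})"
      unfolding H_def by (rule borel_measurable_nn_integral)
    then show ?thesis by (rule measurable_from_flow_algebra)
  qed
  have sq: "ennreal (sq_diff i (\<lambda>\<omega>. J (t - s) (\<psi> s t \<omega>) (Y' j \<omega>)) (\<lambda>\<omega>. J (t - s) (\<psi> s t \<omega>) (Y \<omega>))) = (\<integral>\<^sup>+\<omega>. H j \<omega> \<partial>\<Omega>)" for j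
  proof -
    have "ennreal (sq_diff i (\<lambda>\<omega>. J (t - s) (\<psi> s t \<omega>) (Y' j \<omega>)) (\<lambda>\<omega>. J (t - s) (\<psi> s t \<omega>) (Y \<omega>)))
      = (\<integral>\<^sup>+\<omega>. h j (\<omega>, \<psi> s t \<omega>) \<partial>\<Omega>)"
      unfolding sq_diff_def h_def fst_conv snd_conv
      by (intro nn_integral_eq_integral[symmetric] sq_bump_integrable J\<Omega> Y Yj) simp
    then show ?thesis unfolding H_def flow_fubini[OF st h] .
  qed
  have "(\<lambda>j. \<integral>\<^sup>+\<omega>. H j \<omega> \<partial>\<Omega>) \<longlonglongrightarrow> (\<integral>\<^sup>+\<omega>. 0 \<partial>\<Omega>)"
  proof (rule nn_integral_dominated_convergence[where w="\<lambda>_. 1"])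
    show "AE \<omega> in \<Omega>. H j \<omega> \<le> 1" for j
      using sq_diff_le_1 by (intro AE_I2) (simp add: H_eq ennreal_le_1)
    show "AE \<omega> in \<Omega>. (\<lambda>j. H j \<omega>) \<longlonglongrightarrow> 0"
    proof (rule AE_I2)
      fix \<omega> assume "\<omega> \<in> space \<Omega>"
      from tendsto_ennrealI[OF flow_space_continuous[OF st lim[OF this], of i]]
      show "(\<lambda>j. H j \<omega>) \<longlonglongrightarrow> 0" by (simp add: H_eq)
    qed
  qed (use H_meas in \<open>simp_all add: emeasure_space_1\<close>)
  then have "(\<lambda>j. ennreal (sq_diff i (\<lambda>\<omega>. J (t - s) (\<psi> s t \<omega>) (Y' j \<omega>)) (\<lambda>\<omega>. J (t - s) (\<psi> s t \<omega>) (Y \<omega>)))) \<longlonglongrightarrow> ennreal 0"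
    by (simp add: sq)
  then show ?thesis
    by (rule tendsto_ennrealD) (simp_all add: sq_diff_nonneg)
qed

text \<open>On the piece where \<open>I\<close> equals \<open>i\<close> the starting point
  \<open>d i\<close> is deterministic, so independence of past and future gives the product of
  \<open>prob (B i)\<close> with a separation probability. The pieces sum up to
  \<open>A\<close>.\<close>

lemma \<Psi>_countable_prob:
  assumes A: "A \<in> sets (flow_algebra {..s})"
    and I: "I \<in> flow_algebra {..s} \<rightarrow>\<^sub>M count_space UNIV"
  shows "prob {\<omega>\<in>A. dist x (d (I \<omega> :: nat)) < eps P \<delta> k x \<and> 1 / 2 ^ k \<le> \<Psi>_dist s x (d (I \<omega>)) \<omega>} \<le> 1 / 2 ^ k * prob A"
proof -
  define B where "B i = A \<inter> (I -` {i} \<inter> space \<Omega>)" for i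
  define C where "C i = (if dist x (d i) < eps P \<delta> k x then B i \<inter> {\<omega>\<in>space \<Omega>. 1 / 2 ^ k \<le> \<Psi>_dist s x (d i) \<omega>} else {})" for i
  have Asp: "A \<subseteq> space \<Omega>" using sets.sets_into_space[OF A] by simp
  have B: "B i \<in> sets (flow_algebra {..s})" for i
    unfolding B_def using A measurable_sets[OF I, of "{i}"] by auto
  have Bev: "B i \<in> events" for i using B flow_algebra_events by blast
  have D: "{\<omega>\<in>space \<Omega>. 1 / 2 ^ k \<le> \<Psi>_dist s x (d i) \<omega>} \<in> sets (flow_algebra {s..})" for i
  proof -
    have "{\<omega>\<in>space (flow_algebra {s..}). 1 / 2 ^ k \<le> \<Psi>_dist s x (d i) \<omega>} \<in> sets (flow_algebra {s..})"
      using \<Psi>_dist_future_measurable[of s x "d i"] by measurable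
    then show ?thesis by simp
  qed
  have Cev: "C i \<in> events" for i
    using Bev D flow_algebra_events by (auto simp: C_def intro!: sets.Int)
  have disj: "disjoint_family B" "disjoint_family C"
    by (auto simp: disjoint_family_on_def B_def C_def)
  have le: "prob (C i) \<le> 1 / 2 ^ k * prob (B i)" for i
  proof (cases "dist x (d i) < eps P \<delta> k x")
    case True
    have "prob (C i) = prob (B i) * prob {\<omega>\<in>space \<Omega>. 1 / 2 ^ k \<le> \<Psi>_dist s x (d i) \<omega>}"
      using True by (simp add: C_def flow_algebra_prob_Int[OF B D])
    also have "\<dots> = prob (B i) * separation_prob P \<delta> k x (d i)"
      by (simp add: separation_prob_eq[of _ _ _ s])
    also have "\<dots> \<le> prob (B i) * (1 / 2 ^ k)"
      by (intro mult_left_mono separation_prob_ball True) simp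
    finally show ?thesis by (simp add: mult.commute)
  qed (simp add: C_def)
  have sumC: "(\<lambda>i. prob (C i)) sums prob (\<Union>i. C i)"
    using Cev disj by (intro finite_measure_UNION) auto
  have "(\<lambda>i. prob (B i)) sums prob (\<Union>i. B i)"
    using Bev disj by (intro finite_measure_UNION) auto
  from sums_le[OF le sumC sums_mult[OF this]] have "prob (\<Union>i. C i) \<le> 1 / 2 ^ k * prob (\<Union>i. B i)" .
  moreover have "(\<Union>i. B i) = A" using Asp by (auto simp: B_def)
  moreover have "(\<Union>i. C i) = {\<omega>\<in>A. dist x (d (I \<omega>)) < eps P \<delta> k x \<and> 1 / 2 ^ k \<le> \<Psi>_dist s x (d (I \<omega>)) \<omega>}"
    using Asp by (auto simp: B_def C_def split: if_splits)
  ultimately show ?thesis by simp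
qed

definition \<Phi>_dist :: "real \<Rightarrow> 'a \<Rightarrow> nat \<Rightarrow> 'w \<Rightarrow> real"
  where "\<Phi>_dist s x n \<omega> = path_dist \<delta> (shift s (\<Psi> s x \<omega>)) (shift s (restrict_from s (\<Phi> \<omega> n)))"

lemma \<Phi>_restrict_cylinder: "cylinder_measurable \<Omega> (\<lambda>\<omega>. restrict_from s (\<Phi> \<omega> n))"
  using \<Phi>_cylinder[of n] unfolding cylinder_measurable_def
  by (simp add: extend_restrict_from Pi_iff restrict_from_paths)

lemma \<Phi>_dist_measurable: "\<Phi>_dist s x n \<in> borel_measurable \<Omega>"
  unfolding \<Phi>_dist_def by (intro measurable_path_dist cylinder_measurable_shift \<Psi>_cylinder \<Phi>_restrict_cylinder)

text \<open>Given the past, \<open>\<Phi>\<^sub>n\<close> after time \<open>s\<close> is a copy of the flow started at the random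
  point \<open>\<Phi>\<^sub>n(s)\<close>, which is approximated by random points with countably many values.\<close>

lemma skeleton_separation:
  assumes Sn: "S n \<le> s" and A: "A \<in> sets (flow_algebra {..s})"
    and near: "\<And>\<omega>. \<omega> \<in> A \<Longrightarrow> dist x (snd (\<Phi> \<omega> n) s) < eps P \<delta> k x"
  shows "prob {\<omega>\<in>A. 1 / 2 ^ k < \<Phi>_dist s x n \<omega>} \<le> 1 / 2 ^ k * prob A"
proof -
  define Y where "Y \<omega> = snd (\<Phi> \<omega> n) s" for \<omega>
  have Y: "Y \<in> flow_algebra {..s} \<rightarrow>\<^sub>M borel"
    unfolding Y_def by (rule \<Phi>_past_measurable[OF Sn])
  have Asp: "A \<subseteq> space \<Omega>" using sets.sets_into_space[OF A] by simp
  have Aev: "A \<in> events" using A flow_algebra_events by blast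
  define d where "d i = from_nat_into (dense_set :: 'a set) i" for i
  \<comment> \<open>The least admissible index is a measurable choice of a dense point within
    1/(j+1) of \<open>Y\<close>, and it is determined by the past.\<close>
  define I where "I j \<omega> = (LEAST i. dist (d i) (Y \<omega>) < inverse (real (Suc j)))" for j \<omega>
  have ex: "\<exists>i. dist (d i) y < inverse (real (Suc j))" for y and j :: nat
  proof -
    obtain z where z: "z \<in> dense_set" "z \<in> ball y (inverse (real (Suc j)))"
      using dense_set(2)[of "ball y (inverse (real (Suc j)))"] by (auto simp del: of_nat_Suc)
    then obtain i where "d i = z" using from_nat_into_surj[OF dense_set(1)] unfolding d_def by metis
    with z show ?thesis by (auto simp: dist_commute)
  qed
  have near_d: "dist (d (I j \<omega>)) (Y \<omega>) < inverse (real (Suc j))" for j \<omega>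
    unfolding I_def by (rule LeastI_ex[OF ex])
  have I: "I j \<in> flow_algebra {..s} \<rightarrow>\<^sub>M count_space UNIV" for j
    unfolding I_def using Y by measurable
  have I\<Omega>: "I j \<in> \<Omega> \<rightarrow>\<^sub>M count_space UNIV" for j by (rule measurable_from_flow_algebra[OF I])
  have d_lim: "(\<lambda>j. d (I j \<omega>)) \<longlonglongrightarrow> Y \<omega>" for \<omega>
  proof -
    have "(\<lambda>j. dist (d (I j \<omega>)) (Y \<omega>)) \<longlonglongrightarrow> 0"
      by (rule Lim_null_comparison[OF _ LIMSEQ_inverse_real_of_nat])
        (use near_d in \<open>auto intro!: always_eventually less_imp_le\<close>)
    then show ?thesis by (rule tendsto_dist_iff[THEN iffD2])
  qed
  define Z where "Z j \<omega> = \<Psi> s (d (I j \<omega>)) \<omega>" for j \<omega>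
  have Zm: "(\<lambda>\<omega>. extend (Z j \<omega>) t) \<in> borel_measurable \<Omega>" for j t
    unfolding Z_def
    by (rule measurable_compose_countable[where f="\<lambda>i \<omega>. extend (\<Psi> s (d i) \<omega>) t", OF \<Psi>_measurable I\<Omega>])
  define V where "V \<omega> = restrict_from s (\<Phi> \<omega> n)" for \<omega>
  have V: "cylinder_measurable \<Omega> V" unfolding V_def by (rule \<Phi>_restrict_cylinder)
  have "\<exists>r :: nat \<Rightarrow> nat. strict_mono r \<and> (AE \<omega> in \<Omega>. limitin (path_topology \<delta>) (\<lambda>j. Z (r j) \<omega>) (V \<omega>) sequentially)"
  proof (rule path_subsequence_to[OF Zm _ _ V])
    show "fst (V \<omega>) = s" for \<omega> by (simp add: V_def)
    show "AE \<omega> in \<Omega>. (\<lambda>j. fst (Z j \<omega>)) \<longlonglongrightarrow> s"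
      by (rule AE_I2) (simp add: Z_def \<Psi>_fst)
    have "AE \<omega> in \<Omega>. \<forall>i. \<forall>N. dist (0, undefined) (s, d i) < real N \<longrightarrow> \<Psi> s (d i) \<omega> \<in> tight \<omega> N"
      by (subst AE_all_countable) (intro allI \<Psi>_tight)
    then show "AE \<omega> in \<Omega>. \<exists>N. \<forall>j. Z j \<omega> \<in> tight \<omega> N"
    proof eventually_elim
      case (elim \<omega>)
      have "(\<lambda>j. (s, d (I j \<omega>))) \<longlonglongrightarrow> (s, Y \<omega>)" by (intro tendsto_intros d_lim)
      then have "bounded (range (\<lambda>j. (s, d (I j \<omega>))))" by (rule convergent_imp_bounded)
      then obtain e where e: "\<forall>p\<in>range (\<lambda>j. (s, d (I j \<omega>))). dist (0, undefined) p \<le> e"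
        unfolding bounded_any_center[where a="(0, undefined)"] by blast
      obtain N where N: "e < real N" using reals_Archimedean2 by blast
      have "dist (0, undefined) (s, d (I j \<omega>)) < real N" for j
        using e N by (meson le_less_trans rangeI)
      then show ?case using elim unfolding Z_def by blast
    qed
    fix t i assume t: "s < t"
    have st: "s \<le> t" using t by simp
    \<comment> \<open>The null set has to be common to all \<open>i\<close>, because a random index
      is inserted next.\<close>
    have "AE \<omega> in \<Omega>. \<forall>i. extend (\<Psi> s (d i) \<omega>) t = J (t - s) (\<psi> s t \<omega>) (d i)"
      unfolding AE_all_countable
    proof
      fix i show "AE \<omega> in \<Omega>. extend (\<Psi> s (d i) \<omega>) t = J (t - s) (\<psi> s t \<omega>) (d i)"
        using \<Psi>_AE[OF st, of "d i"] J_AE[OF st, of "d i"] by eventually_elim simp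
    qed
    then have Z_AE: "AE \<omega> in \<Omega>. extend (Z j \<omega>) t = J (t - s) (\<psi> s t \<omega>) (d (I j \<omega>))" for j
      by eventually_elim (simp add: Z_def)
    have V_AE: "AE \<omega> in \<Omega>. extend (V \<omega>) t = J (t - s) (\<psi> s t \<omega>) (Y \<omega>)"
      using \<Phi>_AE[OF order_trans[OF Sn st]] \<Phi>_AE[OF Sn] J_compose[OF Sn st, of "X n"] AE_space
    proof eventually_elim
      case (elim \<omega>)
      have "extend (V \<omega>) t = snd (\<Phi> \<omega> n) t"
        using Sn t by (simp add: V_def extend_restrict_from extend_eq_snd \<Phi>_fst elim(4))
      then show ?case using elim(1-3) by (simp add: Y_def)
    qed
    have dI: "(\<lambda>\<omega>. d (I j \<omega>)) \<in> flow_algebra {..s} \<rightarrow>\<^sub>M borel" for j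
      by (rule measurable_compose[OF I]) simp
    have "sq_diff i (\<lambda>\<omega>. extend (Z j \<omega>) t) (\<lambda>\<omega>. extend (V \<omega>) t)
      = sq_diff i (\<lambda>\<omega>. J (t - s) (\<psi> s t \<omega>) (d (I j \<omega>))) (\<lambda>\<omega>. J (t - s) (\<psi> s t \<omega>) (Y \<omega>))" for j
    proof (rule sq_diff_cong_AE[OF Zm _ _ _ Z_AE V_AE])
      show "(\<lambda>\<omega>. extend (V \<omega>) t) \<in> borel_measurable \<Omega>" using V by (simp add: cylinder_measurable_def)
    qed (use st in \<open>auto intro!: J_measurable_compose \<psi>_measurable measurable_from_flow_algebra[OF dI] measurable_from_flow_algebra[OF Y]\<close>)
    then show "(\<lambda>j. sq_diff i (\<lambda>\<omega>. extend (Z j \<omega>) t) (\<lambda>\<omega>. extend (V \<omega>) t)) \<longlonglongrightarrow> 0"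
      using flow_composed_convergence[where Y'="\<lambda>j \<omega>. d (I j \<omega>)", OF st Y dI d_lim, of i] by simp
  qed
  then obtain r :: "nat \<Rightarrow> nat" where r: "strict_mono r"
    "AE \<omega> in \<Omega>. limitin (path_topology \<delta>) (\<lambda>j. Z (r j) \<omega>) (V \<omega>) sequentially" by blast
  define D where "D j \<omega> = \<Psi>_dist s x (d (I j \<omega>)) \<omega>" for j \<omega>
  have Dm [measurable]: "D j \<in> borel_measurable \<Omega>" for j
    unfolding D_def by (rule measurable_compose_countable[where f="\<lambda>i \<omega>. \<Psi>_dist s x (d i) \<omega>", OF \<Psi>_dist_measurable I\<Omega>])
  have dm [measurable]: "(\<lambda>\<omega>. dist x (d (I j \<omega>))) \<in> borel_measurable \<Omega>" for j
    by (rule measurable_compose[OF I\<Omega>]) simp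
  have D_lim: "AE \<omega> in \<Omega>. (\<lambda>j. D (r j) \<omega>) \<longlonglongrightarrow> \<Phi>_dist s x n \<omega>"
    using r(2) AE_space
  proof eventually_elim
    case (elim \<omega>)
    have "limitin (path_topology \<delta>) (\<lambda>j. \<Psi> s x \<omega>) (\<Psi> s x \<omega>) sequentially"
      using \<Psi>_paths[OF elim(2)] by (simp add: limitin_const_iff)
    then show ?case
      using elim(1) unfolding D_def \<Psi>_dist_def \<Phi>_dist_def V_def Z_def
      by (intro path_dist_limit limitin_shift shift_paths \<Psi>_paths elim(2))
  qed
  \<comment> \<open>Both strict inequalities, on the initial distance and on
    \<open>\<Phi>_dist\<close>, are open conditions and hold eventually for the approximations. The
    weak inequality in \<open>G\<close> matches \<open>\<Psi>_countable_prob\<close>.\<close>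
  define G where "G j = {\<omega>\<in>A. dist x (d (I (r j) \<omega>)) < eps P \<delta> k x \<and> 1 / 2 ^ k \<le> D (r j) \<omega>}" for j
  have G: "prob (G j) \<le> 1 / 2 ^ k * prob A" for j
    unfolding G_def D_def by (rule \<Psi>_countable_prob[OF A I])
  have Gev: "G j \<in> events" for j
  proof -
    have "G j = A \<inter> {\<omega>\<in>space \<Omega>. dist x (d (I (r j) \<omega>)) < eps P \<delta> k x \<and> 1 / 2 ^ k \<le> D (r j) \<omega>}"
      using Asp by (auto simp: G_def)
    also have "\<dots> \<in> events" using Aev by measurable
    finally show ?thesis .
  qed
  define E where "E m = (\<Inter>j\<in>{m..}. G j)" for m
  have Eev: "E m \<in> events" for m unfolding E_def using Gev by (intro sets.countable_INT') auto
  have "incseq E" unfolding incseq_def E_def by auto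
  then have "(\<lambda>m. prob (E m)) \<longlonglongrightarrow> prob (\<Union>m. E m)"
    using Eev by (intro finite_Lim_measure_incseq) auto
  moreover have "prob (E m) \<le> 1 / 2 ^ k * prob A" for m
  proof -
    have "prob (E m) \<le> prob (G m)" using Gev by (intro finite_measure_mono) (auto simp: E_def)
    then show ?thesis using G[of m] by simp
  qed
  ultimately have union: "prob (\<Union>m. E m) \<le> 1 / 2 ^ k * prob A" by (intro LIMSEQ_le_const2) auto
  have "prob {\<omega>\<in>A. 1 / 2 ^ k < \<Phi>_dist s x n \<omega>} \<le> prob (\<Union>m. E m)"
  proof (rule finite_measure_mono_AE)
    show "(\<Union>m. E m) \<in> events" using Eev by auto
    show "AE \<omega> in \<Omega>. \<omega> \<in> {\<omega>\<in>A. 1 / 2 ^ k < \<Phi>_dist s x n \<omega>} \<longrightarrow> \<omega> \<in> (\<Union>m. E m)"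
      using D_lim
    proof eventually_elim
      case (elim \<omega>)
      show ?case
      proof
        assume "\<omega> \<in> {\<omega>\<in>A. 1 / 2 ^ k < \<Phi>_dist s x n \<omega>}"
        then have \<omega>: "\<omega> \<in> A" "1 / 2 ^ k < \<Phi>_dist s x n \<omega>" by auto
        have "(\<lambda>j. dist x (d (I (r j) \<omega>))) \<longlonglongrightarrow> dist x (Y \<omega>)"
          using LIMSEQ_subseq_LIMSEQ[OF d_lim r(1)] by (intro tendsto_intros) (simp add: o_def)
        from order_tendstoD(2)[OF this near[OF \<omega>(1), folded Y_def]] order_tendstoD(1)[OF elim \<omega>(2)]
        have "\<forall>\<^sub>F j in sequentially. \<omega> \<in> G j"
          by eventually_elim (simp add: G_def \<omega>(1) less_imp_le)
        then obtain m where "\<forall>j\<ge>m. \<omega> \<in> G j" by (auto simp: eventually_sequentially)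
        then show "\<omega> \<in> (\<Union>m. E m)" by (auto simp: E_def)
      qed
    qed
  qed
  then show ?thesis using union by simp
qed

text \<open>The index used by \<theta> is random but determined by the past of \<open>s\<close>.
  Splitting according to its value reduces the estimate to \<open>skeleton_separation\<close> for a
  fixed \<open>n\<close>.\<close>

lemma theta_modification:
  assumes selector: "limit_point_selector \<delta> l" and st: "s \<le> t"
  shows "AE \<omega> in \<Omega>. theta P \<delta> l (\<Phi> \<omega>) s t x = \<psi> s t \<omega> x"
proof -
  interpret maps: skeleton_maps \<delta> P l
    by unfold_locales (rule selector, rule eps_pos, rule eps_measurable)
  define K where "K k \<omega> = approx_index P \<delta> (\<Phi> \<omega>) s x k" for k \<omega>
  \<comment> \<open>The condition \<open>S n \<le> s\<close> is built in: where \<Phi> is not a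
    skeleton, \<open>LEAST\<close> may return an index whose path has not started at time
    \<open>s\<close>.\<close>
  define A where "A k n = (if S n \<le> s then {\<omega>\<in>space \<Omega>. K k \<omega> = n \<and> dist (snd (\<Phi> \<omega> n) s) x < eps P \<delta> k x} else {})" for k n
  define B where "B k n = {\<omega>\<in>A k n. 1 / 2 ^ k < \<Phi>_dist s x n \<omega>}" for k n
  have pred: "{\<omega>\<in>space \<Omega>. S n \<le> s \<and> dist (snd (\<Phi> \<omega> n) s) x < eps P \<delta> k x} \<in> sets (flow_algebra {..s})" for n k
  proof (cases "S n \<le> s")
    case True
    have "{\<omega>\<in>space (flow_algebra {..s}). dist (snd (\<Phi> \<omega> n) s) x < eps P \<delta> k x} \<in> sets (flow_algebra {..s})"
      using \<Phi>_past_measurable[OF True] by measurable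
    with True show ?thesis by simp
  qed simp
  have K: "K k \<in> flow_algebra {..s} \<rightarrow>\<^sub>M count_space UNIV" for k
  proof -
    have "(\<lambda>\<omega>. LEAST n. S n \<le> s \<and> dist (snd (\<Phi> \<omega> n) s) x < eps P \<delta> k x) \<in> flow_algebra {..s} \<rightarrow>\<^sub>M count_space UNIV"
      by (rule measurable_Least) (simp add: pred pred_def)
    then show ?thesis
      by (rule measurable_cong[THEN iffD1, rotated]) (simp add: K_def approx_index_def active_def \<Phi>_fst)
  qed
  have A: "A k n \<in> sets (flow_algebra {..s})" for k n
  proof -
    have "A k n = (K k -` {n} \<inter> space \<Omega>) \<inter> {\<omega>\<in>space \<Omega>. S n \<le> s \<and> dist (snd (\<Phi> \<omega> n) s) x < eps P \<delta> k x}"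
      unfolding A_def by (cases "S n \<le> s") auto
    also have "\<dots> \<in> sets (flow_algebra {..s})"
    proof (rule sets.Int[OF _ pred])
      show "K k -` {n} \<inter> space \<Omega> \<in> sets (flow_algebra {..s})"
        using measurable_sets[OF K[of k], of "{n}"] by simp
    qed
    finally show ?thesis .
  qed
  have Aev: "A k n \<in> events" for k n using A flow_algebra_events by blast
  have Asp: "A k n \<subseteq> space \<Omega>" for k n using sets.sets_into_space[OF Aev] .
  have Bev: "B k n \<in> events" for k n
  proof -
    have [measurable]: "\<Phi>_dist s x n \<in> borel_measurable \<Omega>" by (rule \<Phi>_dist_measurable)
    have "B k n = A k n \<inter> {\<omega>\<in>space \<Omega>. 1 / 2 ^ k < \<Phi>_dist s x n \<omega>}"
      using Asp by (auto simp: B_def)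
    also have "\<dots> \<in> events" using Aev by measurable
    finally show ?thesis .
  qed
  have le: "prob (B k n) \<le> 1 / 2 ^ k * prob (A k n)" for k n
  proof (cases "S n \<le> s")
    case True
    show ?thesis
      unfolding B_def by (rule skeleton_separation[OF True A]) (simp add: A_def True dist_commute)
  qed (simp add: B_def A_def)
  have disj: "disjoint_family (A k)" "disjoint_family (B k)" for k
    by (auto simp: disjoint_family_on_def A_def B_def)
  \<comment> \<open>Each bound carries the factor \<open>prob (A k n)\<close>, and the events
    \<open>A k n\<close> are disjoint in \<open>n\<close>; summing over infinitely many possible
    indices therefore costs nothing.\<close>
  have B_le: "prob (\<Union>n. B k n) \<le> (1 / 2) ^ k" for k
  proof -
    have B_sums: "(\<lambda>n. prob (B k n)) sums prob (\<Union>n. B k n)"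
      using Bev disj by (intro finite_measure_UNION) auto
    have "(\<lambda>n. prob (A k n)) sums prob (\<Union>n. A k n)"
      using Aev disj by (intro finite_measure_UNION) auto
    from sums_le[OF le B_sums sums_mult[OF this]]
    have "prob (\<Union>n. B k n) \<le> 1 / 2 ^ k * prob (\<Union>n. A k n)" .
    also have "\<dots> \<le> 1 / 2 ^ k * 1" by (intro mult_left_mono) auto
    finally show ?thesis by (simp add: power_divide)
  qed
  have "AE \<omega> in \<Omega>. \<forall>\<^sub>F k in sequentially. \<omega> \<in> space \<Omega> - (\<Union>n. B k n)"
  proof (rule borel_cantelli_AE1)
    show "(\<Union>n. B k n) \<in> events" for k using Bev by auto
    have "summable (\<lambda>k. (1 / 2 :: real) ^ k)" by (rule summable_geometric) simp
    then show "summable (\<lambda>k. prob (\<Union>n. B k n))"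
      by (rule summable_comparison_test') (simp add: B_le)
  qed (simp add: emeasure_eq_measure)
  moreover note \<Psi>_AE[OF st, of x] TF4 AE_space
  ultimately show ?thesis
  proof eventually_elim
    case (elim \<omega>)
    note sk = elim(3)
    have V: "restrict_from s (\<Phi> \<omega> n) \<in> paths" for n
      by (rule restrict_from_paths[OF \<Phi>_paths[OF elim(4)]])
    have inA: "\<omega> \<in> A k (K k \<omega>)" for k
      using maps.approx_index[OF sk, of s x k] elim(4) by (simp add: A_def K_def active_def \<Phi>_fst)
    have "(\<lambda>k. path_dist \<delta> (shift s (restrict_from s (\<Phi> \<omega> (K k \<omega>)))) (shift s (\<Psi> s x \<omega>))) \<longlonglongrightarrow> 0"
    proof (rule Lim_null_comparison)
      show "(\<lambda>k. (1/2::real) ^ k) \<longlonglongrightarrow> 0" by (rule LIMSEQ_power_zero) simp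
      show "\<forall>\<^sub>F k in sequentially. norm (path_dist \<delta> (shift s (restrict_from s (\<Phi> \<omega> (K k \<omega>)))) (shift s (\<Psi> s x \<omega>))) \<le> (1/2) ^ k"
        using elim(1)
      proof eventually_elim
        case (elim k)
        then have "\<omega> \<notin> B k (K k \<omega>)" by blast
        then have "\<Phi>_dist s x (K k \<omega>) \<omega> \<le> 1 / 2 ^ k" using inA[of k] by (simp add: B_def)
        then show ?case by (simp add: \<Phi>_dist_def PM.commute power_divide)
      qed
    qed
    then have "limitin (path_topology \<delta>) (\<lambda>k. shift s (restrict_from s (\<Phi> \<omega> (K k \<omega>)))) (shift s (\<Psi> s x \<omega>)) sequentially"
      using shift_paths[OF V] shift_paths[OF \<Psi>_paths[OF elim(4)]] by (subst limitin_path_topology_iff) auto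
    from limitin_path_eval[OF shift_paths[OF V] this, of "t - s"]
    have lim: "(\<lambda>k. snd (\<Phi> \<omega> (K k \<omega>)) t) \<longlonglongrightarrow> extend (\<Psi> s x \<omega>) t"
    proof -
      have "S (K k \<omega>) \<le> t" for k
        using maps.approx_index(1)[OF sk, of s x k] st elim(4) by (simp add: K_def active_def \<Phi>_fst)
      then show ?thesis
        using \<open>(\<lambda>k. extend (shift s (restrict_from s (\<Phi> \<omega> (K k \<omega>)))) (t - s)) \<longlonglongrightarrow> extend (shift s (\<Psi> s x \<omega>)) (t - s)\<close> st
        by (simp add: extend_shift extend_restrict_from extend_eq_snd \<Phi>_fst elim(4))
    qed
    \<comment> \<open>The selector provides a limit along some subsequence only. The whole sequence
      of values at \<open>t\<close> converges to that of \<Psi>, so every choice gives the same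
      value.\<close>
    obtain r :: "nat \<Rightarrow> nat" where r: "strict_mono r"
      "\<forall>t\<ge>s. (\<lambda>k. snd (\<Phi> \<omega> (approx_index P \<delta> (\<Phi> \<omega>) s x (r k))) t) \<longlonglongrightarrow> theta P \<delta> l (\<Phi> \<omega>) s t x"
      using maps.theta_limit(4)[OF sk] by blast
    have "(\<lambda>k. snd (\<Phi> \<omega> (K (r k) \<omega>)) t) \<longlonglongrightarrow> theta P \<delta> l (\<Phi> \<omega>) s t x"
      using r(2) st by (simp add: K_def)
    moreover have "(\<lambda>k. snd (\<Phi> \<omega> (K (r k) \<omega>)) t) \<longlonglongrightarrow> extend (\<Psi> s x \<omega>) t"
      using LIMSEQ_subseq_LIMSEQ[OF lim r(1)] by (simp add: o_def)
    ultimately have "theta P \<delta> l (\<Phi> \<omega>) s t x = extend (\<Psi> s x \<omega>) t" by (rule LIMSEQ_unique)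
    then show ?case using elim(2) by simp
  qed
qed

end

theorem theorem3p6:
  fixes P :: "'a::{heine_borel,polish_space} transition"
    and \<Omega> :: "'w measure"
    and \<psi> :: "real \<Rightarrow> real \<Rightarrow> 'w \<Rightarrow> 'a \<Rightarrow> 'a"
    and \<delta> :: "(real \<Rightarrow> 'a) \<Rightarrow> (real \<Rightarrow> 'a) \<Rightarrow> real"
    and S :: "nat \<Rightarrow> real" and X :: "nat \<Rightarrow> 'a"
    and \<Phi> :: "'w \<Rightarrow> nat \<Rightarrow> 'a path"
    and l :: "(nat \<Rightarrow> 'a path) \<Rightarrow> 'a path"
    and \<Omega>0 :: "'w set"
    and \<theta> :: "real \<Rightarrow> real \<Rightarrow> 'w \<Rightarrow> 'a \<Rightarrow> 'a"
  assumes transition: "consistent_coalescing P" and TF3: "TF3 P"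
    and flow: "stochastic_flow P \<Omega> \<psi>"
    and metric: "loc_unif_metric \<delta>"
    and dense: "closure (range (\<lambda>n. (S n, X n))) = UNIV"
    and skeleton: "random_skeleton \<Omega> \<psi> S X \<Phi>"
    and TF4: "AE \<omega> in \<Omega>. \<Phi> \<omega> \<in> skeletons \<delta>"
    and full: "\<Omega>0 \<in> sets \<Omega>" "measure \<Omega> \<Omega>0 = 1" "\<And>\<omega>. \<omega> \<in> \<Omega>0 \<Longrightarrow> \<Phi> \<omega> \<in> skeletons \<delta>"
    and selector: "limit_point_selector \<delta> l"
    and theta: "\<And>s t \<omega> x. \<theta> s t \<omega> x = theta P \<delta> l (\<Phi> \<omega>) s t x"
  shows "(\<forall>s x. \<forall>\<omega>\<in>\<Omega>0. \<theta> s s \<omega> x = x) \<and>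
    (\<lambda>(s, t, x, \<omega>). \<theta> s t \<omega> x) \<in>
      restrict_space (borel \<Otimes>\<^sub>M borel \<Otimes>\<^sub>M borel \<Otimes>\<^sub>M \<Omega>) {(s, t, x, \<omega>). s \<le> t \<and> \<omega> \<in> \<Omega>0}
        \<rightarrow>\<^sub>M borel \<and>
    (\<forall>s x. \<forall>\<omega>\<in>\<Omega>0. continuous_on {s..} (\<lambda>t. \<theta> s t \<omega> x)) \<and>
    (\<forall>s t x. s \<le> t \<longrightarrow> (AE \<omega> in \<Omega>. \<theta> s t \<omega> x = \<psi> s t \<omega> x)) \<and>
    (\<forall>n s t. \<forall>\<omega>\<in>\<Omega>0. S n \<le> s \<and> s \<le> t \<longrightarrow> \<theta> s t \<omega> (snd (\<Phi> \<omega> n) s) = snd (\<Phi> \<omega> n) t)"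
proof -
  interpret F: skeleton_flow P \<Omega> \<psi> \<delta> S X \<Phi>
    by unfold_locales (fact transition flow metric dense skeleton TF4)+
  interpret M: skeleton_maps \<delta> P l
    by unfold_locales (rule selector, rule F.eps_pos, rule F.eps_measurable)
  have \<Omega>0_space: "\<omega> \<in> space \<Omega>" if "\<omega> \<in> \<Omega>0" for \<omega>
    using sets.sets_into_space[OF full(1)] that by blast
  show ?thesis
    unfolding theta
  proof (intro conjI allI ballI impI)
    show "theta P \<delta> l (\<Phi> \<omega>) s s x = x" if "\<omega> \<in> \<Omega>0" for s x \<omega>
      by (rule M.theta_start[OF full(3)[OF that]])
    show "(\<lambda>(s, t, x, \<omega>). theta P \<delta> l (\<Phi> \<omega>) s t x) \<in>
        restrict_space (borel \<Otimes>\<^sub>M borel \<Otimes>\<^sub>M borel \<Otimes>\<^sub>M \<Omega>) {(s, t, x, \<omega>). s \<le> t \<and> \<omega> \<in> \<Omega>0} \<rightarrow>\<^sub>M borel"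
      by (rule M.theta_measurable[OF full(1,3) F.\<Phi>_cylinder F.\<Phi>_fst])
    show "continuous_on {s..} (\<lambda>t. theta P \<delta> l (\<Phi> \<omega>) s t x)" if "\<omega> \<in> \<Omega>0" for s x \<omega>
      by (rule M.theta_continuous[OF full(3)[OF that]])
    show "AE \<omega> in \<Omega>. theta P \<delta> l (\<Phi> \<omega>) s t x = \<psi> s t \<omega> x" if "s \<le> t" for s t x
      by (rule F.theta_modification[OF selector that])
    show "theta P \<delta> l (\<Phi> \<omega>) s t (snd (\<Phi> \<omega> n) s) = snd (\<Phi> \<omega> n) t"
      if "\<omega> \<in> \<Omega>0" "S n \<le> s \<and> s \<le> t" for n s t \<omega>
      by (rule M.theta_skeleton[OF full(3)[OF that(1)]])
        (use that \<Omega>0_space in \<open>simp_all add: active_def F.\<Phi>_fst\<close>)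
  qed
qed

end
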